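(* Let $R$ be a covariance operator on $L^2(\mathbb{R})$ commuting with the metaplectic image $\mu(g_\theta)=e^{-i\theta H_{\mathrm{ell}}}$ (all $\theta\in\mathbb{R}$) of the elliptic one-parameter subgroup, generated by $H_{\mathrm{ell}}=\tfrac12(-\partial_t^2+t^2)$. This generator is the harmonic-oscillator Hamiltonian, with discrete simple spectrum $\{n+\tfrac12:n\ge0\}$ and the Hermite–Gauss functions $h_n(t)=H_n(t)e^{-t^2/2}$ (normalized) as an orthonormal eigenbasis of $L^2(\mathbb{R})$. Then $R$ is a function of $H_{\mathrm{ell}}$, and the Karhunen–Loève transform (KLT) of $R$ is the Hermite–Gauss basis, the eigenfunctions of the fractional Fourier transform (eigenvalues $e^{-i(n+1/2)\theta}$). The same conclusion holds for any linear canonical transform group conjugate to the elliptic class: if $R$ commutes with $V\mu(g_\theta)V^{-1}$ for all $\theta$, with $V$ a metaplectic operator, then $R$ is a function of $VH_{\mathrm{ell}}V^{-1}$, with eigenbasis the correspondingly scaled and chirped Hermite–Gauss functions $Vh_n$.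
   Context: A covariance operator is a compact positive semidefinite self-adjoint operator. The metaplectic representation $\mu$ is the unitary action on $L^2(\mathbb{R})$ of (the double cover of) $Sp(2,\mathbb{R})$, the linear symplectic maps of the time–frequency plane; its operators are the linear canonical transforms, and the operators $e^{-i\theta H_{\mathrm{ell}}}$ are the fractional Fourier transforms. $H_n$ is the $n$-th (physicists') Hermite polynomial. A KLT of $R$ is an orthonormal eigenbasis of $R$. *)

theory Defs
  imports "HOL-Analysis.Analysis" "HOL-Computational_Algebra.Polynomial"
begin

section \<open>The complex Hilbert space of square-integrable functions on the line\<close>

definition square_integrable :: "(real \<Rightarrow> complex) \<Rightarrow> bool" where
  "square_integrable f \<longleftrightarrow>
     f \<in> borel_measurable borel \<and> integrable lborel (\<lambda>t. (cmod (f t))\<^sup>2)"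

definition l2_eq :: "(real \<Rightarrow> complex) \<Rightarrow> (real \<Rightarrow> complex) \<Rightarrow> bool" where
  "l2_eq f g \<longleftrightarrow> square_integrable f \<and> square_integrable g \<and> (AE t in lborel. f t = g t)"

lemma square_integrable_zero: "square_integrable (\<lambda>_. 0)"
  by (simp add: square_integrable_def)

lemma square_integrable_add:
  assumes "square_integrable f" "square_integrable g"
  shows "square_integrable (\<lambda>t. f t + g t)"
proof -
  have [measurable]: "f \<in> borel_measurable borel" "g \<in> borel_measurable borel"
    using assms by (auto simp: square_integrable_def)
  have "(cmod (f t + g t))\<^sup>2 \<le> 2 * (cmod (f t))\<^sup>2 + 2 * (cmod (g t))\<^sup>2" for t
  proof -
    have "(cmod (f t + g t))\<^sup>2 \<le> (cmod (f t) + cmod (g t))\<^sup>2"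
      by (intro power_mono norm_triangle_ineq norm_ge_zero)
    also have "\<dots> \<le> 2 * (cmod (f t))\<^sup>2 + 2 * (cmod (g t))\<^sup>2"
      using sum_squares_bound[of "cmod (f t)" "cmod (g t)"] by (simp add: power2_sum)
    finally show ?thesis .
  qed
  then have bound: "AE t in lborel. norm ((cmod (f t + g t))\<^sup>2)
      \<le> norm (2 * (cmod (f t))\<^sup>2 + 2 * (cmod (g t))\<^sup>2)"
    by simp
  have "integrable lborel (\<lambda>t. 2 * (cmod (f t))\<^sup>2 + 2 * (cmod (g t))\<^sup>2)"
    using assms by (simp add: square_integrable_def)
  moreover have "(\<lambda>t. (cmod (f t + g t))\<^sup>2) \<in> borel_measurable lborel" by measurable
  ultimately have "integrable lborel (\<lambda>t. (cmod (f t + g t))\<^sup>2)"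
    using bound by (rule Bochner_Integration.integrable_bound)
  then show ?thesis by (simp add: square_integrable_def)
qed

lemma square_integrable_cmult:
  "square_integrable f \<Longrightarrow> square_integrable (\<lambda>t. c * f t)"
  by (auto simp: square_integrable_def norm_mult power_mult_distrib)

lemma square_integrable_cnj_mult:
  assumes "square_integrable f" "square_integrable g"
  shows "integrable lborel (\<lambda>t. cnj (f t) * g t)"
proof (rule Bochner_Integration.integrable_bound)
  have [measurable]: "f \<in> borel_measurable borel" "g \<in> borel_measurable borel"
    using assms by (auto simp: square_integrable_def)
  have [measurable]: "cnj \<in> borel_measurable borel"
    by (intro borel_measurable_continuous_onI continuous_intros)
  show "(\<lambda>t. cnj (f t) * g t) \<in> borel_measurable lborel" by measurable
  show "integrable lborel (\<lambda>t. (cmod (f t))\<^sup>2 + (cmod (g t))\<^sup>2)"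
    using assms by (auto simp: square_integrable_def)
  have "cmod (f t) * cmod (g t) \<le> (cmod (f t))\<^sup>2 + (cmod (g t))\<^sup>2" for t
    using sum_squares_bound[of "cmod (f t)" "cmod (g t)"]
      mult_nonneg_nonneg[OF norm_ge_zero[of "f t"] norm_ge_zero[of "g t"]] by linarith
  then show "AE t in lborel. cmod (cnj (f t) * g t) \<le> norm ((cmod (f t))\<^sup>2 + (cmod (g t))\<^sup>2)"
    by (simp add: norm_mult)
qed

quotient_type l2 = "real \<Rightarrow> complex" / partial: l2_eq
proof (rule part_equivpI)
  show "\<exists>f. l2_eq f f"
    using square_integrable_zero by (auto simp: l2_eq_def)
  show "symp l2_eq"
    by (simp add: symp_def l2_eq_def eq_commute)
  show "transp l2_eq"
  proof (rule transpI)
    fix f g h assume *: "l2_eq f g" "l2_eq g h"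
    then have "AE t in lborel. f t = g t" "AE t in lborel. g t = h t"
      by (auto simp: l2_eq_def)
    then have "AE t in lborel. f t = h t" by eventually_elim simp
    with * show "l2_eq f h" by (simp add: l2_eq_def)
  qed
qed

lemma square_integrable_rep: "square_integrable (rep_l2 f)"
  using Quotient3_rep_reflp[OF Quotient3_l2, of f] by (simp add: l2_eq_def)

lemma rep_abs_l2: "square_integrable f \<Longrightarrow> AE t in lborel. rep_l2 (abs_l2 f) t = f t"
  using rep_abs_rsp_left[OF Quotient3_l2, of f f] by (simp add: l2_eq_def)

instantiation l2 :: ab_group_add
begin

lift_definition zero_l2 :: l2 is "\<lambda>_. 0"
  by (simp add: l2_eq_def square_integrable_zero)

lift_definition plus_l2 :: "l2 \<Rightarrow> l2 \<Rightarrow> l2" is "\<lambda>f g t. f t + g t"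
proof -
  fix f f' g g' assume *: "l2_eq f f'" "l2_eq g g'"
  then have "AE t in lborel. f t = f' t" "AE t in lborel. g t = g' t"
    by (auto simp: l2_eq_def)
  then have "AE t in lborel. f t + g t = f' t + g' t" by eventually_elim simp
  with * show "l2_eq (\<lambda>t. f t + g t) (\<lambda>t. f' t + g' t)"
    by (simp add: l2_eq_def square_integrable_add)
qed

lift_definition uminus_l2 :: "l2 \<Rightarrow> l2" is "\<lambda>f t. - f t"
  using square_integrable_cmult[of _ "-1"] by (auto simp: l2_eq_def)

definition minus_l2 :: "l2 \<Rightarrow> l2 \<Rightarrow> l2" where "minus_l2 f g = f + (- g)"

instance
proof
  fix f g h :: l2
  show "f + g + h = f + (g + h)"
    by transfer (auto simp: l2_eq_def add.assoc intro!: square_integrable_add)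
  show "f + g = g + f"
    by transfer (auto simp: l2_eq_def add.commute intro!: square_integrable_add)
  show "0 + f = f"
    by transfer (auto simp: l2_eq_def)
  show "- f + f = 0"
    by transfer (auto simp: l2_eq_def square_integrable_zero)
  show "f - g = f + - g" by (simp add: minus_l2_def)
qed

end

lift_definition cscale :: "complex \<Rightarrow> l2 \<Rightarrow> l2" is "\<lambda>c f t. c * f t"
  by (auto simp: l2_eq_def square_integrable_cmult)

text \<open>Conjugate-linear in the first argument.\<close>

lift_definition cinner :: "l2 \<Rightarrow> l2 \<Rightarrow> complex"
  is "\<lambda>f g. \<integral>t. cnj (f t) * g t \<partial>lborel"
proof -
  fix f f' g g' assume *: "l2_eq f f'" "l2_eq g g'"
  then have "AE t in lborel. f t = f' t" "AE t in lborel. g t = g' t"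
    by (auto simp: l2_eq_def)
  then have "AE t in lborel. cnj (f t) * g t = cnj (f' t) * g' t" by eventually_elim simp
  with * show "(\<integral>t. cnj (f t) * g t \<partial>lborel) = (\<integral>t. cnj (f' t) * g' t \<partial>lborel)"
    by (intro integral_cong_AE borel_measurable_integrable square_integrable_cnj_mult)
       (simp_all add: l2_eq_def)
qed

lemma cinner_add_left: "cinner (f + g) h = cinner f h + cinner g h"
  by transfer (simp add: l2_eq_def distrib_right square_integrable_cnj_mult)

lemma cinner_add_right: "cinner f (g + h) = cinner f g + cinner f h"
  by transfer (simp add: l2_eq_def distrib_left square_integrable_cnj_mult)

lemma cinner_cscale_left: "cinner (cscale c f) g = cnj c * cinner f g"
  by transfer (simp add: mult.assoc)

lemma cinner_cscale_right: "cinner f (cscale c g) = c * cinner f g"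
  by transfer (simp add: mult.left_commute)

lemma cinner_commute: "cinner f g = cnj (cinner g f)"
  by transfer (subst Bochner_Integration.integral_cnj [symmetric], simp add: mult.commute)

lemma cinner_self: "cinner f f = of_real (\<integral>t. (cmod (rep_l2 f t))\<^sup>2 \<partial>lborel)"
proof -
  have "cinner f f = (\<integral>t. cnj (rep_l2 f t) * rep_l2 f t \<partial>lborel)"
    by (simp add: cinner_def)
  also have "\<dots> = (\<integral>t. complex_of_real ((cmod (rep_l2 f t))\<^sup>2) \<partial>lborel)"
    by (intro Bochner_Integration.integral_cong refl)
       (simp only: complex_norm_square mult.commute)
  finally show ?thesis by (simp only: integral_complex_of_real)
qed

instantiation l2 :: real_vector
begin

definition scaleR_l2 :: "real \<Rightarrow> l2 \<Rightarrow> l2" where "scaleR_l2 r f = cscale (of_real r) f"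

instance
proof
  fix a b :: real and f g :: l2
  show "a *\<^sub>R (f + g) = a *\<^sub>R f + a *\<^sub>R g"
    unfolding scaleR_l2_def
    by transfer (auto simp: l2_eq_def distrib_left intro!: square_integrable_add square_integrable_cmult)
  show "(a + b) *\<^sub>R f = a *\<^sub>R f + b *\<^sub>R f"
    unfolding scaleR_l2_def
    by transfer (auto simp: l2_eq_def distrib_right intro!: square_integrable_add square_integrable_cmult)
  show "a *\<^sub>R b *\<^sub>R f = (a * b) *\<^sub>R f"
    unfolding scaleR_l2_def
    by transfer (auto simp: l2_eq_def mult.assoc intro!: square_integrable_cmult)
  show "1 *\<^sub>R f = f"
    unfolding scaleR_l2_def by transfer (auto simp: l2_eq_def)
qed

end

instantiation l2 :: real_inner
begin

definition inner_l2 :: "l2 \<Rightarrow> l2 \<Rightarrow> real" where "inner_l2 f g = Re (cinner f g)"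
definition norm_l2 :: "l2 \<Rightarrow> real" where "norm_l2 f = sqrt (inner f f)"
definition sgn_l2 :: "l2 \<Rightarrow> l2" where "sgn_l2 f = f /\<^sub>R norm f"
definition dist_l2 :: "l2 \<Rightarrow> l2 \<Rightarrow> real" where "dist_l2 f g = norm (f - g)"
definition uniformity_l2 :: "(l2 \<times> l2) filter" where
  "uniformity_l2 = (INF e\<in>{0<..}. principal {(f, g). dist f g < e})"
definition open_l2 :: "l2 set \<Rightarrow> bool" where
  "open_l2 U \<longleftrightarrow> (\<forall>f\<in>U. \<forall>\<^sub>F (f', g) in uniformity. f' = f \<longrightarrow> g \<in> U)"

instance
proof
  fix a :: real and f g h :: l2
  show "inner f g = inner g f"
    unfolding inner_l2_def by (subst cinner_commute) simp
  show "inner (f + g) h = inner f h + inner g h"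
    by (simp add: inner_l2_def cinner_add_left)
  show "inner (a *\<^sub>R f) g = a * inner f g"
    by (simp add: inner_l2_def scaleR_l2_def cinner_cscale_left)
  show "0 \<le> inner f f"
    by (simp add: inner_l2_def cinner_self)
  show "inner f f = 0 \<longleftrightarrow> f = 0"
  proof
    assume "inner f f = 0"
    then have "(\<integral>t. (cmod (rep_l2 f t))\<^sup>2 \<partial>lborel) = 0"
      by (simp add: inner_l2_def cinner_self)
    then have "AE t in lborel. (cmod (rep_l2 f t))\<^sup>2 = 0"
      using square_integrable_rep[of f]
      by (subst (asm) integral_nonneg_eq_0_iff_AE) (auto simp: square_integrable_def)
    then have "l2_eq (rep_l2 f) (\<lambda>_. 0)"
      using square_integrable_rep[of f] by (simp add: l2_eq_def square_integrable_zero)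
    then show "f = 0"
      using Quotient3_rel_abs[OF Quotient3_l2] Quotient3_abs_rep[OF Quotient3_l2, of f]
      by (simp add: zero_l2_def)
  next
    assume "f = 0"
    moreover have "cinner 0 0 = 0" using cinner_add_left[of 0 0 0] by simp
    ultimately show "inner f f = 0" by (simp add: inner_l2_def)
  qed
  show "norm f = sqrt (inner f f)" by (simp add: norm_l2_def)
  show "sgn f = f /\<^sub>R norm f" by (simp add: sgn_l2_def)
  show "dist f g = norm (f - g)" by (simp add: dist_l2_def)
  show "uniformity = (INF e\<in>{0<..}. principal {(f, g :: l2). dist f g < e})"
    by (simp add: uniformity_l2_def)
  show "open U \<longleftrightarrow> (\<forall>f\<in>U. \<forall>\<^sub>F (f', g) in uniformity. f' = f \<longrightarrow> g \<in> U)" for U :: "l2 set"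
    by (simp add: open_l2_def)
qed

end


section \<open>Operators\<close>

definition bounded_clinear :: "(l2 \<Rightarrow> l2) \<Rightarrow> bool" where
  "bounded_clinear T \<longleftrightarrow> bounded_linear T \<and> (\<forall>c f. T (cscale c f) = cscale c (T f))"

definition self_adjoint :: "(l2 \<Rightarrow> l2) \<Rightarrow> bool" where
  "self_adjoint T \<longleftrightarrow> (\<forall>f g. cinner (T f) g = cinner f (T g))"

definition compact_operator :: "(l2 \<Rightarrow> l2) \<Rightarrow> bool" where
  "compact_operator T \<longleftrightarrow> bounded_clinear T \<and> compact (closure (T ` cball 0 1))"

definition positive_semidefinite :: "(l2 \<Rightarrow> l2) \<Rightarrow> bool" where
  "positive_semidefinite T \<longleftrightarrow> (\<forall>f. cinner f (T f) \<in> \<real> \<and> 0 \<le> Re (cinner f (T f)))"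

definition covariance_operator :: "(l2 \<Rightarrow> l2) \<Rightarrow> bool" where
  "covariance_operator R \<longleftrightarrow> compact_operator R \<and> positive_semidefinite R \<and> self_adjoint R"

definition unitary_operator :: "(l2 \<Rightarrow> l2) \<Rightarrow> bool" where
  "unitary_operator U \<longleftrightarrow>
     bounded_clinear U \<and> surj U \<and> (\<forall>f g. cinner (U f) (U g) = cinner f g)"

definition orthonormal_basis :: "(nat \<Rightarrow> l2) \<Rightarrow> bool" where
  "orthonormal_basis e \<longleftrightarrow>
     (\<forall>m n. cinner (e m) (e n) = (if m = n then 1 else 0)) \<and>
     (\<forall>f. (\<lambda>n. cscale (cinner (e n) f) (e n)) sums f)"

definition KLT :: "(l2 \<Rightarrow> l2) \<Rightarrow> (nat \<Rightarrow> l2) \<Rightarrow> bool" where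
  "KLT R e \<longleftrightarrow> orthonormal_basis e \<and> (\<forall>n. \<exists>c. R (e n) = cscale c (e n))"

text \<open>Unbounded operators are represented by their graphs: \<open>(f, g) \<in> T\<close> means that \<open>f\<close> lies in the
  domain of \<open>T\<close> and \<open>T f = g\<close>.\<close>

definition graph_of :: "(l2 \<Rightarrow> l2) \<Rightarrow> l2 rel" where
  "graph_of T = {(f, T f) | f. True}"

definition linear_graph :: "l2 rel \<Rightarrow> bool" where
  "linear_graph T \<longleftrightarrow> single_valued T \<and> (0, 0) \<in> T \<and>
     (\<forall>(f, g)\<in>T. \<forall>(f', g')\<in>T. (f + f', g + g') \<in> T) \<and>
     (\<forall>c. \<forall>(f, g)\<in>T. (cscale c f, cscale c g) \<in> T)"

text \<open>The operator \<open>V T V\<^sup>-\<^sup>1\<close>, for bijective \<open>V\<close>.\<close>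

definition conj_graph :: "(l2 \<Rightarrow> l2) \<Rightarrow> l2 rel \<Rightarrow> l2 rel" where
  "conj_graph V T = {(V f, V g) | f g. (f, g) \<in> T}"

definition eigenspace :: "l2 rel \<Rightarrow> complex \<Rightarrow> l2 set" where
  "eigenspace T z = {f. (f, cscale z f) \<in> T}"

text \<open>The resolvent set consists of the \<open>z\<close> for which \<open>T - z\<close> is a bijection of its domain onto the
  whole space with a bounded inverse \<open>S\<close>.\<close>

definition resolvent_set :: "l2 rel \<Rightarrow> complex set" where
  "resolvent_set T =
     {z. \<exists>S. bounded_clinear S \<and> {(g - cscale z f, f) | f g. (f, g) \<in> T} = graph_of S}"

definition spectrum :: "l2 rel \<Rightarrow> complex set" where
  "spectrum T = - resolvent_set T"


section \<open>Borel functional calculus\<close>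

definition projection_valued_measure :: "(real set \<Rightarrow> l2 \<Rightarrow> l2) \<Rightarrow> bool" where
  "projection_valued_measure E \<longleftrightarrow>
     (\<forall>B\<in>sets borel. bounded_clinear (E B) \<and> self_adjoint (E B)) \<and>
     (\<forall>B\<in>sets borel. \<forall>C\<in>sets borel. E (B \<inter> C) = E B \<circ> E C) \<and>
     E UNIV = id \<and>
     (\<forall>A :: nat \<Rightarrow> real set. range A \<subseteq> sets borel \<longrightarrow> disjoint_family A \<longrightarrow>
        (\<forall>f. (\<lambda>n. E (A n) f) sums E (\<Union>n. A n) f))"

text \<open>The scalar measure \<open>B \<mapsto> \<langle>f, E B f\<rangle> = \<parallel>E B f\<parallel>\<^sup>2\<close>.\<close>

definition scalar_measure :: "(real set \<Rightarrow> l2 \<Rightarrow> l2) \<Rightarrow> l2 \<Rightarrow> real measure" where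
  "scalar_measure E f = measure_of UNIV (sets borel) (\<lambda>B. ennreal ((norm (E B f))\<^sup>2))"

text \<open>\<open>T\<close> is the spectral integral of \<open>\<phi>\<close> against \<open>E\<close>. The quadratic form on the given domain
  determines the linear operator \<open>T\<close> by polarization, the domain being dense.\<close>

definition spectral_integral ::
    "(real set \<Rightarrow> l2 \<Rightarrow> l2) \<Rightarrow> (real \<Rightarrow> complex) \<Rightarrow> l2 rel \<Rightarrow> bool" where
  "spectral_integral E \<phi> T \<longleftrightarrow> linear_graph T \<and>
     Domain T = {f. integrable (scalar_measure E f) (\<lambda>x. (cmod (\<phi> x))\<^sup>2)} \<and>
     (\<forall>(f, g)\<in>T. cinner f g = (\<integral>x. \<phi> x \<partial>scalar_measure E f))"

text \<open>\<open>T = \<phi>(H)\<close> for the self-adjoint operator \<open>H\<close> with spectral measure \<open>E\<close>.\<close>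

definition functional_calculus :: "(real \<Rightarrow> complex) \<Rightarrow> l2 rel \<Rightarrow> (l2 \<Rightarrow> l2) \<Rightarrow> bool" where
  "functional_calculus \<phi> H T \<longleftrightarrow>
     (\<exists>E. projection_valued_measure E \<and> spectral_integral E of_real H \<and>
          spectral_integral E \<phi> (graph_of T))"

definition is_function_of :: "(l2 \<Rightarrow> l2) \<Rightarrow> l2 rel \<Rightarrow> bool" where
  "is_function_of R H \<longleftrightarrow> (\<exists>\<phi>\<in>borel_measurable borel. functional_calculus \<phi> H R)"


section \<open>The harmonic oscillator and the Hermite--Gauss functions\<close>

definition nth_deriv :: "nat \<Rightarrow> (real \<Rightarrow> complex) \<Rightarrow> real \<Rightarrow> complex" where
  "nth_deriv n f = ((\<lambda>g t. vector_derivative g (at t)) ^^ n) f"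

definition schwartz :: "(real \<Rightarrow> complex) \<Rightarrow> bool" where
  "schwartz f \<longleftrightarrow>
     (\<forall>n t. nth_deriv n f differentiable at t) \<and>
     (\<forall>m n. bounded (range (\<lambda>t. of_real (t ^ m) * nth_deriv n f t)))"

text \<open>The self-adjoint operator \<open>(- d\<^sup>2/dt\<^sup>2 + t\<^sup>2) / 2\<close>: the closure of its restriction to the
  Schwartz space, on which it is essentially self-adjoint.\<close>

definition H_ell :: "l2 rel" where
  "H_ell = closure {(abs_l2 f, abs_l2 (\<lambda>t. (- nth_deriv 2 f t + of_real (t\<^sup>2) * f t) / 2)) | f.
     schwartz f}"

text \<open>Physicists' Hermite polynomials, by the recurrence \<open>H\<^sub>n\<^sub>+\<^sub>1 = 2 t H\<^sub>n - H\<^sub>n'\<close>.\<close>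

fun hermite :: "nat \<Rightarrow> real poly" where
  "hermite 0 = 1"
| "hermite (Suc n) = [:0, 2:] * hermite n - pderiv (hermite n)"

definition hermite_gauss_fun :: "nat \<Rightarrow> real \<Rightarrow> real" where
  "hermite_gauss_fun n t =
     poly (hermite n) t * exp (- t\<^sup>2 / 2) / sqrt (2 ^ n * fact n * sqrt pi)"

definition hermite_gauss :: "nat \<Rightarrow> l2" where
  "hermite_gauss n = abs_l2 (\<lambda>t. of_real (hermite_gauss_fun n t))"


section \<open>The metaplectic representation\<close>

definition symplectic_form :: "real^2^2" where
  "symplectic_form = vector [vector [0, 1], vector [-1, 0]]"

definition Sp2 :: "(real^2^2) set" where
  "Sp2 = {M. transpose M ** symplectic_form ** M = symplectic_form}"

text \<open>The double cover of \<open>Sp2\<close>: a point over the matrix with rows \<open>(a, b)\<close> and \<open>(c, d)\<close> is given by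
  a choice of a square root \<open>\<epsilon>\<close> of \<open>a + i b\<close>. The two choices give metaplectic operators
  differing by a sign.\<close>

definition Mp2 :: "((real^2^2) \<times> complex) set" where
  "Mp2 = {(M, \<epsilon>). M \<in> Sp2 \<and> \<epsilon>\<^sup>2 = Complex (M $ 1 $ 1) (M $ 1 $ 2)}"

text \<open>The linear canonical transform. For \<open>b \<noteq> 0\<close> the constant in front of the integral is the square
  root of \<open>1 / (2 \<pi> i b)\<close> selected by \<open>\<epsilon>\<close>, and for \<open>b = 0\<close> the factor \<open>1 / \<epsilon>\<close> is a square root
  of \<open>d = 1 / a\<close>. In both cases the normalization is such that the Gaussian \<open>exp (- s\<^sup>2 / 2)\<close> is mapped
  to a function with value \<open>1 / \<epsilon>\<close> at \<open>0\<close>.\<close>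

definition lct :: "(real^2^2) \<times> complex \<Rightarrow> (real \<Rightarrow> complex) \<Rightarrow> real \<Rightarrow> complex" where
  "lct g f t = (case g of (M, \<epsilon>) \<Rightarrow>
     let a = M $ 1 $ 1; b = M $ 1 $ 2; c = M $ 2 $ 1; d = M $ 2 $ 2 in
     if b = 0 then exp (\<i> * of_real (c * d * t\<^sup>2 / 2)) * f (d * t) / \<epsilon>
     else csqrt ((1 - \<i> * of_real (a / b)) / of_real (2 * pi)) / \<epsilon> *
       (\<integral>s. exp (\<i> * of_real ((d * t\<^sup>2 - 2 * t * s + a * s\<^sup>2) / (2 * b))) * f s \<partial>lborel))"

text \<open>The integral only makes sense for integrable functions; the operator on the whole space is the
  unitary extension, which is unique by density.\<close>

definition metaplectic :: "(real^2^2) \<times> complex \<Rightarrow> l2 \<Rightarrow> l2" where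
  "metaplectic g = (THE U. unitary_operator U \<and>
     (\<forall>f. square_integrable f \<longrightarrow> integrable lborel f \<longrightarrow>
        (AE t in lborel. rep_l2 (U (abs_l2 f)) t = lct g f t)))"

definition metaplectic_operators :: "(l2 \<Rightarrow> l2) set" where
  "metaplectic_operators = metaplectic ` Mp2"

text \<open>The elliptic one-parameter subgroup, lifted continuously to the double cover
  (so with period \<open>4 \<pi>\<close>).\<close>

definition elliptic :: "real \<Rightarrow> (real^2^2) \<times> complex" where
  "elliptic \<theta> =
     (vector [vector [cos \<theta>, sin \<theta>], vector [- sin \<theta>, cos \<theta>]], cis (\<theta> / 2))"

end

theory Submission
  imports Defs "HOL-Probability.Levy"
begin

text \<open>
  The Hermite--Gauss functions are an orthonormal basis: if all Hermite coefficients of \<open>f\<close> vanish, so do all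
  moments of \<open>f(t) e\<^sup>-\<^sup>t\<^sup>2\<^sup>/\<^sup>2\<close>, hence its Fourier transform. The oscillator is symmetric on the Schwartz
  space and closed, so \<open>H_ell\<close> is the diagonal operator with entries \<open>n + 1/2\<close> in this basis, and its functional
  calculus is explicit. By the Hermite recurrence, integration by parts and the complex Gaussian integral, a linear
  canonical transform maps \<open>h\<^sub>n\<close> to a unimodular multiple of a scaled and chirped \<open>h\<^sub>n\<close>; the metaplectic
  operator is therefore the unitary map between two orthonormal bases, and the elliptic group acts diagonally, with
  eigenvalues \<open>e\<^sup>-\<^sup>i\<^sup>(\<^sup>n\<^sup>+\<^sup>1\<^sup>/\<^sup>2\<^sup>)\<^sup>\<theta>\<close>. Since these characters are pairwise distinct, an operator commuting with the group is diagonal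
  in the same basis.
\<close>

section \<open>Completeness of the space of square-integrable functions\<close>

text \<open>The obstacle is that \<open>metaplectic\<close> is a definite description: existence and
  uniqueness of the unitary extension have to be produced before any operator can be computed. A
  candidate is built from the values that \<open>lct\<close> takes on the Hermite-Gauss functions,
  where all integrals are explicit; its unitarity is then the orthonormality and totality of the
  images. What remains is its agreement with the integral for every integrable square-integrable
  function. At that stage \<open>lct\<close> of such a function is not known to be square
  integrable, so the comparison uses a determinacy criterion that asks only for integrability
  against Gaussian-type weights, and the transform is moved onto the test function by Fubini or by a
  substitution. For the oscillator, the two inclusions between the closure \<open>H_ell\<close> and
  the diagonal operator rest on different facts: symmetry tested against one Hermite-Gauss function
  at a time, and Hermite partial sums, which are themselves Schwartz functions.\<close>

lemma abs_rep_l2: "abs_l2 (rep_l2 f) = f"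
  by (rule Quotient3_abs_rep[OF Quotient3_l2])

lemma abs_l2_eqI:
  assumes "square_integrable f" "square_integrable g" "AE t in lborel. f t = g t"
  shows "abs_l2 f = abs_l2 g"
  using assms by (intro Quotient3_rel_abs[OF Quotient3_l2]) (simp add: l2_eq_def)

lemma l2_eqI:
  assumes "AE t in lborel. rep_l2 f t = rep_l2 g t"
  shows "f = g"
  using abs_l2_eqI[OF square_integrable_rep square_integrable_rep assms] by (simp add: abs_rep_l2)

lemma abs_l2_zero: "abs_l2 (\<lambda>_. 0) = 0"
  by (simp add: zero_l2_def)

lemma abs_l2_add:
  "square_integrable f \<Longrightarrow> square_integrable g \<Longrightarrow> abs_l2 (\<lambda>t. f t + g t) = abs_l2 f + abs_l2 g"
  by (subst plus_l2.abs_eq) (simp_all add: l2_eq_def)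

lemma abs_l2_cmult:
  "square_integrable f \<Longrightarrow> abs_l2 (\<lambda>t. c * f t) = cscale c (abs_l2 f)"
  by (subst cscale.abs_eq) (simp_all add: l2_eq_def)

lemma cinner_abs:
  "square_integrable f \<Longrightarrow> square_integrable g \<Longrightarrow>
    cinner (abs_l2 f) (abs_l2 g) = (\<integral>t. cnj (f t) * g t \<partial>lborel)"
  by (subst cinner.abs_eq) (simp_all add: l2_eq_def)

lemma square_integrable_diff:
  assumes "square_integrable f" "square_integrable g"
  shows "square_integrable (\<lambda>t. f t - g t)"
  using square_integrable_add[OF assms(1) square_integrable_cmult[OF assms(2), of "-1"]] by simp

lemma cscale_minus_one: "cscale (-1) f = - f"
  using scaleR_l2_def[of "-1" f] by simp

lemma cscale_0_left [simp]: "cscale 0 f = 0"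
  using scaleR_l2_def[of 0 f] by simp

lemma cscale_cscale: "cscale a (cscale b f) = cscale (a * b) f"
  by transfer (auto simp: l2_eq_def mult.assoc intro!: square_integrable_cmult)

lemma abs_l2_diff:
  assumes "square_integrable f" "square_integrable g"
  shows "abs_l2 (\<lambda>t. f t - g t) = abs_l2 f - abs_l2 g"
  using abs_l2_add[OF assms(1) square_integrable_cmult[OF assms(2), of "-1"]] assms
  by (simp add: abs_l2_cmult[of g "-1", simplified] cscale_minus_one)

lemma cinner_norm: "cinner f f = of_real ((norm f)\<^sup>2)"
proof -
  have "(norm f)\<^sup>2 = Re (cinner f f)"
    by (simp add: power2_norm_eq_inner inner_l2_def)
  then show ?thesis by (simp add: cinner_self)
qed

lemma norm_l2_square: "(norm f)\<^sup>2 = (\<integral>t. (cmod (rep_l2 f t))\<^sup>2 \<partial>lborel)"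
  using cinner_norm[of f] unfolding cinner_self of_real_eq_iff by simp

lemma norm_abs_l2_square:
  assumes "square_integrable f"
  shows "(norm (abs_l2 f))\<^sup>2 = (\<integral>t. (cmod (f t))\<^sup>2 \<partial>lborel)"
proof -
  have "AE t in lborel. rep_l2 (abs_l2 f) t = f t" by (rule rep_abs_l2[OF assms])
  then show ?thesis
    unfolding norm_l2_square
    using square_integrable_rep[of "abs_l2 f"] assms
    by (intro integral_cong_AE) (auto simp: square_integrable_def)
qed

lemma norm_cscale: "norm (cscale c f) = cmod c * norm f"
proof -
  have "complex_of_real ((norm (cscale c f))\<^sup>2) = of_real ((cmod c * norm f)\<^sup>2)"
    unfolding cinner_norm[symmetric] cinner_cscale_left cinner_cscale_right
    by (simp add: cinner_norm power_mult_distrib complex_norm_square[of c, simplified] mult_ac)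
  then have "(norm (cscale c f))\<^sup>2 = (cmod c * norm f)\<^sup>2" by (simp only: of_real_eq_iff)
  then show ?thesis by (simp add: power2_eq_iff_nonneg)
qed

text \<open>The real inner product only bounds the real part of \<open>cinner f g\<close>;
  multiplying \<open>g\<close> by a phase makes the product real and nonnegative.\<close>

lemma cinner_Cauchy_Schwarz: "cmod (cinner f g) \<le> norm f * norm g"
proof -
  define c where "c = cnj (sgn (cinner f g))"
  have "c * cinner f g = of_real (cmod (cinner f g))"
    unfolding c_def sgn_eq
    by (simp add: complex_norm_square[symmetric] power2_eq_square mult.commute)
  then have "inner f (cscale c g) = cmod (cinner f g)"
    by (simp add: inner_l2_def cinner_cscale_right)
  moreover have "inner f (cscale c g) \<le> norm f * norm (cscale c g)"
    by (rule norm_cauchy_schwarz)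
  \<comment> \<open>Only an inequality, since \<open>c\<close> is 0 when the inner product
    vanishes.\<close>
  moreover have "cmod c \<le> 1" by (simp add: c_def norm_sgn)
  then have "norm f * norm (cscale c g) \<le> norm f * norm g"
    unfolding norm_cscale by (intro mult_left_mono mult_left_le_one_le) auto
  ultimately show ?thesis by linarith
qed

lemma bounded_linear_cinner_right: "bounded_linear (cinner f)"
  by (rule bounded_linear_intro[where K = "norm f"])
     (auto simp: cinner_add_right scaleR_l2_def cinner_cscale_right scaleR_conv_of_real
        mult.commute[of _ "norm f"] cinner_Cauchy_Schwarz)

lemma cinner_diff_right: "cinner f (g - h) = cinner f g - cinner f h"
  by (rule linear_diff[OF bounded_linear.linear[OF bounded_linear_cinner_right]])

lemma cinner_zero_right [simp]: "cinner f 0 = 0"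
  by (rule linear_0[OF bounded_linear.linear[OF bounded_linear_cinner_right]])

lemma cinner_zero_left [simp]: "cinner 0 f = 0"
  by (subst cinner_commute) simp

lemma cinner_sum_right: "cinner f (\<Sum>i\<in>A. g i) = (\<Sum>i\<in>A. cinner f (g i))"
  by (rule linear_sum[OF bounded_linear.linear[OF bounded_linear_cinner_right]])

lemma cinner_sum_left: "cinner (\<Sum>i\<in>A. g i) f = (\<Sum>i\<in>A. cinner (g i) f)"
  by (subst cinner_commute) (simp add: cinner_sum_right flip: cinner_commute)

text \<open>Along a subsequence whose increments have norm at most \<open>2\<^sup>-\<^sup>n\<close>, the series
  \<open>\<Sum>n. 2\<^sup>n \<bar>f\<^sub>n\<^sub>+\<^sub>1 - f\<^sub>n\<bar>\<^sup>2\<close> has a finite integral; this gives pointwise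
  convergence without Minkowski's inequality.\<close>

lemma l2_rapid_Cauchy_convergent:
  fixes X :: "nat \<Rightarrow> l2"
  assumes X: "\<And>n. norm (X (Suc n) - X n) \<le> (1/2) ^ n"
  shows "convergent X"
proof -
  define f where "f = (\<lambda>n. rep_l2 (X n))"
  have sq: "square_integrable (f n)" for n
    by (simp add: f_def square_integrable_rep)
  have [measurable]: "f n \<in> borel_measurable borel" for n
    using sq[of n] by (auto simp: square_integrable_def)
  have X_abs: "X n = abs_l2 (f n)" for n by (simp add: f_def abs_rep_l2)
  have norm_diff: "(\<integral>\<^sup>+t. ennreal ((cmod (f m t - f n t))\<^sup>2) \<partial>lborel) = ennreal ((norm (X m - X n))\<^sup>2)" for m n
  proof -
    have "square_integrable (\<lambda>t. f m t - f n t)" by (intro square_integrable_diff sq)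
    then show ?thesis
      unfolding X_abs abs_l2_diff[OF sq sq, symmetric]
      by (subst norm_abs_l2_square) (auto simp: square_integrable_def intro!: nn_integral_eq_integral)
  qed
  have "(\<integral>\<^sup>+t. (\<Sum>n. ennreal (2 ^ n * (cmod (f (Suc n) t - f n t))\<^sup>2)) \<partial>lborel)
      = (\<Sum>n. (\<integral>\<^sup>+t. ennreal (2 ^ n * (cmod (f (Suc n) t - f n t))\<^sup>2) \<partial>lborel))"
    by (intro nn_integral_suminf) measurable
  also have "\<dots> = (\<Sum>n. ennreal (2 ^ n * (norm (X (Suc n) - X n))\<^sup>2))"
    by (intro suminf_cong)
       (simp add: ennreal_mult nn_integral_cmult norm_diff)
  also have "\<dots> \<le> (\<Sum>n. ennreal ((1/2) ^ n))"
  proof (intro suminf_le ennreal_leI)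
    show "2 ^ n * (norm (X (Suc n) - X n))\<^sup>2 \<le> (1/2::real) ^ n" for n
    proof -
      have "2 ^ n * (norm (X (Suc n) - X n))\<^sup>2 \<le> 2 ^ n * ((1/2::real) ^ n)\<^sup>2"
        using X[of n] by (intro mult_left_mono power_mono) auto
      also have "\<dots> = (1/2) ^ n" by (simp add: power2_eq_square power_divide)
      finally show ?thesis .
    qed
  qed auto
  also have "\<dots> = ennreal (\<Sum>n. (1/2) ^ n)"
    by (intro suminf_ennreal2) (auto intro!: summable_geometric)
  also have "\<dots> < \<infinity>" by simp
  finally have "AE t in lborel. (\<Sum>n. ennreal (2 ^ n * (cmod (f (Suc n) t - f n t))\<^sup>2)) \<noteq> \<infinity>"
    by (intro nn_integral_PInf_AE) auto
  then have conv: "AE t in lborel. convergent (\<lambda>n. f n t)"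
  proof eventually_elim
    case (elim t)
    then have summ: "summable (\<lambda>n. 2 ^ n * (cmod (f (Suc n) t - f n t))\<^sup>2)"
      by (intro summable_suminf_not_top) auto
    have "norm (f (Suc n) t - f n t) \<le> 2 ^ n * (cmod (f (Suc n) t - f n t))\<^sup>2 + (1/2) ^ n" for n
    proof -
      define x where "x = cmod (f (Suc n) t - f n t)"
      \<comment> \<open>From \<open>(x * 2 ^ n - 1)^2 \<ge> 0\<close>; multiplied by
        \<open>(1/2) ^ n\<close> it bounds \<open>x\<close> by the two summable majorants.\<close>
      have "2 * (x * 2 ^ n) \<le> (x * 2 ^ n)\<^sup>2 + 1" "0 \<le> x * 2 ^ n"
        using zero_le_power2[of "x * 2 ^ n - 1"]
        by (simp_all add: power2_diff x_def[symmetric]) (simp add: x_def)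
      then have "x * 2 ^ n \<le> (x * 2 ^ n)\<^sup>2 + 1" by linarith
      then have "x * 2 ^ n * (1/2) ^ n \<le> ((x * 2 ^ n)\<^sup>2 + 1) * (1/2) ^ n"
        by (intro mult_right_mono) auto
      then show ?thesis
        by (simp add: x_def[symmetric] power2_eq_square power_divide field_simps)
    qed
    then have "summable (\<lambda>n. f (Suc n) t - f n t)"
      by (intro summable_comparison_test'[OF summable_add[OF summ summable_geometric[of "1/2"]], of 0]) auto
    then have "convergent (\<lambda>n. \<Sum>k<n. f (Suc k) t - f k t)"
      by (simp add: summable_iff_convergent)
    then have "convergent (\<lambda>n. f n t - f 0 t)" by (simp only: sum_lessThan_telescope[of "\<lambda>k. f k t"])
    then show ?case by (simp add: convergent_diff_const_right_iff)
  qed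
  define g where "g = (\<lambda>t. lim (\<lambda>n. f n t))"
  have [measurable]: "g \<in> borel_measurable borel" unfolding g_def by measurable
  have lim: "AE t in lborel. (\<lambda>n. f n t) \<longlonglongrightarrow> g t"
    using conv by eventually_elim (simp add: g_def convergent_LIMSEQ_iff)
  have geo: "norm (X (n + k) - X n) \<le> 2 * (1/2) ^ n" for n k
  proof -
    \<comment> \<open>The subtracted tail of the geometric series makes the induction on
      \<open>k\<close> close.\<close>
    have "norm (X (n + k) - X n) \<le> 2 * (1/2) ^ n - 2 * (1/2) ^ (n + k)"
    proof (induction k)
      case (Suc k)
      have "norm (X (n + Suc k) - X n) \<le> norm (X (Suc (n + k)) - X (n + k)) + norm (X (n + k) - X n)"
        using norm_triangle_ineq[of "X (Suc (n + k)) - X (n + k)" "X (n + k) - X n"] by simp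
      with Suc X[of "n + k"] show ?case by simp
    qed simp
    then show ?thesis by (smt (verit) zero_le_power divide_nonneg_nonneg)
  qed
  \<comment> \<open>Fatou's lemma: the distance to the pointwise limit is at most the lower limit of
    the distances along the sequence.\<close>
  have bound: "(\<integral>\<^sup>+t. ennreal ((cmod (g t - f n t))\<^sup>2) \<partial>lborel) \<le> ennreal ((2 * (1/2) ^ n)\<^sup>2)" for n
  proof -
    have "(\<integral>\<^sup>+t. ennreal ((cmod (g t - f n t))\<^sup>2) \<partial>lborel)
        = (\<integral>\<^sup>+t. liminf (\<lambda>k. ennreal ((cmod (f (n + k) t - f n t))\<^sup>2)) \<partial>lborel)"
    proof (intro nn_integral_cong_AE)
      show "AE t in lborel. ennreal ((cmod (g t - f n t))\<^sup>2)
          = liminf (\<lambda>k. ennreal ((cmod (f (n + k) t - f n t))\<^sup>2))"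
        using lim
      proof eventually_elim
        case (elim t)
        then have "(\<lambda>k. f (k + n) t) \<longlonglongrightarrow> g t" by (rule LIMSEQ_ignore_initial_segment)
        then have "(\<lambda>k. ennreal ((cmod (f (n + k) t - f n t))\<^sup>2)) \<longlonglongrightarrow> ennreal ((cmod (g t - f n t))\<^sup>2)"
          unfolding add.commute[of n] by (intro tendsto_intros)
        then show ?case by (rule lim_imp_Liminf[OF trivial_limit_sequentially, symmetric])
      qed
    qed
    also have "\<dots> \<le> liminf (\<lambda>k. \<integral>\<^sup>+t. ennreal ((cmod (f (n + k) t - f n t))\<^sup>2) \<partial>lborel)"
      by (intro nn_integral_liminf) measurable
    also have "\<dots> \<le> liminf (\<lambda>k::nat. ennreal ((2 * (1/2) ^ n)\<^sup>2))"
      unfolding norm_diff by (intro Liminf_mono always_eventually allI ennreal_leI power_mono geo) auto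
    also have "\<dots> = ennreal ((2 * (1/2) ^ n)\<^sup>2)" by (simp add: Liminf_const)
    finally show ?thesis .
  qed
  have sqd: "square_integrable (\<lambda>t. g t - f n t)" for n
    unfolding square_integrable_def
    using bound[of n] by (auto intro!: integrableI_bounded simp: order_le_less_trans[OF _ ennreal_less_top])
  from square_integrable_add[OF sqd[of 0] sq[of 0]] have sqg: "square_integrable g" by simp
  have "norm (abs_l2 g - X n) \<le> 2 * (1/2) ^ n" for n
  proof -
    have "(norm (abs_l2 g - X n))\<^sup>2 = (\<integral>t. (cmod (g t - f n t))\<^sup>2 \<partial>lborel)"
      unfolding X_abs abs_l2_diff[OF sqg sq, symmetric] by (rule norm_abs_l2_square[OF sqd])
    then have "ennreal ((norm (abs_l2 g - X n))\<^sup>2) = (\<integral>\<^sup>+t. ennreal ((cmod (g t - f n t))\<^sup>2) \<partial>lborel)"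
      using sqd[of n] by (simp add: square_integrable_def nn_integral_eq_integral)
    with bound[of n] have "ennreal ((norm (abs_l2 g - X n))\<^sup>2) \<le> ennreal ((2 * (1/2) ^ n)\<^sup>2)" by simp
    then have "(norm (abs_l2 g - X n))\<^sup>2 \<le> (2 * (1/2) ^ n)\<^sup>2" by (subst (asm) ennreal_le_iff) auto
    then show ?thesis by (rule power2_le_imp_le) simp
  qed
  then have "\<forall>\<^sub>F n in sequentially. norm (X n - abs_l2 g) \<le> 2 * (1/2) ^ n"
    by (simp add: norm_minus_commute)
  moreover have "(\<lambda>n. 2 * (1/2 :: real) ^ n) \<longlonglongrightarrow> 0"
    by (intro tendsto_mult_right_zero LIMSEQ_power_zero) simp
  ultimately have "X \<longlonglongrightarrow> abs_l2 g"
    by (rule LIM_zero_cancel[OF Lim_null_comparison])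
  then show ?thesis by (auto simp: convergent_def)
qed

instance l2 :: banach
proof
  fix X :: "nat \<Rightarrow> l2" assume X: "Cauchy X"
  have "\<exists>k. \<forall>m\<ge>k. \<forall>n\<ge>k. norm (X m - X n) < (1/2) ^ i" for i :: nat
    using X unfolding Cauchy_iff by simp
  then obtain k where k: "\<And>i m n. k i \<le> m \<Longrightarrow> k i \<le> n \<Longrightarrow> norm (X m - X n) < (1/2) ^ i"
    by metis
  \<comment> \<open>The sum dominates \<open>k n\<close>, and the summand \<open>n\<close> makes
    \<open>r\<close> strictly increasing.\<close>
  define r where "r = (\<lambda>n. n + (\<Sum>i\<le>n. k i))"
  have mono: "strict_mono r"
    unfolding strict_mono_Suc_iff r_def by simp
  have "k n \<le> r n" "r n \<le> r (Suc n)" for n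
    using member_le_sum[of n "{..n}" k] by (auto simp: r_def)
  then have "norm ((X \<circ> r) (Suc n) - (X \<circ> r) n) \<le> (1/2) ^ n" for n
    using k[of n "r (Suc n)" "r n"] le_trans[of "k n" "r n" "r (Suc n)"] by simp
  then have "convergent (X \<circ> r)" by (rule l2_rapid_Cauchy_convergent)
  then show "convergent X"
    using Cauchy_converges_subseq[OF X mono] by (auto simp: convergent_def)
qed

section \<open>Diagonal operators in an orthonormal basis\<close>

locale onb =
  fixes e :: "nat \<Rightarrow> l2"
  assumes onb: "orthonormal_basis e"
begin

lemma cinner_basis: "cinner (e m) (e n) = (if m = n then 1 else 0)"
  using onb by (simp add: orthonormal_basis_def)

lemma expansion: "(\<lambda>n. cscale (cinner (e n) f) (e n)) sums f"
  using onb by (simp add: orthonormal_basis_def)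

text \<open>The rule by which identities between vectors, and hence between operators, are verified
  coefficient by coefficient below.\<close>

lemma coeff_eqI: "(\<And>n. cinner (e n) f = cinner (e n) g) \<Longrightarrow> f = g"
  using expansion[of f] expansion[of g] by (simp add: sums_unique2)

lemma Parseval: "(\<lambda>n. cnj (cinner (e n) f) * cinner (e n) g) sums cinner f g"
proof -
  have "(\<lambda>n. cinner f (cscale (cinner (e n) g) (e n))) sums cinner f g"
    by (rule bounded_linear.sums[OF bounded_linear_cinner_right expansion])
  then show ?thesis
    by (simp add: cinner_cscale_right cinner_commute[of f "e _"] mult.commute)
qed

lemma Parseval_norm: "(\<lambda>n. (cmod (cinner (e n) f))\<^sup>2) sums (norm f)\<^sup>2"
proof -
  have "(\<lambda>n. complex_of_real ((cmod (cinner (e n) f))\<^sup>2)) sums complex_of_real ((norm f)\<^sup>2)"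
    using Parseval[of f f] unfolding cinner_norm complex_norm_square by (simp add: mult.commute)
  then show ?thesis by (simp only: sums_of_real_iff)
qed

end

section \<open>Orthonormal systems: convergence of series, Bessel's inequality, totality\<close>

lemma norm_sum_orthonormal:
  assumes "\<And>m n. cinner (e m) (e n) = (if m = n then 1 else 0)" "finite A"
  shows "(norm (\<Sum>n\<in>A. cscale (a n) (e n)))\<^sup>2 = (\<Sum>n\<in>A. (cmod (a n))\<^sup>2)"
proof -
  have "cinner (\<Sum>n\<in>A. cscale (a n) (e n)) (\<Sum>n\<in>A. cscale (a n) (e n))
      = (\<Sum>n\<in>A. cnj (a n) * (\<Sum>m\<in>A. if n = m then a m else 0))"
    unfolding cinner_sum_left
    by (intro sum.cong refl)
       (auto simp: cinner_sum_right cinner_cscale_left cinner_cscale_right assms(1) sum_distrib_left intro!: sum.cong)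
  also have "\<dots> = of_real (\<Sum>n\<in>A. (cmod (a n))\<^sup>2)"
    using assms(2) by (simp add: sum.delta' complex_norm_square[simplified] mult.commute)
  finally show ?thesis unfolding cinner_norm of_real_eq_iff .
qed

text \<open>By Pythagoras the squared norms of the tails are tails of a convergent real series;
  completeness of the space turns this into convergence.\<close>

lemma orthonormal_summable:
  assumes "\<And>m n. cinner (e m) (e n) = (if m = n then 1 else 0)"
    and "summable (\<lambda>n. (cmod (a n))\<^sup>2)"
  shows "summable (\<lambda>n. cscale (a n) (e n))"
  unfolding summable_Cauchy
proof (intro allI impI)
  fix \<epsilon> :: real assume "0 < \<epsilon>"
  with assms(2) obtain N where N: "\<And>m n. N \<le> m \<Longrightarrow> norm (\<Sum>k=m..<n. (cmod (a k))\<^sup>2) < \<epsilon>\<^sup>2"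
    unfolding summable_Cauchy by (metis zero_less_power)
  have "norm (\<Sum>k=m..<n. cscale (a k) (e k)) < \<epsilon>" if "N \<le> m" for m n
  proof (rule power2_less_imp_less)
    show "(norm (\<Sum>k=m..<n. cscale (a k) (e k)))\<^sup>2 < \<epsilon>\<^sup>2"
      using N[OF that, of n] by (simp add: norm_sum_orthonormal[OF assms(1)])
  qed (use \<open>0 < \<epsilon>\<close> in simp)
  then show "\<exists>N. \<forall>m\<ge>N. \<forall>n. norm (\<Sum>k=m..<n. cscale (a k) (e k)) < \<epsilon>" by blast
qed

lemma coeff_orthonormal_series:
  assumes "\<And>m n. cinner (e m) (e n) = (if m = n then 1 else 0)"
    and "(\<lambda>n. cscale (a n) (e n)) sums f"
  shows "cinner (e n) f = a n"
proof -
  have "(\<lambda>m. cinner (e n) (cscale (a m) (e m))) sums cinner (e n) f"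
    by (rule bounded_linear.sums[OF bounded_linear_cinner_right assms(2)])
  moreover have "(\<lambda>m. cinner (e n) (cscale (a m) (e m))) = (\<lambda>m. if m = n then a m else 0)"
    by (auto simp: cinner_cscale_right assms(1))
  ultimately show ?thesis using sums_single[of n a] by (metis sums_unique2)
qed

text \<open>For a partial sum \<open>S\<close> of the expansion the square of \<open>norm S\<close>
  equals \<open>inner S f\<close>, so Cauchy-Schwarz gives \<open>norm S \<le> norm f\<close>
  uniformly in the number of terms.\<close>

lemma Bessel_summable:
  assumes on: "\<And>m n. cinner (e m) (e n) = (if m = n then 1 else 0)"
  shows "summable (\<lambda>n. (cmod (cinner (e n) f))\<^sup>2)"
proof (rule bounded_imp_summable[where B = "(norm f)\<^sup>2"])
  fix n
  define S where "S = (\<Sum>k\<le>n. cscale (cinner (e k) f) (e k))"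
  have nS: "(norm S)\<^sup>2 = (\<Sum>k\<le>n. (cmod (cinner (e k) f))\<^sup>2)"
    unfolding S_def by (rule norm_sum_orthonormal[OF on]) simp
  have "cinner S f = of_real (\<Sum>k\<le>n. (cmod (cinner (e k) f))\<^sup>2)"
    by (simp add: S_def cinner_sum_left cinner_cscale_left complex_norm_square[simplified] mult.commute)
  with nS have "(norm S)\<^sup>2 = inner S f" by (simp add: inner_l2_def)
  also have "\<dots> \<le> norm S * norm f" by (rule norm_cauchy_schwarz)
  finally have "norm S \<le> norm f"
    by (cases "norm S = 0") (auto simp: power2_eq_square)
  then have "(norm S)\<^sup>2 \<le> (norm f)\<^sup>2" by (intro power_mono) auto
  then show "(\<Sum>k\<le>n. (cmod (cinner (e k) f))\<^sup>2) \<le> (norm f)\<^sup>2" by (simp add: nS)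
qed simp

text \<open>The Bessel series converges to some \<open>g\<close>, and \<open>f - g\<close> has zero
  coefficients; so totality replaces the expansion as the property to be checked for each basis
  below.\<close>

lemma orthonormal_basisI:
  assumes on: "\<And>m n. cinner (e m) (e n) = (if m = n then 1 else 0)"
    and total: "\<And>f. (\<And>n. cinner (e n) f = 0) \<Longrightarrow> f = 0"
  shows "orthonormal_basis e"
  unfolding orthonormal_basis_def
proof (intro conjI allI)
  fix f
  obtain g where g: "(\<lambda>n. cscale (cinner (e n) f) (e n)) sums g"
    using orthonormal_summable[OF on Bessel_summable[OF on]] by (auto simp: summable_def)
  have "f - g = 0"
    by (rule total) (simp add: cinner_diff_right coeff_orthonormal_series[OF on g])
  with g show "(\<lambda>n. cscale (cinner (e n) f) (e n)) sums f" by simp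
qed (rule on)

section \<open>Riesz-Fischer and operators that are diagonal in a basis\<close>

context onb
begin

lemma Riesz_Fischer:
  assumes "summable (\<lambda>n. (cmod (a n))\<^sup>2)"
  obtains f where "\<And>n. cinner (e n) f = a n"
proof -
  obtain f where "(\<lambda>n. cscale (a n) (e n)) sums f"
    using orthonormal_summable[OF cinner_basis assms] by (auto simp: summable_def)
  from coeff_orthonormal_series[OF cinner_basis this] that show ?thesis by blast
qed

text \<open>The domain is maximal by construction: \<open>f\<close> belongs to it exactly if the
  multiplied coefficients are those of some square-integrable \<open>g\<close>.\<close>

definition diag_graph :: "(nat \<Rightarrow> complex) \<Rightarrow> l2 rel" where
  "diag_graph a = {(f, g). \<forall>n. cinner (e n) g = a n * cinner (e n) f}"

text \<open>The everywhere defined form, meant for bounded \<open>a\<close>, where the series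
  converges for every \<open>f\<close>.\<close>

definition diag :: "(nat \<Rightarrow> complex) \<Rightarrow> l2 \<Rightarrow> l2" where
  "diag a f = (\<Sum>n. cscale (a n * cinner (e n) f) (e n))"

lemma coeff_diag:
  assumes "\<And>n. cmod (a n) \<le> K"
  shows "cinner (e n) (diag a f) = a n * cinner (e n) f"
proof (rule coeff_orthonormal_series[OF cinner_basis])
  have "summable (\<lambda>n. (cmod (a n * cinner (e n) f))\<^sup>2)"
  proof (rule summable_comparison_test'[where N = 0])
    show "summable (\<lambda>n. K\<^sup>2 * (cmod (cinner (e n) f))\<^sup>2)"
      by (intro summable_mult sums_summable[OF Parseval_norm])
    show "norm ((cmod (a n * cinner (e n) f))\<^sup>2) \<le> K\<^sup>2 * (cmod (cinner (e n) f))\<^sup>2" for n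
      using assms[of n] by (auto simp: norm_mult power_mult_distrib intro!: mult_right_mono power_mono)
  qed
  then show "(\<lambda>n. cscale (a n * cinner (e n) f) (e n)) sums diag a f"
    unfolding diag_def by (intro summable_sums orthonormal_summable[OF cinner_basis])
qed

lemma norm_diag_le:
  assumes "\<And>n. cmod (a n) \<le> K"
  shows "norm (diag a f) \<le> K * norm f"
proof (rule power2_le_imp_le)
  have K: "0 \<le> K" using order_trans[OF norm_ge_zero assms] .
  show "(norm (diag a f))\<^sup>2 \<le> (K * norm f)\<^sup>2"
  proof (rule sums_le)
    show "(\<lambda>n. (cmod (a n * cinner (e n) f))\<^sup>2) sums (norm (diag a f))\<^sup>2"
      using Parseval_norm[of "diag a f"] by (simp add: coeff_diag[OF assms])
    show "(\<lambda>n. K\<^sup>2 * (cmod (cinner (e n) f))\<^sup>2) sums (K * norm f)\<^sup>2"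
      unfolding power_mult_distrib by (intro sums_mult Parseval_norm)
    show "(cmod (a n * cinner (e n) f))\<^sup>2 \<le> K\<^sup>2 * (cmod (cinner (e n) f))\<^sup>2" for n
      using assms[of n] by (auto simp: norm_mult power_mult_distrib intro!: mult_right_mono power_mono)
  qed
  show "0 \<le> K * norm f" using K by simp
qed

lemma bounded_clinear_diag:
  assumes "\<And>n. cmod (a n) \<le> K"
  shows "bounded_clinear (diag a)"
proof -
  note c = coeff_diag[OF assms]
  have sc: "diag a (cscale z f) = cscale z (diag a f)" for z f
    by (rule coeff_eqI) (simp add: c cinner_cscale_right)
  have "bounded_linear (diag a)"
  proof (rule bounded_linear_intro[where K = K])
    show "diag a (f + g) = diag a f + diag a g" for f g
      by (rule coeff_eqI) (simp add: c cinner_add_right distrib_left)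
    show "diag a (r *\<^sub>R f) = r *\<^sub>R diag a f" for r f
      by (simp add: scaleR_l2_def sc)
    show "norm (diag a f) \<le> norm f * K" for f
      using norm_diag_le[OF assms] by (simp add: mult.commute)
  qed
  with sc show ?thesis by (simp add: bounded_clinear_def)
qed

lemma graph_of_eq_diag_graph:
  assumes "\<And>n f. cinner (e n) (T f) = a n * cinner (e n) f"
  shows "graph_of T = diag_graph a"
proof -
  have "g = T f \<longleftrightarrow> (\<forall>n. cinner (e n) g = a n * cinner (e n) f)" for f g
    using coeff_eqI[of g "T f"] by (auto simp: assms)
  then show ?thesis unfolding graph_of_def diag_graph_def by auto
qed

text \<open>Dominated convergence for series: the common bound \<open>K\<close> majorises the
  squared errors by \<open>(2 * K)^2\<close> times the squared coefficients, which are summable.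
  This supplies the countable additivity of the spectral measure.\<close>

lemma diag_tendsto:
  assumes K: "\<And>N n. cmod (a N n) \<le> K" "\<And>n. cmod (b n) \<le> K"
    and lim: "\<And>n. (\<lambda>N. a N n) \<longlonglongrightarrow> b n"
  shows "(\<lambda>N. diag (a N) f) \<longlonglongrightarrow> diag b f"
proof -
  have norm_eq: "(norm (diag (a N) f - diag b f))\<^sup>2 = (\<Sum>n. (cmod ((a N n - b n) * cinner (e n) f))\<^sup>2)" for N
    using sums_unique[OF Parseval_norm[of "diag (a N) f - diag b f"]]
    by (simp add: cinner_diff_right coeff_diag[of _ K, OF K(1)] coeff_diag[of _ K, OF K(2)] left_diff_distrib)
  have "(\<lambda>N. \<Sum>n. (cmod ((a N n - b n) * cinner (e n) f))\<^sup>2) \<longlonglongrightarrow> (\<Sum>n. (cmod ((b n - b n) * cinner (e n) f))\<^sup>2)"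
  proof (rule tannerys_theorem[THEN conjunct2, THEN conjunct2])
    show "\<forall>\<^sub>F (n, N) in at_top \<times>\<^sub>F sequentially.
        norm ((cmod ((a N n - b n) * cinner (e n) f))\<^sup>2) \<le> (2 * K)\<^sup>2 * (cmod (cinner (e n) f))\<^sup>2"
    proof (intro always_eventually allI, clarify)
      fix n N
      have "cmod (a N n - b n) \<le> 2 * K"
        using norm_triangle_ineq4[of "a N n" "b n"] K(1)[of N n] K(2)[of n] by linarith
      then show "norm ((cmod ((a N n - b n) * cinner (e n) f))\<^sup>2) \<le> (2 * K)\<^sup>2 * (cmod (cinner (e n) f))\<^sup>2"
        unfolding norm_mult power_mult_distrib[of "cmod _"] real_norm_def abs_mult abs_power2
        by (intro mult_right_mono power_mono) auto
    qed
    show "summable (\<lambda>n. (2 * K)\<^sup>2 * (cmod (cinner (e n) f))\<^sup>2)"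
      by (intro summable_mult sums_summable[OF Parseval_norm])
    show "((\<lambda>N. (cmod ((a N n - b n) * cinner (e n) f))\<^sup>2) \<longlongrightarrow> (cmod ((b n - b n) * cinner (e n) f))\<^sup>2) sequentially" for n
      by (intro tendsto_intros lim)
  qed simp
  then have "(\<lambda>N. (norm (diag (a N) f - diag b f))\<^sup>2) \<longlonglongrightarrow> 0"
    unfolding norm_eq by simp
  then have "(\<lambda>N. sqrt ((norm (diag (a N) f - diag b f))\<^sup>2)) \<longlonglongrightarrow> sqrt 0"
    by (rule tendsto_real_sqrt)
  then show ?thesis by (simp add: LIM_zero_iff tendsto_norm_zero_iff)
qed

end

section \<open>The spectral measure on the points n + 1/2 and its spectral integrals\<close>

context onb
begin

lemma self_adjoint_diag:
  assumes "\<And>n. cmod (a n) \<le> K" "\<And>n. a n \<in> \<real>"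
  shows "self_adjoint (diag a)"
  unfolding self_adjoint_def
proof (intro allI)
  fix f g
  have "(\<lambda>n. cnj (cinner (e n) f) * cinner (e n) (diag a g)) =
      (\<lambda>n. cnj (cinner (e n) (diag a f)) * cinner (e n) g)"
    using assms(2) by (auto simp: coeff_diag[of _ K, OF assms(1)] Reals_cnj_iff)
  then show "cinner (diag a f) g = cinner f (diag a g)"
    using Parseval[of "diag a f" g] Parseval[of f "diag a g"] by (metis sums_unique2)
qed

definition spectral_proj :: "real set \<Rightarrow> l2 \<Rightarrow> l2" where
  "spectral_proj B = diag (\<lambda>n. indicator B (real n + 1 / 2))"

lemma coeff_spectral_proj:
  "cinner (e n) (spectral_proj B f) = indicator B (real n + 1 / 2) * cinner (e n) f"
  unfolding spectral_proj_def by (rule coeff_diag[where K = 1]) (simp add: indicator_def)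

lemma projection_valued_measure_spectral_proj: "projection_valued_measure spectral_proj"
  unfolding projection_valued_measure_def
proof (intro conjI ballI allI impI)
  fix B C :: "real set"
  have le: "cmod (indicator B x) \<le> 1" for x by (simp add: indicator_def)
  show "bounded_clinear (spectral_proj B)"
    unfolding spectral_proj_def by (rule bounded_clinear_diag[OF le])
  show "self_adjoint (spectral_proj B)"
    unfolding spectral_proj_def by (rule self_adjoint_diag[OF le]) (simp add: indicator_def)
  show "spectral_proj (B \<inter> C) = spectral_proj B \<circ> spectral_proj C"
    by (rule ext, rule coeff_eqI) (simp add: coeff_spectral_proj indicator_inter_arith)
  show "spectral_proj UNIV = id"
    by (rule ext, rule coeff_eqI) (simp add: coeff_spectral_proj)
next
  fix A :: "nat \<Rightarrow> real set" and f
  assume disj: "disjoint_family A"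
  \<comment> \<open>Finite sums of projections are again diagonal, with entries the indicator of the
    finite union; these converge pointwise to the indicator of the full union.\<close>
  have ind: "indicator (\<Union>n<N. A n) x = (\<Sum>n<N. indicator (A n) x :: complex)" for N x
    by (intro indicator_UN_disjoint disjoint_family_on_mono[OF _ disj]) auto
  have "(\<Sum>n<N. spectral_proj (A n) f) = diag (\<lambda>m. indicator (\<Union>n<N. A n) (real m + 1 / 2)) f" for N
  proof (rule coeff_eqI)
    fix m
    have "cinner (e m) (diag (\<lambda>m. indicator (\<Union>n<N. A n) (real m + 1 / 2)) f)
        = indicator (\<Union>n<N. A n) (real m + 1 / 2) * cinner (e m) f"
      by (rule coeff_diag[where K = 1]) (simp add: indicator_def)
    then show "cinner (e m) (\<Sum>n<N. spectral_proj (A n) f)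
        = cinner (e m) (diag (\<lambda>m. indicator (\<Union>n<N. A n) (real m + 1 / 2)) f)"
      unfolding ind by (simp add: cinner_sum_right coeff_spectral_proj sum_distrib_right)
  qed
  moreover have "(\<lambda>N. diag (\<lambda>m. indicator (\<Union>n<N. A n) (real m + 1 / 2)) f) \<longlonglongrightarrow> spectral_proj (\<Union>n. A n) f"
    unfolding spectral_proj_def
    by (rule diag_tendsto[where K = 1]; (rule LIMSEQ_indicator_UN)?) (simp_all add: indicator_def)
  ultimately show "(\<lambda>n. spectral_proj (A n) f) sums spectral_proj (\<Union>n. A n) f"
    by (simp add: sums_def)
qed

text \<open>Parseval identifies the scalar measure as the discrete one with mass
  \<open>(cmod (cinner (e n) f))^2\<close> at \<open>n + 1/2\<close>. Written as the image of a
  weighted counting measure, it turns spectral integrals into series.\<close>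

lemma scalar_measure_spectral_proj:
  "scalar_measure spectral_proj f =
     distr (density (count_space UNIV) (\<lambda>n. ennreal ((cmod (cinner (e n) f))\<^sup>2))) borel (\<lambda>n. real n + 1 / 2)"
  (is "_ = ?\<mu>")
proof -
  have "ennreal ((norm (spectral_proj B f))\<^sup>2) = emeasure ?\<mu> B" if "B \<in> sets borel" for B
  proof -
    have "emeasure ?\<mu> B = (\<Sum>n. ennreal ((cmod (cinner (e n) f))\<^sup>2) * indicator ((\<lambda>n. real n + 1 / 2) -` B) n)"
      using that by (simp add: emeasure_distr emeasure_density nn_integral_count_space_nat)
    also have "\<dots> = (\<Sum>n. ennreal ((cmod (cinner (e n) (spectral_proj B f)))\<^sup>2))"
      by (intro suminf_cong) (simp add: coeff_spectral_proj indicator_def)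
    also have "\<dots> = ennreal ((norm (spectral_proj B f))\<^sup>2)"
      by (intro suminf_ennreal_eq Parseval_norm) simp
    finally show ?thesis by simp
  qed
  then have "scalar_measure spectral_proj f = measure_of UNIV (sets borel) (emeasure ?\<mu>)"
    unfolding scalar_measure_def
    by (intro measure_of_eq) (auto simp: sets.sigma_sets_eq[of borel, simplified])
  also have "\<dots> = ?\<mu>"
    using measure_of_of_measure[of ?\<mu>] by simp
  finally show ?thesis .
qed

lemma linear_graph_diag_graph: "linear_graph (diag_graph a)"
  unfolding linear_graph_def diag_graph_def
  by (auto intro!: single_valuedI coeff_eqI simp: cinner_add_right cinner_cscale_right distrib_left)

lemma Domain_diag_graph:
  "Domain (diag_graph a) = {f. summable (\<lambda>n. (cmod (a n * cinner (e n) f))\<^sup>2)}"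
proof (intro set_eqI iffI)
  fix f assume "f \<in> Domain (diag_graph a)"
  then obtain g where "\<And>n. cinner (e n) g = a n * cinner (e n) f"
    by (auto simp: diag_graph_def)
  then show "f \<in> {f. summable (\<lambda>n. (cmod (a n * cinner (e n) f))\<^sup>2)}"
    using sums_summable[OF Parseval_norm[of g]] by simp
next
  fix f assume "f \<in> {f. summable (\<lambda>n. (cmod (a n * cinner (e n) f))\<^sup>2)}"
  then obtain g where "\<And>n. cinner (e n) g = a n * cinner (e n) f"
    using Riesz_Fischer[of "\<lambda>n. a n * cinner (e n) f"] by auto
  then show "f \<in> Domain (diag_graph a)"
    by (auto simp: diag_graph_def)
qed

text \<open>Over a discrete scalar measure the requirements become statements on series: square
  summability for the domain, Parseval for the quadratic form.\<close>

lemma spectral_integral_spectral_proj: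
  assumes [measurable]: "\<phi> \<in> borel_measurable borel"
  shows "spectral_integral spectral_proj \<phi> (diag_graph (\<lambda>n. \<phi> (real n + 1 / 2)))"
  unfolding spectral_integral_def
proof (intro conjI)
  have int: "integrable (scalar_measure spectral_proj f) \<psi> \<longleftrightarrow>
      summable (\<lambda>n. (cmod (cinner (e n) f))\<^sup>2 * norm (\<psi> (real n + 1 / 2)))"
    if [measurable]: "\<psi> \<in> borel_measurable borel"
    for f and \<psi> :: "real \<Rightarrow> 'b :: {banach, second_countable_topology}"
    unfolding scalar_measure_spectral_proj
    by (subst integrable_distr_eq; (subst integrable_density)?)
       (auto simp: integrable_count_space_nat_iff)
  show "linear_graph (diag_graph (\<lambda>n. \<phi> (real n + 1 / 2)))" by (rule linear_graph_diag_graph)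
  show "Domain (diag_graph (\<lambda>n. \<phi> (real n + 1 / 2))) =
      {f. integrable (scalar_measure spectral_proj f) (\<lambda>x. (cmod (\<phi> x))\<^sup>2)}"
    by (simp add: Domain_diag_graph int norm_mult power_mult_distrib mult.commute)
  show "\<forall>(f, g)\<in>diag_graph (\<lambda>n. \<phi> (real n + 1 / 2)).
      cinner f g = (\<integral>x. \<phi> x \<partial>scalar_measure spectral_proj f)"
  proof clarify
    fix f g assume "(f, g) \<in> diag_graph (\<lambda>n. \<phi> (real n + 1 / 2))"
    then have fg: "cinner (e n) g = \<phi> (real n + 1 / 2) * cinner (e n) f" for n
      by (simp add: diag_graph_def)
    have eq: "cnj (cinner (e n) f) * cinner (e n) g = (cmod (cinner (e n) f))\<^sup>2 *\<^sub>R \<phi> (real n + 1 / 2)" for n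
      by (simp add: fg scaleR_conv_of_real complex_norm_square[simplified])
    \<comment> \<open>Absolute convergence by \<open>x * y \<le> x^2 + y^2\<close>, as
      \<open>f\<close> and \<open>g\<close> both have square-summable coefficients.\<close>
    have "summable (\<lambda>n. (cmod (cinner (e n) f))\<^sup>2 + (cmod (cinner (e n) g))\<^sup>2)"
      by (intro summable_add sums_summable[OF Parseval_norm])
    then have abs: "summable (\<lambda>n. norm ((cmod (cinner (e n) f))\<^sup>2 *\<^sub>R \<phi> (real n + 1 / 2)))"
    proof (rule summable_comparison_test'[where N = 0])
      fix n
      show "norm (norm ((cmod (cinner (e n) f))\<^sup>2 *\<^sub>R \<phi> (real n + 1 / 2))) \<le>
          (cmod (cinner (e n) f))\<^sup>2 + (cmod (cinner (e n) g))\<^sup>2"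
        unfolding eq[symmetric] norm_mult real_norm_def abs_mult abs_norm_cancel complex_mod_cnj
        using sum_squares_bound[of "cmod (cinner (e n) f)" "cmod (cinner (e n) g)"]
          mult_nonneg_nonneg[OF norm_ge_zero[of "cinner (e n) f"] norm_ge_zero[of "cinner (e n) g"]]
        by linarith
    qed
    have "(\<integral>x. \<phi> x \<partial>scalar_measure spectral_proj f) =
        (\<integral>n. (cmod (cinner (e n) f))\<^sup>2 *\<^sub>R \<phi> (real n + 1 / 2) \<partial>count_space UNIV)"
      unfolding scalar_measure_spectral_proj
      by (subst integral_distr; (subst integral_density)?) auto
    also have "\<dots> = (\<Sum>n. (cmod (cinner (e n) f))\<^sup>2 *\<^sub>R \<phi> (real n + 1 / 2))"
      by (rule integral_count_space_nat) (use abs in \<open>simp add: integrable_count_space_nat_iff\<close>)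
    also have "\<dots> = cinner f g"
      using sums_unique[OF Parseval[of f g]] by (simp only: eq)
    finally show "cinner f g = (\<integral>x. \<phi> x \<partial>scalar_measure spectral_proj f)" ..
  qed
qed

section \<open>The operator with entries n + 1/2: functional calculus, eigenspaces, spectrum\<close>

abbreviation number_op :: "l2 rel" where
  "number_op \<equiv> diag_graph (\<lambda>n. of_nat n + 1 / 2)"

text \<open>The definition asks for one spectral measure serving both operators;
  \<open>spectral_proj\<close> is that witness, with \<open>of_real\<close> for the operator and
  \<open>\<phi>\<close> for \<open>T\<close>.\<close>

lemma functional_calculus_number_op:
  assumes "\<phi> \<in> borel_measurable borel"
    and "\<And>n f. cinner (e n) (T f) = \<phi> (real n + 1 / 2) * cinner (e n) f"
  shows "functional_calculus \<phi> number_op T"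
  unfolding functional_calculus_def
proof (intro exI conjI)
  show "projection_valued_measure spectral_proj" by (rule projection_valued_measure_spectral_proj)
  show "spectral_integral spectral_proj of_real number_op"
    using spectral_integral_spectral_proj[of of_real] by simp
  show "spectral_integral spectral_proj \<phi> (graph_of T)"
    unfolding graph_of_eq_diag_graph[where T = T and a = "\<lambda>n. \<phi> (real n + 1 / 2)", OF assms(2)]
    by (rule spectral_integral_spectral_proj[OF assms(1)])
qed

lemma eigenspace_number_op: "eigenspace number_op (of_nat n + 1 / 2) = {cscale c (e n) | c. True}"
proof (intro set_eqI iffI)
  fix f assume "f \<in> eigenspace number_op (of_nat n + 1 / 2)"
  \<comment> \<open>The entries \<open>m + 1/2\<close> are pairwise distinct, which forces every
    other coefficient to vanish and makes the eigenvalue simple.\<close>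
  then have "cinner (e m) f = 0" if "m \<noteq> n" for m
    using that by (auto simp: eigenspace_def diag_graph_def cinner_cscale_right)
  then have "f = cscale (cinner (e n) f) (e n)"
    by (intro coeff_eqI) (simp add: cinner_cscale_right cinner_basis)
  then show "f \<in> {cscale c (e n) | c. True}" by blast
qed (auto simp: eigenspace_def diag_graph_def cinner_cscale_right cinner_basis)

lemma spectrum_number_op: "spectrum number_op = {of_nat n + 1 / 2 | n. True}"
proof -
  have "z \<notin> resolvent_set number_op" if z: "z = of_nat n + 1 / 2" for z n
  proof
    assume "z \<in> resolvent_set number_op"
    then obtain S where S: "bounded_clinear S" "{(g - cscale z f, f) | f g. (f, g) \<in> number_op} = graph_of S"
      by (auto simp: resolvent_set_def)
    \<comment> \<open>An eigenvector would make the bounded inverse send 0 to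
      \<open>e n\<close>.\<close>
    have "(e n, cscale z (e n)) \<in> number_op"
      by (simp add: z diag_graph_def cinner_cscale_right cinner_basis)
    then have "(cscale z (e n) - cscale z (e n), e n) \<in> graph_of S"
      unfolding S(2)[symmetric] by blast
    then have "e n = S 0" by (simp add: graph_of_def)
    also have "\<dots> = 0"
      using S(1) by (simp add: bounded_clinear_def linear_0 bounded_linear.linear)
    finally show False using cinner_basis[of n n] by simp
  qed
  moreover have "z \<in> resolvent_set number_op" if z: "\<And>n. z \<noteq> of_nat n + 1 / 2" for z
  proof -
    \<comment> \<open>The entries of the resolvent; they tend to 0, which gives the bound that
      \<open>diag\<close> requires.\<close>
    define a where "a = (\<lambda>n. inverse (of_nat n + 1 / 2 - z))"
    have nz: "of_nat n + 1 / 2 - z \<noteq> 0" for n using z[of n] by auto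
    have "filterlim (\<lambda>n. (1 / 2 - z) + of_nat n) at_infinity sequentially"
      by (rule tendsto_add_filterlim_at_infinity[OF tendsto_const tendsto_of_nat])
    from filterlim_compose[OF tendsto_inverse_0 this]
    have "a \<longlonglongrightarrow> 0" by (simp add: a_def algebra_simps)
    then have "Bseq a" by (intro convergent_imp_Bseq convergentI)
    then obtain K where K: "\<And>n. cmod (a n) \<le> K" unfolding Bseq_def by auto
    have "{(g - cscale z f, f) | f g. (f, g) \<in> number_op} = graph_of (diag a)"
    proof (intro set_eqI iffI)
      fix p assume "p \<in> {(g - cscale z f, f) | f g. (f, g) \<in> number_op}"
      then obtain f g where p: "p = (g - cscale z f, f)" and fg: "\<And>n. cinner (e n) g = (of_nat n + 1 / 2) * cinner (e n) f"
        by (auto simp: diag_graph_def)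
      have "f = diag a (g - cscale z f)"
      proof (rule coeff_eqI)
        show "cinner (e n) f = cinner (e n) (diag a (g - cscale z f))" for n
          unfolding coeff_diag[OF K] cinner_diff_right cinner_cscale_right fg
          by (simp only: a_def left_diff_distrib[symmetric] add_diff_cancel_left' mult.assoc[symmetric]
              left_inverse[OF nz] right_inverse[OF nz] mult_1 distrib_right[symmetric])
      qed
      then show "p \<in> graph_of (diag a)" by (auto simp: p graph_of_def)
    next
      fix p assume "p \<in> graph_of (diag a)"
      then obtain h where p: "p = (h, diag a h)" by (auto simp: graph_of_def)
      define g where "g = h + cscale z (diag a h)"
      have "(diag a h, g) \<in> number_op"
        unfolding diag_graph_def
      proof (clarify)
        show "cinner (e n) g = (of_nat n + 1 / 2) * cinner (e n) (diag a h)" for n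
        proof -
          define x where "x = cinner (e n) h"
          have g: "cinner (e n) g = x + z * (a n * x)"
            by (simp add: g_def coeff_diag[OF K] cinner_add_right cinner_cscale_right x_def)
          have "x = (of_nat n + 1 / 2 - z) * (a n * x)"
            by (simp only: a_def mult.assoc[symmetric] right_inverse[OF nz] mult_1)
          then have "x + z * (a n * x) = (of_nat n + 1 / 2) * (a n * x)"
            by (simp only: left_diff_distrib eq_diff_eq)
          then show ?thesis
            unfolding g coeff_diag[OF K] x_def .
        qed
      qed
      moreover have "p = (g - cscale z (diag a h), diag a h)" by (simp add: p g_def)
      ultimately show "p \<in> {(g - cscale z f, f) | f g. (f, g) \<in> number_op}" by blast
    qed
    then show ?thesis
      using bounded_clinear_diag[of a K] K unfolding resolvent_set_def by blast
  qed
  ultimately show ?thesis unfolding spectrum_def by blast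
qed

text \<open>The phases \<open>e\<^sup>-\<^sup>i\<^sup>(\<^sup>n\<^sup>+\<^sup>1\<^sup>/\<^sup>2\<^sup>)\<^sup>\<theta>\<close> separate the basis vectors: already at
  \<open>\<theta> = \<pi> / (m - n)\<close> those of \<open>m\<close> and \<open>n\<close> have quotient \<open>-1\<close>.\<close>

lemma commute_imp_eigenvector:
  assumes R: "bounded_clinear R"
    and U: "\<And>\<theta> f g. cinner (U \<theta> f) (U \<theta> g) = cinner f g"
      "\<And>\<theta> n. U \<theta> (e n) = cscale (exp (- \<i> * (of_nat n + 1 / 2) * of_real \<theta>)) (e n)"
    and comm: "\<And>\<theta>. R \<circ> U \<theta> = U \<theta> \<circ> R"
  shows "R (e n) = cscale (cinner (e n) (R (e n))) (e n)"
proof (rule coeff_eqI)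
  fix m
  show "cinner (e m) (R (e n)) = cinner (e m) (cscale (cinner (e n) (R (e n))) (e n))"
  proof (cases "m = n")
    case False
    define \<theta> where "\<theta> = pi / (real m - real n)"
    define c where "c = (\<lambda>k::nat. exp (- \<i> * (of_nat k + 1 / 2) * of_real \<theta>))"
    define x where "x = cinner (e m) (R (e n))"
    have "cnj (c m) = exp (\<i> * (of_nat m + 1 / 2) * of_real \<theta>)"
      by (simp add: c_def exp_cnj)
    then have "cnj (c m) * c n = exp (\<i> * ((of_nat m - of_nat n) * of_real \<theta>))"
      unfolding c_def by (simp add: exp_add[symmetric] algebra_simps)
    also have "(of_nat m - of_nat n) * complex_of_real \<theta> = of_real ((real m - real n) * \<theta>)" by simp
    also have "(real m - real n) * \<theta> = pi" using False by (simp add: \<theta>_def)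
    finally have c: "cnj (c m) * c n = -1" by simp
    have Ue: "U \<theta> (e k) = cscale (c k) (e k)" for k by (simp only: U(2) c_def)
    have "U \<theta> (R (e n)) = R (U \<theta> (e n))"
      using comm[of \<theta>] by (simp add: fun_eq_iff)
    also have "\<dots> = R (cscale (c n) (e n))" by (simp only: Ue)
    also have "\<dots> = cscale (c n) (R (e n))"
      using R by (simp add: bounded_clinear_def)
    \<comment> \<open>The same inner product is evaluated twice: through the eigenvalues it is
      \<open>- x\<close>, through isometry it is \<open>x\<close>.\<close>
    finally have "cinner (U \<theta> (e m)) (U \<theta> (R (e n))) = cnj (c m) * c n * x"
      by (simp add: Ue x_def cinner_cscale_left cinner_cscale_right)
    moreover have "cinner (U \<theta> (e m)) (U \<theta> (R (e n))) = x"
      by (simp add: U(1) x_def)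
    ultimately have "x = 0" unfolding c by simp
    with False show ?thesis by (simp add: x_def cinner_cscale_right cinner_basis)
  qed (simp add: cinner_cscale_right cinner_basis)
qed

end

section \<open>Polynomials times Gaussians\<close>

text \<open>The parameters are complex because the kernels of the transforms are Gaussians with
  imaginary exponent; multiplying by such a kernel only changes \<open>p\<close> and
  \<open>q\<close>, up to a factor independent of the integration variable.\<close>

definition gpoly :: "complex \<Rightarrow> complex \<Rightarrow> complex poly \<Rightarrow> real \<Rightarrow> complex" where
  "gpoly p q P s = poly P (of_real s) * exp (- p * (of_real s)\<^sup>2 / 2 - q * of_real s)"

lemma gpoly_add: "gpoly p q (P + Q) s = gpoly p q P s + gpoly p q Q s"
  and gpoly_diff: "gpoly p q (P - Q) s = gpoly p q P s - gpoly p q Q s"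
  and gpoly_smult: "gpoly p q (smult c P) s = c * gpoly p q P s"
  by (simp_all add: gpoly_def algebra_simps)

lemma gpoly_mult: "gpoly p q P s * gpoly p' q' Q s = gpoly (p + p') (q + q') (P * Q) s"
proof -
  have "- (p + p') * (of_real s)\<^sup>2 / 2 - (q + q') * of_real s
      = (- p * (of_real s)\<^sup>2 / 2 - q * of_real s) + (- p' * (of_real s)\<^sup>2 / 2 - q' * of_real s)"
    by (simp add: field_simps)
  then show ?thesis by (simp add: gpoly_def exp_add)
qed

lemma continuous_gpoly: "continuous_on A (gpoly p q P)"
  unfolding gpoly_def by (intro continuous_intros) simp

lemma measurable_gpoly [measurable]: "gpoly p q P \<in> borel_measurable borel"
  by (rule borel_measurable_continuous_onI[OF continuous_gpoly])

lemma integrable_gaussian: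
  assumes "0 < a"
  shows "integrable lborel (\<lambda>s::real. exp (- a * s\<^sup>2))"
proof -
  \<comment> \<open>The variance \<open>1 / (2 * a)\<close> turns the normal density into a multiple
    of \<open>exp (- a * s^2)\<close>.\<close>
  have "integrable lborel (\<lambda>s. sqrt (2 * pi * (sqrt (1 / (2 * a)))\<^sup>2) * normal_density 0 (sqrt (1 / (2 * a))) s)"
    using assms by (intro integrable_mult_right integrable_normal_density) simp
  also have "(\<lambda>s. sqrt (2 * pi * (sqrt (1 / (2 * a)))\<^sup>2) * normal_density 0 (sqrt (1 / (2 * a))) s)
      = (\<lambda>s. exp (- a * s\<^sup>2))"
    using assms by (auto simp: normal_density_def fun_eq_iff)
  finally show ?thesis .
qed

lemma linear_le_quadratic:
  fixes a c s :: real
  assumes "0 < a"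
  shows "c * s \<le> c\<^sup>2 / a + a * s\<^sup>2 / 4"
proof -
  have "0 \<le> (c / sqrt a - sqrt a * s / 2)\<^sup>2" by simp
  also have "\<dots> = c\<^sup>2 / a + a * s\<^sup>2 / 4 - c * s"
    using assms by (simp add: power2_diff power_divide power_mult_distrib)
  finally show ?thesis by simp
qed

lemma power_le_exp: "\<bar>s :: real\<bar> ^ k \<le> fact k * exp \<bar>s\<bar>"
proof -
  have "(\<Sum>i\<in>{k}. \<bar>s\<bar> ^ i /\<^sub>R fact i) \<le> (\<Sum>i. \<bar>s\<bar> ^ i /\<^sub>R fact i)"
    by (intro sum_le_suminf summable_exp_generic) auto
  then show ?thesis by (simp add: exp_def field_simps)
qed

text \<open>The power costs one unit of the linear exponent, whence \<open>c + 1\<close>; the linear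
  exponent costs half of the quadratic one, and the rate \<open>a / 4\<close> is what
  remains.\<close>

lemma power_exp_le_gaussian:
  fixes a c s :: real
  assumes "0 < a"
  shows "\<bar>s\<bar> ^ k * exp (c * \<bar>s\<bar> - a * s\<^sup>2 / 2) \<le> fact k * exp ((c + 1)\<^sup>2 / a) * exp (- (a / 4) * s\<^sup>2)"
proof -
  have "\<bar>s\<bar> ^ k * exp (c * \<bar>s\<bar> - a * s\<^sup>2 / 2) \<le> fact k * exp \<bar>s\<bar> * exp (c * \<bar>s\<bar> - a * s\<^sup>2 / 2)"
    by (rule mult_right_mono[OF power_le_exp]) simp
  also have "\<dots> = fact k * exp ((c + 1) * \<bar>s\<bar> - a * s\<^sup>2 / 2)"
    by (simp add: exp_add[symmetric] algebra_simps)
  also have "\<dots> \<le> fact k * exp ((c + 1)\<^sup>2 / a - (a / 4) * s\<^sup>2)"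
    using linear_le_quadratic[OF assms, of "c + 1" "\<bar>s\<bar>"] by simp
  also have "\<dots> = fact k * exp ((c + 1)\<^sup>2 / a) * exp (- (a / 4) * s\<^sup>2)"
    by (simp add: exp_add[symmetric])
  finally show ?thesis .
qed

lemma gpoly_bound:
  assumes "0 < Re p"
  obtains C where "0 \<le> C" "\<And>s. cmod (gpoly p q P s) \<le> C * exp (- (Re p / 4) * s\<^sup>2)"
proof
  define K where "K = (\<lambda>i. cmod (coeff P i) * (fact i * exp ((cmod q + 1)\<^sup>2 / Re p)))"
  show "0 \<le> (\<Sum>i\<le>degree P. K i)" by (intro sum_nonneg) (simp add: K_def)
  fix s
  have "Re (- p * (of_real s)\<^sup>2 / 2 - q * of_real s) = - (Re p * s\<^sup>2 / 2) - Re q * s"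
    by (simp add: of_real_power[symmetric] del: of_real_power)
  moreover have "\<bar>Re q * s\<bar> \<le> cmod q * \<bar>s\<bar>"
    unfolding abs_mult by (intro mult_right_mono abs_Re_le_cmod) simp
  ultimately have exp: "cmod (exp (- p * (of_real s)\<^sup>2 / 2 - q * of_real s)) \<le> exp (cmod q * \<bar>s\<bar> - Re p * s\<^sup>2 / 2)"
    unfolding norm_exp_eq_Re by simp
  have "cmod (gpoly p q P s)
      \<le> (\<Sum>i\<le>degree P. cmod (coeff P i) * \<bar>s\<bar> ^ i) * exp (cmod q * \<bar>s\<bar> - Re p * s\<^sup>2 / 2)"
    unfolding gpoly_def norm_mult
    by (intro mult_mono exp sum_nonneg)
       (auto simp: poly_altdef norm_mult norm_power intro!: order_trans[OF norm_sum])
  also have "\<dots> = (\<Sum>i\<le>degree P. cmod (coeff P i) * (\<bar>s\<bar> ^ i * exp (cmod q * \<bar>s\<bar> - Re p * s\<^sup>2 / 2)))"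
    by (simp add: sum_distrib_right mult.assoc)
  also have "\<dots> \<le> (\<Sum>i\<le>degree P. cmod (coeff P i) * (fact i * exp ((cmod q + 1)\<^sup>2 / Re p) * exp (- (Re p / 4) * s\<^sup>2)))"
    by (intro sum_mono mult_left_mono power_exp_le_gaussian assms) auto
  also have "\<dots> = (\<Sum>i\<le>degree P. K i) * exp (- (Re p / 4) * s\<^sup>2)"
    by (simp add: K_def sum_distrib_right mult.assoc)
  finally show "cmod (gpoly p q P s) \<le> (\<Sum>i\<le>degree P. K i) * exp (- (Re p / 4) * s\<^sup>2)" .
qed

lemma integrable_gpoly:
  assumes "0 < Re p"
  shows "integrable lborel (gpoly p q P)"
proof -
  obtain C where C: "\<And>s. cmod (gpoly p q P s) \<le> C * exp (- (Re p / 4) * s\<^sup>2)"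
    using gpoly_bound[OF assms] by metis
  have "integrable lborel (\<lambda>s. C * exp (- (Re p / 4) * s\<^sup>2))"
    using assms by (intro integrable_mult_right integrable_gaussian) simp
  then show ?thesis
    by (rule Bochner_Integration.integrable_bound) (auto intro!: always_eventually order_trans[OF C])
qed

lemma square_integrable_gpoly:
  assumes "0 < Re p"
  shows "square_integrable (gpoly p q P)"
proof -
  obtain C where C: "\<And>s. cmod (gpoly p q P s) \<le> C * exp (- (Re p / 4) * s\<^sup>2)"
    using gpoly_bound[OF assms] by metis
  have int: "integrable lborel (\<lambda>s. C\<^sup>2 * exp (- (Re p / 2) * s\<^sup>2))"
    using assms by (intro integrable_mult_right integrable_gaussian) simp
  have le: "norm ((cmod (gpoly p q P s))\<^sup>2) \<le> norm (C\<^sup>2 * exp (- (Re p / 2) * s\<^sup>2))" for s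
  proof -
    have "(cmod (gpoly p q P s))\<^sup>2 \<le> (C * exp (- (Re p / 4) * s\<^sup>2))\<^sup>2"
      by (intro power_mono C) simp
    also have "\<dots> = C\<^sup>2 * exp (- (Re p / 2) * s\<^sup>2)"
      by (simp add: power_mult_distrib exp_double[symmetric])
    finally show ?thesis by simp
  qed
  have "integrable lborel (\<lambda>s. (cmod (gpoly p q P s))\<^sup>2)"
    by (rule Bochner_Integration.integrable_bound[OF int _ always_eventually[OF allI[OF le]]]) measurable
  then show ?thesis by (simp add: square_integrable_def)
qed

lemma has_vector_derivative_gpoly:
  "(gpoly p q P has_vector_derivative gpoly p q (pderiv P - [:q, p:] * P) s) (at s within A)"
proof -
  define F where "F = (\<lambda>z. poly P z * exp (- p * z\<^sup>2 / 2 - q * z))"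
  have "(F has_field_derivative gpoly p q (pderiv P - [:q, p:] * P) s) (at (of_real s))"
    unfolding F_def gpoly_def
    by (auto intro!: derivative_eq_intros simp: algebra_simps)
  then have "((\<lambda>s. F (of_real s)) has_vector_derivative gpoly p q (pderiv P - [:q, p:] * P) s) (at s)"
    by (rule has_vector_derivative_real_field)
  then show ?thesis
    by (simp add: F_def gpoly_def[abs_def] has_vector_derivative_at_within)
qed

text \<open>The fundamental theorem of calculus on \<open>[-n, n]\<close>, with dominated
  convergence for the integrals and vanishing boundary terms.\<close>

lemma integral_derivative_eq_0:
  fixes F f :: "real \<Rightarrow> complex"
  assumes F: "\<And>x. (F has_vector_derivative f x) (at x)"
    and f: "continuous_on UNIV f" "integrable lborel f"
    and lim: "(\<lambda>n. F (real n)) \<longlonglongrightarrow> 0" "(\<lambda>n. F (- real n)) \<longlonglongrightarrow> 0"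
  shows "(\<integral>x. f x \<partial>lborel) = 0"
proof -
  have "(\<lambda>n. \<integral>x. indicator {- real n..real n} x *\<^sub>R f x \<partial>lborel) \<longlonglongrightarrow> (\<integral>x. f x \<partial>lborel)"
  proof (rule integral_dominated_convergence[where w = "\<lambda>x. norm (f x)"])
    have [measurable]: "f \<in> borel_measurable borel" using f(1) by (rule borel_measurable_continuous_onI)
    show "f \<in> borel_measurable lborel"
      "(\<lambda>x. indicator {- real n..real n} x *\<^sub>R f x) \<in> borel_measurable lborel" for n by simp_all
    have "(\<lambda>n. indicator {- real n..real n} x *\<^sub>R f x) \<longlonglongrightarrow> f x" for x
    proof (rule tendsto_eventually)
      show "\<forall>\<^sub>F n in sequentially. indicator {- real n..real n} x *\<^sub>R f x = f x"
        using eventually_ge_at_top[of "nat \<lceil>\<bar>x\<bar>\<rceil>"] by eventually_elim (auto simp: indicator_def nat_le_iff le_of_int_ceiling ceiling_le_iff)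
    qed
    then show "AE x in lborel. (\<lambda>n. indicator {- real n..real n} x *\<^sub>R f x) \<longlonglongrightarrow> f x" by simp
    show "AE x in lborel. norm (indicator {- real n..real n} x *\<^sub>R f x) \<le> norm (f x)" for n
      by (simp add: indicator_def)
  qed (use f(2) in simp)
  moreover have "(\<integral>x. indicator {- real n..real n} x *\<^sub>R f x \<partial>lborel) = F (real n) - F (- real n)" for n
    by (rule integral_FTC_Icc)
       (auto intro: has_vector_derivative_at_within[OF F] continuous_on_subset[OF f(1)])
  moreover have "(\<lambda>n. F (real n) - F (- real n)) \<longlonglongrightarrow> 0 - 0"
    by (intro tendsto_diff lim)
  ultimately show ?thesis by (simp add: LIMSEQ_unique)
qed

text \<open>The hypothesis on \<open>x\<close> covers both ends of the line, \<open>x n = n\<close>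
  and \<open>x n = - n\<close>.\<close>

lemma gpoly_tendsto_0:
  assumes "0 < Re p" "\<And>n. (x n)\<^sup>2 = (real n)\<^sup>2"
  shows "(\<lambda>n. gpoly p q P (x n)) \<longlonglongrightarrow> 0"
proof -
  obtain C where C: "0 \<le> C" "\<And>s. cmod (gpoly p q P s) \<le> C * exp (- (Re p / 4) * s\<^sup>2)"
    using gpoly_bound[OF assms(1)] by metis
  have "cmod (gpoly p q P (x n)) \<le> C * exp (- (Re p / 4)) ^ n" for n
  proof -
    have "real n \<le> (real n)\<^sup>2" by (cases n) (simp_all add: power2_eq_square)
    then have "exp (- (Re p / 4) * (real n)\<^sup>2) \<le> exp (- (Re p / 4)) ^ n"
      using assms(1) by (simp add: exp_of_nat_mult[symmetric] mult.commute mult_left_mono)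
    with C(1) show ?thesis by (intro order_trans[OF C(2)] mult_left_mono) (simp_all add: assms(2))
  qed
  moreover have "(\<lambda>n. C * exp (- (Re p / 4)) ^ n) \<longlonglongrightarrow> 0"
    using assms(1) by (intro tendsto_mult_right_zero LIMSEQ_power_zero) simp
  ultimately show ?thesis by (rule Lim_null_comparison[OF always_eventually[OF allI]])
qed

text \<open>Integration by parts; the moment formulas and the Hermite recurrences for integrals
  below are instances for chosen \<open>P\<close>.\<close>

lemma integral_gpoly_pderiv:
  assumes "0 < Re p"
  shows "(\<integral>s. gpoly p q (pderiv P) s \<partial>lborel) = (\<integral>s. gpoly p q ([:q, p:] * P) s \<partial>lborel)"
proof -
  have "(\<integral>s. gpoly p q (pderiv P - [:q, p:] * P) s \<partial>lborel) = 0"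
    by (rule integral_derivative_eq_0[OF has_vector_derivative_gpoly continuous_gpoly integrable_gpoly[OF assms]
          gpoly_tendsto_0[OF assms] gpoly_tendsto_0[OF assms]]) simp_all
  then show ?thesis
    by (simp add: gpoly_diff[abs_def] integrable_gpoly[OF assms] del: mult_pCons_left)
qed

text \<open>Differentiation under the integral sign. Convexity of \<open>S\<close> provides the mean
  value estimate that bounds the difference quotients by \<open>B\<close>, so dominated convergence
  applies.\<close>

lemma has_field_derivative_lebesgue_integral:
  fixes F :: "complex \<Rightarrow> 'a \<Rightarrow> complex"
  assumes S: "convex S" "z0 \<in> S"
    and int: "\<And>z. z \<in> S \<Longrightarrow> integrable M (F z)"
    and deriv: "\<And>z s. z \<in> S \<Longrightarrow> ((\<lambda>z. F z s) has_field_derivative F' z s) (at z within S)"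
    and bound: "\<And>z s. z \<in> S \<Longrightarrow> norm (F' z s) \<le> B s" "integrable M B"
    and [measurable]: "F' z0 \<in> borel_measurable M"
  shows "((\<lambda>z. \<integral>s. F z s \<partial>M) has_field_derivative (\<integral>s. F' z0 s \<partial>M)) (at z0 within S)"
  unfolding has_field_derivative_iff tendsto_at_iff_sequentially comp_def
proof (intro allI impI)
  fix X assume X: "\<forall>i. X i \<in> S - {z0}" "X \<longlonglongrightarrow> z0"
  have [measurable]: "F z \<in> borel_measurable M" if "z \<in> S" for z
    using int[OF that] by simp
  note XS = X(1)[rule_format, THEN DiffD1]
  have "(\<lambda>i. \<integral>s. (F (X i) s - F z0 s) / (X i - z0) \<partial>M) \<longlonglongrightarrow> (\<integral>s. F' z0 s \<partial>M)"
  proof (rule integral_dominated_convergence[where w = B])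
    show "(\<lambda>s. (F (X i) s - F z0 s) / (X i - z0)) \<in> borel_measurable M" for i
      using XS[of i] S(2) by measurable
    have "(\<lambda>i. (F (X i) s - F z0 s) / (X i - z0)) \<longlonglongrightarrow> F' z0 s" for s
      using deriv[OF S(2), of s] X
      unfolding has_field_derivative_iff tendsto_at_iff_sequentially comp_def by blast
    then show "AE s in M. (\<lambda>i. (F (X i) s - F z0 s) / (X i - z0)) \<longlonglongrightarrow> F' z0 s" by simp
    have "norm ((F (X i) s - F z0 s) / (X i - z0)) \<le> B s" for i s
    proof -
      have "norm (F (X i) s - F z0 s) \<le> B s * norm (X i - z0)"
        by (rule field_differentiable_bound[OF S(1) deriv bound(1) XS S(2)])
      moreover have "X i \<noteq> z0" using X(1) by auto
      ultimately show ?thesis by (simp add: norm_divide divide_le_eq)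
    qed
    then show "AE s in M. norm ((F (X i) s - F z0 s) / (X i - z0)) \<le> B s" for i by simp
  qed (use bound in simp_all)
  then show "(\<lambda>i. ((\<integral>s. F (X i) s \<partial>M) - (\<integral>s. F z0 s \<partial>M)) / (X i - z0)) \<longlonglongrightarrow> (\<integral>s. F' z0 s \<partial>M)"
    using int[OF XS] int[OF S(2)] by simp
qed

lemma integral_gpoly_linear:
  assumes "0 < Re p"
  shows "(\<integral>s. gpoly p q [:0, 1:] s \<partial>lborel) = - q / p * (\<integral>s. gpoly p q 1 s \<partial>lborel)"
proof -
  define I where "I = (\<lambda>P. \<integral>s. gpoly p q P s \<partial>lborel)"
  have "[:q, p:] = smult q 1 + smult p [:0, 1:]" by simp
  then have "I [:q, p:] = q * I 1 + p * I [:0, 1:]"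
    unfolding I_def by (simp only: gpoly_add[abs_def] gpoly_smult[abs_def]) (simp add: integrable_gpoly[OF assms])
  moreover have "I [:q, p:] = 0"
    using integral_gpoly_pderiv[OF assms, of q 1] by (simp add: I_def gpoly_def)
  ultimately have "p * I [:0, 1:] = - q * I 1" by (simp add: add_eq_0_iff)
  moreover have "p \<noteq> 0" using assms by auto
  ultimately show ?thesis by (simp add: I_def field_simps)
qed

lemma integral_gpoly_square:
  assumes "0 < Re p"
  shows "(\<integral>s. gpoly p q [:0, 0, 1:] s \<partial>lborel) = (1 / p + (q / p)\<^sup>2) * (\<integral>s. gpoly p q 1 s \<partial>lborel)"
proof -
  define I where "I = (\<lambda>P. \<integral>s. gpoly p q P s \<partial>lborel)"
  have "[:q, p:] * [:0, 1:] = smult q [:0, 1:] + smult p [:0, 0, 1:]" by simp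
  then have "I ([:q, p:] * [:0, 1:]) = q * I [:0, 1:] + p * I [:0, 0, 1:]"
    unfolding I_def by (simp only: gpoly_add[abs_def] gpoly_smult[abs_def]) (simp add: integrable_gpoly[OF assms])
  moreover have "I ([:q, p:] * [:0, 1:]) = I 1"
    using integral_gpoly_pderiv[OF assms, of q "[:0, 1:]"] unfolding I_def by (simp add: pderiv_pCons one_pCons del: mult_pCons_left)
  moreover have "I [:0, 1:] = - q / p * I 1"
    unfolding I_def by (rule integral_gpoly_linear[OF assms])
  moreover have "p \<noteq> 0" using assms by auto
  ultimately have "p * I [:0, 0, 1:] = I 1 + q * (q / p) * I 1" by (simp add: algebra_simps)
  with \<open>p \<noteq> 0\<close> have "I [:0, 0, 1:] = (1 / p + (q / p)\<^sup>2) * I 1"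
    by (simp add: field_simps power2_eq_square)
  then show ?thesis by (simp add: I_def)
qed

text \<open>Both parameters are deformed linearly to the standard Gaussian; by the two moment formulas the
  logarithmic derivative of the integral cancels that of the asserted value. Working on a convex set
  on which \<open>Re p\<close> is bounded below keeps the principal square root differentiable.\<close>

lemma gaussian_integral:
  assumes "0 < Re p"
  shows "csqrt (p / of_real (2 * pi)) * (\<integral>s. gpoly p q 1 s \<partial>lborel) = exp (q\<^sup>2 / (2 * p))"
proof -
  \<comment> \<open>Strictly below the real widths 1 and \<open>Re p\<close> at the two ends of the
    deformation, so that \<open>S\<close> contains 0 and 1.\<close>
  define \<delta> where "\<delta> = min 1 (Re p) / 2"
  have \<delta>: "0 < \<delta>" "\<delta> < 1" "\<delta> < Re p" using assms by (auto simp: \<delta>_def)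
  define S where "S = {z. \<delta> < Re (1 + z * (p - 1)) \<and> cmod z < 2}"
  have "S = {z. \<delta> - 1 < inner (cnj (p - 1)) z} \<inter> ball 0 2"
    by (auto simp: S_def inner_complex_def algebra_simps)
  then have S: "convex S" by (auto intro: convex_Int convex_halfspace_gt)
  have S01: "0 \<in> S" "1 \<in> S" using \<delta> by (auto simp: S_def)
  define P where "P = (\<lambda>z. 1 + z * (p - 1))"
  define Q where "Q = (\<lambda>z. z * q)"
  have P: "0 < Re (P z)" "\<delta> \<le> Re (P z)" "P z \<noteq> 0" if "z \<in> S" for z
  proof -
    show "0 < Re (P z)" "\<delta> \<le> Re (P z)" using that \<delta> by (auto simp: S_def P_def)
    then show "P z \<noteq> 0" by auto
  qed
  define J where "J = (\<lambda>z. \<integral>s. gpoly (P z) (Q z) 1 s \<partial>lborel)"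
  \<comment> \<open>The derivative of the exponent with respect to the deformation parameter, as a
    polynomial in \<open>s\<close>.\<close>
  define L where "L = [:0, - q, - (p - 1) / 2:]"
  have J': "(J has_field_derivative (\<integral>s. gpoly (P z) (Q z) L s \<partial>lborel)) (at z within S)" if z: "z \<in> S" for z
    unfolding J_def
  proof (rule has_field_derivative_lebesgue_integral[OF S z])
    fix w s assume w: "w \<in> S"
    show "integrable lborel (gpoly (P w) (Q w) 1)" by (rule integrable_gpoly[OF P(1)[OF w]])
    show "((\<lambda>w. gpoly (P w) (Q w) 1 s) has_field_derivative gpoly (P w) (Q w) L s) (at w within S)"
      unfolding gpoly_def P_def Q_def L_def
      by (auto intro!: derivative_eq_intros simp: field_simps power2_eq_square)
    have "cmod (gpoly (P w) (Q w) L s) = cmod (poly L (of_real s)) * exp (- (Re (P w) * s\<^sup>2 / 2) - Re (Q w) * s)"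
      by (simp add: gpoly_def norm_mult norm_exp_eq_Re of_real_power[symmetric] del: of_real_power)
    \<comment> \<open>The bound
      \<open>exp (k * \<bar>s\<bar>) \<le> exp (k * s) + exp (- k * s)\<close> keeps the majorant
      within the family \<open>gpoly\<close>, whose members with positive real width are integrable;
      it no longer depends on \<open>w\<close>.\<close>
    also have "\<dots> \<le> cmod (poly L (of_real s)) * (exp (- \<delta> * s\<^sup>2 / 2 - 2 * cmod q * s) + exp (- \<delta> * s\<^sup>2 / 2 + 2 * cmod q * s))"
    proof (rule mult_left_mono)
      have "\<delta> * s\<^sup>2 \<le> Re (P w) * s\<^sup>2" using P(2)[OF w] by (rule mult_right_mono) simp
      moreover have "\<bar>Re (Q w) * s\<bar> \<le> 2 * cmod q * \<bar>s\<bar>"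
        unfolding abs_mult
      proof (rule mult_right_mono)
        have "cmod w * cmod q \<le> 2 * cmod q"
          using w by (intro mult_right_mono) (auto simp: S_def)
        then show "\<bar>Re (Q w)\<bar> \<le> 2 * cmod q"
          using abs_Re_le_cmod[of "Q w"] by (simp add: Q_def norm_mult)
      qed simp
      ultimately have le: "- (Re (P w) * s\<^sup>2 / 2) - Re (Q w) * s \<le> - \<delta> * s\<^sup>2 / 2 + 2 * cmod q * \<bar>s\<bar>" by linarith
      show "exp (- (Re (P w) * s\<^sup>2 / 2) - Re (Q w) * s) \<le> exp (- \<delta> * s\<^sup>2 / 2 - 2 * cmod q * s) + exp (- \<delta> * s\<^sup>2 / 2 + 2 * cmod q * s)"
      proof (cases "0 \<le> s")
        case True
        with le have "exp (- (Re (P w) * s\<^sup>2 / 2) - Re (Q w) * s) \<le> exp (- \<delta> * s\<^sup>2 / 2 + 2 * cmod q * s)" by simp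
        then show ?thesis by (smt (verit) exp_ge_zero)
      next
        case False
        with le have "exp (- (Re (P w) * s\<^sup>2 / 2) - Re (Q w) * s) \<le> exp (- \<delta> * s\<^sup>2 / 2 - 2 * cmod q * s)" by simp
        then show ?thesis by (smt (verit) exp_ge_zero)
      qed
    qed simp
    also have "\<dots> = cmod (gpoly (of_real \<delta>) (of_real (2 * cmod q)) L s) + cmod (gpoly (of_real \<delta>) (of_real (- 2 * cmod q)) L s)"
      by (simp add: gpoly_def norm_mult norm_exp_eq_Re of_real_power[symmetric] distrib_left del: of_real_power)
    finally show "norm (gpoly (P w) (Q w) L s) \<le> \<dots>" .
  next
    show "integrable lborel (\<lambda>s. cmod (gpoly (of_real \<delta>) (of_real (2 * cmod q)) L s) + cmod (gpoly (of_real \<delta>) (of_real (- 2 * cmod q)) L s))"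
      by (intro Bochner_Integration.integrable_add Bochner_Integration.integrable_norm integrable_gpoly) (use \<delta> in simp_all)
  qed simp
  have L: "(\<integral>s. gpoly (P z) (Q z) L s \<partial>lborel) = (q * Q z / P z - (p - 1) / 2 * (1 / P z + (Q z / P z)\<^sup>2)) * J z"
    if z: "z \<in> S" for z
  proof -
    have "L = smult (- q) [:0, 1:] + smult (- (p - 1) / 2) [:0, 0, 1:]" by (simp add: L_def)
    then have "(\<integral>s. gpoly (P z) (Q z) L s \<partial>lborel)
        = - q * (\<integral>s. gpoly (P z) (Q z) [:0, 1:] s \<partial>lborel) + (- (p - 1) / 2) * (\<integral>s. gpoly (P z) (Q z) [:0, 0, 1:] s \<partial>lborel)"
      by (simp only: gpoly_add[abs_def] gpoly_smult[abs_def]) (simp add: integrable_gpoly[OF P(1)[OF z]])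
    note this[unfolded integral_gpoly_linear[OF P(1)[OF z]] integral_gpoly_square[OF P(1)[OF z]]]
    also have "(\<integral>s. gpoly (P z) (Q z) 1 s \<partial>lborel) = J z" by (simp add: J_def)
    finally show ?thesis by (simp add: algebra_simps add_divide_distrib diff_divide_distrib)
  qed
  \<comment> \<open>The quotient of the two sides of the claim along the deformation; its derivative
    vanishes, and at 0 it is the normalisation of the standard normal density.\<close>
  define W where "W = (\<lambda>z. csqrt (P z / of_real (2 * pi)) * J z * exp (- (Q z)\<^sup>2 / (2 * P z)))"
  have "\<exists>c. \<forall>z\<in>S. W z = c"
  proof (rule has_field_derivative_zero_constant[OF S])
    fix z assume z: "z \<in> S"
    define r where "r = csqrt (P z / of_real (2 * pi))"
    have r2: "r * r = P z / of_real (2 * pi)"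
      by (simp add: r_def power2_eq_square[symmetric])
    have r0: "r \<noteq> 0" using P(3)[OF z] by (simp add: r_def)
    have dP: "(P has_field_derivative (p - 1)) (at z within S)"
      unfolding P_def by (auto intro!: derivative_eq_intros)
    have dQ: "(Q has_field_derivative q) (at z within S)"
      unfolding Q_def by (auto intro!: derivative_eq_intros)
    have "0 < Re (P z / of_real (2 * pi))"
      unfolding Re_divide_of_real using P(1)[OF z] by simp
    then have "P z / of_real (2 * pi) \<notin> \<real>\<^sub>\<le>\<^sub>0"
      by (meson complex_nonpos_Reals_iff not_le)
    then have "((\<lambda>z. csqrt (P z / of_real (2 * pi))) has_field_derivative ((p - 1) / of_real (2 * pi)) / (2 * r)) (at z within S)"
      unfolding r_def by (rule has_field_derivative_csqrt'[OF DERIV_cdivide[OF dP]])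
    moreover have "((p - 1) / of_real (2 * pi)) / (2 * r) = r * (p - 1) / (2 * P z)"
    proof -
      have "P z = r * r * of_real (2 * pi)" using r2 by simp
      then show ?thesis using r0 by (simp add: divide_simps)
    qed
    ultimately have dr: "((\<lambda>z. csqrt (P z / of_real (2 * pi))) has_field_derivative (r * (p - 1) / (2 * P z))) (at z within S)"
      by simp
    have de: "((\<lambda>z. exp (- (Q z)\<^sup>2 / (2 * P z))) has_field_derivative
        exp (- (Q z)\<^sup>2 / (2 * P z)) * (- q * Q z / P z + (Q z / P z)\<^sup>2 * (p - 1) / 2)) (at z within S)"
    proof (rule DERIV_chain2[OF DERIV_exp])
      show "((\<lambda>z. - (Q z)\<^sup>2 / (2 * P z)) has_field_derivative (- q * Q z / P z + (Q z / P z)\<^sup>2 * (p - 1) / 2)) (at z within S)"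
        by (rule DERIV_cong[OF DERIV_divide[OF DERIV_minus[OF DERIV_power[OF dQ]] DERIV_cmult[OF dP]]])
           (use P(3)[OF z] in \<open>simp_all add: field_simps power2_eq_square\<close>)
    qed
    define x where "x = exp (- (Q z)\<^sup>2 / (2 * P z))"
    have "(W has_field_derivative (r * (p - 1) / (2 * P z) * J z + (\<integral>s. gpoly (P z) (Q z) L s \<partial>lborel) * r) * x
        + x * (- q * Q z / P z + (Q z / P z)\<^sup>2 * (p - 1) / 2) * (r * J z)) (at z within S)"
      unfolding W_def x_def r_def by (intro DERIV_mult dr[unfolded r_def] de J' z)
    also have "(r * (p - 1) / (2 * P z) * J z + (\<integral>s. gpoly (P z) (Q z) L s \<partial>lborel) * r) * x
        + x * (- q * Q z / P z + (Q z / P z)\<^sup>2 * (p - 1) / 2) * (r * J z) = 0"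
      unfolding L[OF z] using P(3)[OF z] by (simp add: field_simps power2_eq_square)
    finally show "(W has_field_derivative 0) (at z within S)" .
  qed
  then have "W 1 = W 0" using S01 by metis
  moreover have "W 0 = 1"
  proof -
    have "J 0 = (\<integral>s. complex_of_real (sqrt (2 * pi) * std_normal_density s) \<partial>lborel)"
      unfolding J_def P_def Q_def
      by (intro Bochner_Integration.integral_cong refl)
         (simp add: gpoly_def std_normal_density_def exp_of_real[symmetric])
    also have "\<dots> = of_real (sqrt (2 * pi))"
      by (subst integral_complex_of_real) simp
    finally have J0: "J 0 = of_real (sqrt (2 * pi))" .
    have "W 0 = of_real (1 / sqrt (2 * pi)) * J 0"
      by (simp add: W_def P_def Q_def csqrt_of_real_nonneg real_sqrt_divide of_real_divide[symmetric] del: of_real_divide)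
    also have "\<dots> = 1" unfolding J0 of_real_mult[symmetric] by simp
    finally show ?thesis .
  qed
  ultimately have "csqrt (p / of_real (2 * pi)) * (\<integral>s. gpoly p q 1 s \<partial>lborel) * exp (- q\<^sup>2 / (2 * p)) = 1"
    by (simp add: W_def J_def P_def Q_def)
  then show ?thesis by (simp add: exp_minus field_simps)
qed

section \<open>Determinacy of exponentially integrable functions by their moments\<close>

lemma iexp_partial_sum_bound:
  "cmod (\<Sum>k<N. (\<i> * of_real x) ^ k / fact k) \<le> exp \<bar>x\<bar>"
proof -
  have "cmod (\<Sum>k<N. (\<i> * of_real x) ^ k / fact k) \<le> (\<Sum>k<N. \<bar>x\<bar> ^ k /\<^sub>R fact k)"
    by (rule order_trans[OF norm_sum], simp add: norm_divide norm_power norm_mult)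
       (simp add: divide_inverse mult.commute)
  also have "\<dots> \<le> (\<Sum>k. \<bar>x\<bar> ^ k /\<^sub>R fact k)"
    by (intro sum_le_suminf summable_exp_generic) auto
  finally show ?thesis by (simp add: exp_def)
qed

text \<open>Expansion of the exponential under the integral sign: its partial sums are bounded by
  \<open>exp (\<bar>x\<bar> * \<bar>t\<bar>)\<close>, and integrability at every exponential rate
  justifies the exchange for every \<open>x\<close>.\<close>

lemma Fourier_eq_0_of_moments:
  fixes u :: "real \<Rightarrow> real"
  assumes [measurable]: "u \<in> borel_measurable borel"
    and int: "\<And>c. integrable lborel (\<lambda>t. u t * exp (c * \<bar>t\<bar>))"
    and mom: "\<And>n. (\<integral>t. t ^ n * u t \<partial>lborel) = 0"
  shows "(\<integral>t. iexp (x * t) * of_real (u t) \<partial>lborel) = 0"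
proof -
  define S where "S = (\<lambda>N t. (\<Sum>k<N. (\<i> * of_real (x * t)) ^ k / fact k) * complex_of_real (u t))"
  have "(\<lambda>N. \<integral>t. S N t \<partial>lborel) \<longlonglongrightarrow> (\<integral>t. iexp (x * t) * of_real (u t) \<partial>lborel)"
  proof (rule integral_dominated_convergence[where w = "\<lambda>t. \<bar>u t * exp (\<bar>x\<bar> * \<bar>t\<bar>)\<bar>"])
    show "(\<lambda>t. iexp (x * t) * complex_of_real (u t)) \<in> borel_measurable lborel" by measurable
    show "S N \<in> borel_measurable lborel" for N unfolding S_def by measurable
    have "(\<lambda>N. S N t) \<longlonglongrightarrow> iexp (x * t) * of_real (u t)" for t
      unfolding S_def using exp_converges[of "\<i> * complex_of_real (x * t)"]
      by (intro tendsto_mult tendsto_const) (simp add: sums_def scaleR_conv_of_real divide_inverse mult.commute)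
    then show "AE t in lborel. (\<lambda>N. S N t) \<longlonglongrightarrow> iexp (x * t) * of_real (u t)" by simp
    have "norm (S N t) \<le> \<bar>u t * exp (\<bar>x\<bar> * \<bar>t\<bar>)\<bar>" for N t
      unfolding S_def norm_mult using iexp_partial_sum_bound[of "x * t" N]
      by (simp add: abs_mult mult.commute mult_left_mono)
    then show "AE t in lborel. norm (S N t) \<le> \<bar>u t * exp (\<bar>x\<bar> * \<bar>t\<bar>)\<bar>" for N by simp
    show "integrable lborel (\<lambda>t. \<bar>u t * exp (\<bar>x\<bar> * \<bar>t\<bar>)\<bar>)" by (intro integrable_abs int)
  qed
  moreover have "(\<integral>t. S N t \<partial>lborel) = 0" for N
  proof -
    have tk: "integrable lborel (\<lambda>t. t ^ k * u t)" for k
    proof (rule Bochner_Integration.integrable_bound[OF integrable_mult_right[OF int[of 1], of "fact k"] _ always_eventually[OF allI]])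
      show "norm (t ^ k * u t) \<le> norm (fact k * (u t * exp (1 * \<bar>t\<bar>)))" for t
        using mult_right_mono[OF power_le_exp[of t k], of "\<bar>u t\<bar>"] by (simp add: abs_mult power_abs mult_ac)
    qed measurable
    have "S N = (\<lambda>t. \<Sum>k<N. (\<i> * of_real x) ^ k / fact k * complex_of_real (t ^ k * u t))"
      by (auto simp: S_def sum_distrib_right power_mult_distrib fun_eq_iff intro!: sum.cong)
    then have "(\<integral>t. S N t \<partial>lborel) = (\<Sum>k<N. \<integral>t. (\<i> * of_real x) ^ k / fact k * complex_of_real (t ^ k * u t) \<partial>lborel)"
      by (simp only:) (intro Bochner_Integration.integral_sum integrable_mult_right integrable_of_real tk)
    also have "\<dots> = 0"
      by (simp only: integral_mult_right_zero integral_complex_of_real mom) simp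
    finally show ?thesis .
  qed
  ultimately show ?thesis by (simp add: LIMSEQ_const_iff)
qed

text \<open>Positive and negative part have equal mass, by the case \<open>x = 0\<close>. If it is
  positive, normalising gives probability densities with the same characteristic function, and
  Levy's uniqueness theorem applies.\<close>

lemma AE_eq_0_of_Fourier_eq_0:
  fixes u :: "real \<Rightarrow> real"
  assumes u: "integrable lborel u"
    and F: "\<And>x. (\<integral>t. iexp (x * t) * of_real (u t) \<partial>lborel) = 0"
  shows "AE t in lborel. u t = 0"
proof -
  have [measurable]: "u \<in> borel_measurable borel" using borel_measurable_integrable[OF u] by simp
  define up where "up = (\<lambda>t. max 0 (u t))"
  define un where "un = (\<lambda>t. max 0 (- u t))"
  have [measurable]: "up \<in> borel_measurable borel" "un \<in> borel_measurable borel"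
    unfolding up_def un_def by measurable
  have pos: "0 \<le> up t" "0 \<le> un t" and u_eq: "u t = up t - un t" for t
    by (auto simp: up_def un_def)
  have int: "integrable lborel up" "integrable lborel un"
    by (rule Bochner_Integration.integrable_bound[OF u]; auto simp: up_def un_def)+
  define m where "m = (\<integral>t. up t \<partial>lborel)"
  have "complex_of_real (\<integral>t. u t \<partial>lborel) = 0"
    using F[of 0] by simp
  then have "(\<integral>t. up t - un t \<partial>lborel) = 0"
    by (simp add: u_eq)
  then have m: "m = (\<integral>t. un t \<partial>lborel)"
    using int by (simp add: m_def)
  have AE: "AE t in lborel. up t = un t"
  proof (cases "m = 0")
    case True
    then have "(\<integral>t. up t \<partial>lborel) = 0" "(\<integral>t. un t \<partial>lborel) = 0"
      using m m_def by auto
    then have "AE t in lborel. up t = 0" "AE t in lborel. un t = 0"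
      using integral_nonneg_eq_0_iff_AE[OF int(1)] integral_nonneg_eq_0_iff_AE[OF int(2)] pos by auto
    then show ?thesis by eventually_elim simp
  next
    case False
    have m0: "0 < m" using False pos by (simp add: m_def order_less_le integral_nonneg)
    have dist: "real_distribution (density lborel (\<lambda>t. ennreal (v t / m)))"
      if [measurable]: "v \<in> borel_measurable borel" and v: "integrable lborel v" "\<And>t. 0 \<le> v t" "(\<integral>t. v t \<partial>lborel) = m" for v
    proof -
      have "emeasure (density lborel (\<lambda>t. ennreal (v t / m))) UNIV = (\<integral>\<^sup>+t. ennreal (v t / m) \<partial>lborel)"
        by (subst emeasure_density) auto
      also have "\<dots> = ennreal (\<integral>t. v t / m \<partial>lborel)"
        using v m0 by (intro nn_integral_eq_integral) auto
      also have "\<dots> = 1" using v(3) m0 by simp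
      finally have "prob_space (density lborel (\<lambda>t. ennreal (v t / m)))" by (intro prob_spaceI) simp
      then show ?thesis by (simp add: real_distribution_def real_distribution_axioms_def)
    qed
    have char: "char (density lborel (\<lambda>t. ennreal (v t / m))) x = (\<integral>t. iexp (x * t) * of_real (v t) \<partial>lborel) / of_real m"
      if [measurable]: "v \<in> borel_measurable borel" and v: "\<And>t. 0 \<le> v t" for v x
    proof -
      have "char (density lborel (\<lambda>t. ennreal (v t / m))) x = (\<integral>t. (v t / m) *\<^sub>R iexp (x * t) \<partial>lborel)"
        unfolding char_def using v m0 by (subst integral_density) auto
      also have "\<dots> = (\<integral>t. iexp (x * t) * of_real (v t) / of_real m \<partial>lborel)"
        by (intro Bochner_Integration.integral_cong refl) (simp add: scaleR_conv_of_real mult.commute)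
      finally show ?thesis by simp
    qed
    have iexp_int: "integrable lborel (\<lambda>t. iexp (x * t) * of_real (v t))" if v: "integrable lborel v" for v :: "real \<Rightarrow> real" and x
      by (rule Bochner_Integration.integrable_bound[OF v])
         (use borel_measurable_integrable[OF v] in \<open>auto simp: norm_mult\<close>)
    have "density lborel (\<lambda>t. ennreal (up t / m)) = density lborel (\<lambda>t. ennreal (un t / m))"
    proof (rule Levy_uniqueness)
      show "real_distribution (density lborel (\<lambda>t. ennreal (up t / m)))"
        "real_distribution (density lborel (\<lambda>t. ennreal (un t / m)))"
        by (rule dist[OF _ int(1) pos(1) m_def[symmetric]], measurable)
           (rule dist[OF _ int(2) pos(2) m[symmetric]], measurable)
      show "char (density lborel (\<lambda>t. ennreal (up t / m))) = char (density lborel (\<lambda>t. ennreal (un t / m)))"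
      proof
        fix x
        have "(\<integral>t. iexp (x * t) * of_real (up t) \<partial>lborel) - (\<integral>t. iexp (x * t) * of_real (un t) \<partial>lborel) = 0"
          using F[of x] unfolding u_eq of_real_diff right_diff_distrib
            Bochner_Integration.integral_diff[OF iexp_int[OF int(1)] iexp_int[OF int(2)]] .
        then show "char (density lborel (\<lambda>t. ennreal (up t / m))) x = char (density lborel (\<lambda>t. ennreal (un t / m))) x"
          by (simp add: char pos)
      qed
    qed
    then have "AE t in lborel. ennreal (up t / m) = ennreal (un t / m)"
      by (intro sigma_finite_measure.density_unique[OF sigma_finite_lborel]) auto
    then show ?thesis
      by eventually_elim (use pos m0 in \<open>simp add: ennreal_inj divide_nonneg_pos\<close>)
  qed
  then show ?thesis by eventually_elim (simp add: u_eq)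
qed

text \<open>The weights \<open>t ^ n\<close> are real, so real and imaginary part can be treated
  separately.\<close>

lemma AE_eq_0_of_moments:
  fixes g :: "real \<Rightarrow> complex"
  assumes [measurable]: "g \<in> borel_measurable borel"
    and int: "\<And>c. integrable lborel (\<lambda>t. g t * of_real (exp (c * \<bar>t\<bar>)))"
    and mom: "\<And>n. (\<integral>t. of_real (t ^ n) * g t \<partial>lborel) = 0"
  shows "AE t in lborel. g t = 0"
proof -
  have tk: "integrable lborel (\<lambda>t. of_real (t ^ n) * g t)" for n
  proof (rule Bochner_Integration.integrable_bound[OF integrable_mult_right[OF int[of 1], of "fact n"] _ always_eventually[OF allI]])
    show "norm (of_real (t ^ n) * g t) \<le> norm (fact n * (g t * of_real (exp (1 * \<bar>t\<bar>))))" for t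
      using mult_right_mono[OF power_le_exp[of t n], of "cmod (g t)"]
      by (simp add: norm_mult norm_power power_abs mult_ac)
  qed measurable
  have "AE t in lborel. Re (g t) = 0"
  proof (rule AE_eq_0_of_Fourier_eq_0[OF _ Fourier_eq_0_of_moments])
    show "integrable lborel (\<lambda>t. Re (g t) * exp (c * \<bar>t\<bar>))" for c
      using integrable_Re[OF int[of c]] by simp
    show "(\<integral>t. t ^ n * Re (g t) \<partial>lborel) = 0" for n
      using integral_Re[OF tk[of n]] mom[of n] by simp
    show "integrable lborel (\<lambda>t. Re (g t))" using integrable_Re[OF int[of 0]] by simp
  qed measurable
  moreover have "AE t in lborel. Im (g t) = 0"
  proof (rule AE_eq_0_of_Fourier_eq_0[OF _ Fourier_eq_0_of_moments])
    show "integrable lborel (\<lambda>t. Im (g t) * exp (c * \<bar>t\<bar>))" for c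
      using integrable_Im[OF int[of c]] by simp
    show "(\<integral>t. t ^ n * Im (g t) \<partial>lborel) = 0" for n
      using integral_Im[OF tk[of n]] mom[of n] by simp
    show "integrable lborel (\<lambda>t. Im (g t))" using integrable_Im[OF int[of 0]] by simp
  qed measurable
  ultimately show ?thesis by eventually_elim (simp add: complex_eq_iff)
qed

section \<open>The Hermite--Gauss basis\<close>

text \<open>A complex copy of \<open>hermite\<close>, because \<open>gpoly\<close> takes complex
  polynomials.\<close>

fun hermC :: "nat \<Rightarrow> complex poly" where
  "hermC 0 = 1"
| "hermC (Suc n) = [:0, 2:] * hermC n - pderiv (hermC n)"

lemma coeff_hermC: "coeff (hermC n) k = of_real (coeff (hermite n) k)"
  by (induction n arbitrary: k) (auto simp: coeff_pderiv coeff_pCons coeff_1 split: nat.split)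

lemma poly_hermC: "poly (hermC n) (of_real t) = of_real (poly (hermite n) t)"
proof -
  have "degree (hermC n) = degree (hermite n)" by (simp add: degree_def coeff_hermC)
  then show ?thesis by (simp add: poly_altdef coeff_hermC)
qed

text \<open>Differentiating the recurrence reproduces it one index lower. So differentiation lowers
  the index, and the recurrence takes its three-term form.\<close>

lemma pderiv_hermC_Suc: "pderiv (hermC (Suc n)) = smult (2 * of_nat (Suc n)) (hermC n)"
proof (induction n)
  case 0
  show ?case by (simp add: pderiv_pCons one_pCons)
next
  case (Suc n)
  have "pderiv (hermC (Suc (Suc n))) = smult 2 (hermC (Suc n)) + ([:0, 2:] * pderiv (hermC (Suc n)) - pderiv (pderiv (hermC (Suc n))))"
    unfolding hermC.simps(2)[of "Suc n"] pderiv_diff pderiv_mult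
    by (simp add: pderiv_pCons del: hermC.simps)
  also have "[:0, 2:] * pderiv (hermC (Suc n)) - pderiv (pderiv (hermC (Suc n))) = smult (2 * of_nat (Suc n)) (hermC (Suc n))"
    unfolding Suc.IH pderiv_smult by (simp only: hermC.simps(2)[of n] mult_smult_right smult_diff_right)
  finally have "pderiv (hermC (Suc (Suc n))) = smult 2 (hermC (Suc n)) + smult (2 * of_nat (Suc n)) (hermC (Suc n))" .
  then show ?case by (simp only: smult_add_left[symmetric]) (simp add: algebra_simps del: hermC.simps)
qed

lemma hermC_Suc_Suc: "hermC (Suc (Suc n)) = [:0, 2:] * hermC (Suc n) - smult (2 * of_nat (Suc n)) (hermC n)"
  by (simp only: hermC.simps(2)[of "Suc n"] pderiv_hermC_Suc)

lemma integral_gpoly_hermC: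
  "(\<integral>t. gpoly 2 0 (hermC m * hermC n) t \<partial>lborel) = (if m = n then 2 ^ n * fact n * of_real (sqrt pi) else 0)"
proof -
  define L where "L = (\<lambda>P. \<integral>t. gpoly 2 0 P t \<partial>lborel)"
  have int: "integrable lborel (gpoly 2 0 P)" for P by (rule integrable_gpoly) simp
  have add: "L (P + Q) = L P + L Q" for P Q
    by (simp add: L_def gpoly_add[abs_def] int)
  have smult: "L (smult c P) = c * L P" for c P
    by (simp add: L_def gpoly_smult[abs_def])
  \<comment> \<open>Under the weight \<open>exp (- t^2)\<close> the raising operator
    \<open>2 * t - d/dt\<close> is adjoint to differentiation, so each induction step lowers both
    indices.\<close>
  have step: "L (hermC (Suc n) * Q) = L (hermC n * pderiv Q)" for n Q
  proof -
    have "hermC (Suc n) * Q + pderiv (hermC n * Q) = [:0, 2:] * (hermC n * Q) + hermC n * pderiv Q"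
      by (simp only: hermC.simps pderiv_mult left_diff_distrib mult.assoc) (simp add: algebra_simps)
    then have "L (hermC (Suc n) * Q) + L (pderiv (hermC n * Q)) = L ([:0, 2:] * (hermC n * Q)) + L (hermC n * pderiv Q)"
      by (simp only: add[symmetric])
    moreover have "L (pderiv (hermC n * Q)) = L ([:0, 2:] * (hermC n * Q))"
      unfolding L_def by (rule integral_gpoly_pderiv) simp
    ultimately show ?thesis by simp
  qed
  have L_0: "L 0 = 0" by (simp add: L_def gpoly_def)
  have L0: "L 1 = of_real (sqrt pi)"
  proof -
    have "csqrt (2 / of_real (2 * pi)) * L 1 = 1"
      using gaussian_integral[of 2 0] by (simp add: L_def)
    also have "2 / complex_of_real (2 * pi) = of_real (1 / pi)" by simp
    also have "csqrt \<dots> = of_real (1 / sqrt pi)"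
      by (subst csqrt_of_real_nonneg) (simp_all add: real_sqrt_divide)
    finally have "of_real (sqrt pi) * (of_real (1 / sqrt pi) * L 1) = of_real (sqrt pi)" by simp
    then show ?thesis by (simp only: mult.assoc[symmetric] of_real_mult[symmetric]) simp
  qed
  have "L (hermC m * hermC n) = (if m = n then 2 ^ n * fact n * of_real (sqrt pi) else 0)"
  proof (induction m arbitrary: n)
    case 0
    show ?case
    proof (cases n)
      case (Suc k)
      then show ?thesis using step[of k 1] by (simp add: L_0 del: hermC.simps(2))
    qed (simp add: L0)
  next
    case (Suc m)
    show ?case
    proof (cases n)
      case 0
      then show ?thesis using step[of m 1] by (simp add: L_0 del: hermC.simps(2))
    next
      case (Suc k)
      then show ?thesis
        unfolding \<open>n = Suc k\<close> step pderiv_hermC_Suc mult_smult_right smult Suc.IH by simp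
    qed
  qed
  then show ?thesis by (simp add: L_def)
qed

definition hermite_norm :: "nat \<Rightarrow> real" where
  "hermite_norm n = 1 / sqrt (2 ^ n * fact n * sqrt pi)"

lemma hermite_norm_pos: "0 < hermite_norm n"
  by (simp add: hermite_norm_def)

lemma of_real_hermite_gauss_fun:
  "of_real (hermite_gauss_fun n t) = of_real (hermite_norm n) * gpoly 1 0 (hermC n) t"
proof -
  have "exp (- (complex_of_real t)\<^sup>2 / 2) = of_real (exp (- t\<^sup>2 / 2))"
    by (simp add: exp_of_real[symmetric])
  then show ?thesis
    by (simp add: hermite_gauss_fun_def hermite_norm_def gpoly_def poly_hermC)
qed

lemma square_integrable_hermite_gauss_fun: "square_integrable (\<lambda>t. of_real (hermite_gauss_fun n t))"
  unfolding of_real_hermite_gauss_fun by (intro square_integrable_cmult square_integrable_gpoly) simp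

lemma measurable_hermite_gauss_fun [measurable]: "hermite_gauss_fun n \<in> borel_measurable borel"
proof -
  have "hermite_gauss_fun n = (\<lambda>t. hermite_norm n * (poly (hermite n) t * exp (- t\<^sup>2 / 2)))"
    by (simp add: hermite_gauss_fun_def hermite_norm_def fun_eq_iff)
  then show ?thesis
    by (simp only:) (intro borel_measurable_continuous_onI continuous_intros, simp)
qed

lemma cinner_hermite_gauss_hermite_gauss:
  "cinner (hermite_gauss m) (hermite_gauss n) = (if m = n then 1 else 0)"
proof -
  have "cinner (hermite_gauss m) (hermite_gauss n)
      = (\<integral>t. of_real (hermite_norm m * hermite_norm n) * gpoly 2 0 (hermC m * hermC n) t \<partial>lborel)"
    unfolding hermite_gauss_def cinner_abs[OF square_integrable_hermite_gauss_fun square_integrable_hermite_gauss_fun]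
  proof (intro Bochner_Integration.integral_cong refl)
    fix t
    show "cnj (of_real (hermite_gauss_fun m t)) * of_real (hermite_gauss_fun n t)
        = of_real (hermite_norm m * hermite_norm n) * gpoly 2 0 (hermC m * hermC n) t"
      unfolding complex_cnj_complex_of_real
      unfolding of_real_hermite_gauss_fun
      using gpoly_mult[of 1 0 "hermC m" t 1 0 "hermC n"] by (simp add: mult_ac)
  qed
  also have "\<dots> = of_real (hermite_norm m * hermite_norm n) * (if m = n then 2 ^ n * fact n * of_real (sqrt pi) else 0)"
    by (simp add: integral_gpoly_hermC)
  also have "\<dots> = (if m = n then 1 else 0)"
  proof (cases "m = n")
    case True
    have "hermite_norm n * hermite_norm n = 1 / (2 ^ n * fact n * sqrt pi)"
      by (simp add: hermite_norm_def real_sqrt_mult_self[unfolded abs_of_nonneg])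
    then have "hermite_norm n * hermite_norm n * (2 ^ n * fact n * sqrt pi) = 1" by simp
    then have "complex_of_real (hermite_norm n * hermite_norm n * (2 ^ n * fact n * sqrt pi)) = 1" by (simp only: of_real_1)
    with True show ?thesis by simp
  qed simp
  finally show ?thesis .
qed

text \<open>Since \<open>2 t H\<^sub>n = H\<^sub>n\<^sub>+\<^sub>1 + 2 n H\<^sub>n\<^sub>-\<^sub>1\<close>, vanishing of all Hermite coefficients implies vanishing of all moments.\<close>

lemma AE_eq_0_of_hermite_coeffs:
  fixes g :: "real \<Rightarrow> complex"
  assumes [measurable]: "g \<in> borel_measurable borel"
    and int: "\<And>c. integrable lborel (\<lambda>t. of_real (exp (c * \<bar>t\<bar> - t\<^sup>2 / 2)) * g t)"
    and coeff: "\<And>n. (\<integral>t. of_real (hermite_gauss_fun n t) * g t \<partial>lborel) = 0"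
  shows "AE t in lborel. g t = 0"
proof -
  define w where "w = (\<lambda>t. of_real (exp (- t\<^sup>2 / 2)) * g t)"
  have [measurable]: "w \<in> borel_measurable borel" unfolding w_def by measurable
  have wint: "integrable lborel (\<lambda>t. w t * of_real (exp (c * \<bar>t\<bar>)))" for c
  proof -
    have "exp (c * \<bar>t\<bar> - t\<^sup>2 / 2) = exp (c * \<bar>t\<bar>) * exp (- t\<^sup>2 / 2)" for t
      by (simp add: exp_add[symmetric])
    then show ?thesis using int[of c] by (simp add: w_def mult_ac)
  qed
  have tk: "integrable lborel (\<lambda>t. of_real (t ^ n) * w t)" for n
  proof (rule Bochner_Integration.integrable_bound[OF integrable_mult_right[OF wint[of 1], of "fact n"] _ always_eventually[OF allI]])
    show "norm (of_real (t ^ n) * w t) \<le> norm (fact n * (w t * of_real (exp (1 * \<bar>t\<bar>))))" for t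
      using mult_right_mono[OF power_le_exp[of t n], of "cmod (w t)"]
      by (simp add: norm_mult norm_power power_abs mult_ac)
  qed measurable
  have Pint: "integrable lborel (\<lambda>t. poly P (of_real t) * w t)" for P
  proof -
    have "(\<lambda>t. poly P (of_real t) * w t) = (\<lambda>t. \<Sum>i\<le>degree P. coeff P i * (of_real (t ^ i) * w t))"
      by (auto simp: poly_altdef sum_distrib_right mult.assoc)
    then show ?thesis
      by (simp only:) (intro Bochner_Integration.integrable_sum integrable_mult_right tk)
  qed
  define L where "L = (\<lambda>P. \<integral>t. poly P (of_real t) * w t \<partial>lborel)"
  have Ladd: "L (P + Q) = L P + L Q" for P Q by (simp add: L_def distrib_right Pint)
  have Lsmult: "L (smult c P) = c * L P" for c P by (simp add: L_def mult.assoc)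
  have L0: "L (hermC n) = 0" for n
  proof -
    have "of_real (hermite_gauss_fun n t) * g t = of_real (hermite_norm n) * (poly (hermC n) (of_real t) * w t)" for t
      by (simp add: hermite_gauss_fun_def hermite_norm_def poly_hermC w_def)
    then show ?thesis using coeff[of n] hermite_norm_pos[of n] by (simp add: L_def)
  qed
  have "L ([:0, 1:] ^ k * hermC n) = 0" for k n
  proof (induction k arbitrary: n)
    case (Suc k)
    have "smult 2 ([:0, 1:] ^ Suc k * hermC n) = [:0, 1:] ^ k * ([:0, 2:] * hermC n)"
      by simp
    also have "L \<dots> = 0"
    \<comment> \<open>For \<open>n = 0\<close> the recurrence has no lower term.\<close>
    proof (cases n)
      case 0
      then have "[:0, 2:] * hermC n = hermC 1" by (simp add: pderiv_1)
      then show ?thesis using Suc.IH[of 1] by (simp only:)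
    next
      case n: (Suc m)
      have "[:0, 1:] ^ k * ([:0, 2:] * hermC n)
          = [:0, 1:] ^ k * hermC (Suc n) + smult (2 * of_nat n) ([:0, 1:] ^ k * hermC m)"
        by (simp add: n hermC_Suc_Suc algebra_simps del: hermC.simps)
      then show ?thesis by (simp only: Ladd Lsmult Suc.IH) simp
    qed
    finally show ?case unfolding Lsmult by simp
  qed (simp add: L0)
  \<comment> \<open>As \<open>hermC 0 = 1\<close>, these are the plain moments.\<close>
  then have "L ([:0, 1:] ^ k * hermC 0) = 0" for k .
  then have "(\<integral>t. of_real (t ^ k) * w t \<partial>lborel) = 0" for k
    by (simp add: L_def poly_power)
  then have "AE t in lborel. w t = 0"
    by (intro AE_eq_0_of_moments wint) measurable
  then show ?thesis by eventually_elim (simp add: w_def)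
qed

lemma square_integrable_exp_abs_gaussian: "square_integrable (\<lambda>t. of_real (exp (c * \<bar>t\<bar> - t\<^sup>2 / 2)))"
proof -
  have le: "exp (c * \<bar>t\<bar> - t\<^sup>2 / 2) \<le> exp ((c + 1)\<^sup>2) * exp (- (1/4) * t\<^sup>2)" for t
    using power_exp_le_gaussian[of 1 t 0 c] by simp
  have "integrable lborel (\<lambda>t. (exp ((c + 1)\<^sup>2))\<^sup>2 * exp (- (1/2) * t\<^sup>2))"
    by (intro integrable_mult_right integrable_gaussian) simp
  then have "integrable lborel (\<lambda>t. (exp (c * \<bar>t\<bar> - t\<^sup>2 / 2))\<^sup>2)"
  proof (rule Bochner_Integration.integrable_bound[OF _ _ always_eventually[OF allI]])
    fix t :: real
    have "(exp (c * \<bar>t\<bar> - t\<^sup>2 / 2))\<^sup>2 \<le> (exp ((c + 1)\<^sup>2) * exp (- (1/4) * t\<^sup>2))\<^sup>2"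
      by (intro power_mono le) simp
    also have "\<dots> = (exp ((c + 1)\<^sup>2))\<^sup>2 * exp (- (1/2) * t\<^sup>2)"
      by (simp add: power_mult_distrib exp_double[symmetric])
    finally show "norm ((exp (c * \<bar>t\<bar> - t\<^sup>2 / 2))\<^sup>2) \<le> norm ((exp ((c + 1)\<^sup>2))\<^sup>2 * exp (- (1/2) * t\<^sup>2))" by simp
  qed measurable
  then show ?thesis by (simp add: square_integrable_def)
qed

lemma orthonormal_basis_hermite_gauss: "orthonormal_basis hermite_gauss"
proof (rule orthonormal_basisI[OF cinner_hermite_gauss_hermite_gauss])
  fix f assume f: "\<And>n. cinner (hermite_gauss n) f = 0"
  have "AE t in lborel. rep_l2 f t = 0"
  proof (rule AE_eq_0_of_hermite_coeffs)
    show "rep_l2 f \<in> borel_measurable borel"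
      using square_integrable_rep[of f] by (simp add: square_integrable_def)
    show "integrable lborel (\<lambda>t. of_real (exp (c * \<bar>t\<bar> - t\<^sup>2 / 2)) * rep_l2 f t)" for c
      using square_integrable_cnj_mult[OF square_integrable_exp_abs_gaussian square_integrable_rep] by simp
    have "cinner (hermite_gauss n) (abs_l2 (rep_l2 f)) = (\<integral>t. of_real (hermite_gauss_fun n t) * rep_l2 f t \<partial>lborel)" for n
      unfolding hermite_gauss_def cinner_abs[OF square_integrable_hermite_gauss_fun square_integrable_rep] by simp
    then show "(\<integral>t. of_real (hermite_gauss_fun n t) * rep_l2 f t \<partial>lborel) = 0" for n
      using f by (simp add: abs_rep_l2)
  qed
  then have "AE t in lborel. rep_l2 f t = rep_l2 0 t"
    using rep_abs_l2[OF square_integrable_zero] by (auto simp: abs_l2_zero elim: eventually_elim2)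
  then show "f = 0" by (rule l2_eqI)
qed

interpretation hg: onb hermite_gauss
  by unfold_locales (rule orthonormal_basis_hermite_gauss)

section \<open>The harmonic oscillator\<close>

lemma nth_deriv_0: "nth_deriv 0 f = f"
  and nth_deriv_Suc: "nth_deriv (Suc n) f t = vector_derivative (nth_deriv n f) (at t)"
  by (simp_all add: nth_deriv_def)

text \<open>The effect of differentiating \<open>P * exp (- t^2 / 2)\<close> on its polynomial
  factor.\<close>

definition gderiv :: "complex poly \<Rightarrow> complex poly" where
  "gderiv P = pderiv P - [:0, 1:] * P"

lemma nth_deriv_gpoly: "nth_deriv n (gpoly 1 0 P) = gpoly 1 0 ((gderiv ^^ n) P)"
proof (induction n)
  case (Suc n)
  have "vector_derivative (gpoly 1 0 Q) (at t) = gpoly 1 0 (gderiv Q) t" for Q t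
    unfolding gderiv_def by (rule vector_derivative_at[OF has_vector_derivative_gpoly])
  then show ?case by (simp add: fun_eq_iff nth_deriv_Suc Suc.IH)
qed (simp add: nth_deriv_0)

lemma schwartz_gpoly: "schwartz (gpoly 1 0 P)"
  unfolding schwartz_def nth_deriv_gpoly
proof (intro conjI allI)
  show "gpoly 1 0 ((gderiv ^^ n) P) differentiable at t" for n t
    using has_vector_derivative_gpoly differentiableI_vector by blast
  show "bounded (range (\<lambda>t. of_real (t ^ m) * gpoly 1 0 ((gderiv ^^ n) P) t))" for m n
  proof -
    define Q where "Q = [:0, 1:] ^ m * (gderiv ^^ n) P"
    obtain C where C: "0 \<le> C" "\<And>t. cmod (gpoly 1 0 Q t) \<le> C * exp (- (Re 1 / 4) * t\<^sup>2)"
      using gpoly_bound[of 1 0 Q] by auto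
    have "cmod (of_real (t ^ m) * gpoly 1 0 ((gderiv ^^ n) P) t) \<le> C" for t
    proof -
      have "of_real (t ^ m) * gpoly 1 0 ((gderiv ^^ n) P) t = gpoly 1 0 Q t"
        by (simp add: gpoly_def Q_def poly_power)
      moreover have "C * exp (- (Re 1 / 4) * t\<^sup>2) \<le> C"
        using C(1) by (intro mult_right_le_one_le) auto
      ultimately show ?thesis using C(2)[of t] by simp
    qed
    then show ?thesis by (auto intro: boundedI)
  qed
qed

text \<open>One factor \<open>cmod (k t)\<close> is bounded by \<open>B\<close>, the other by
  \<open>(B + C) / (1 + t^2)\<close>, which is integrable.\<close>

lemma square_integrable_of_decay:
  assumes k: "continuous_on UNIV k" "bounded (range k)" "bounded (range (\<lambda>t. of_real (t\<^sup>2) * k t))"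
  shows "square_integrable k"
proof -
  obtain B where B: "\<And>t. cmod (k t) \<le> B" using k(2) by (auto simp: bounded_iff)
  obtain C where C: "\<And>t. cmod (of_real (t\<^sup>2) * k t) \<le> C" using k(3) by (auto simp: bounded_iff)
  have [measurable]: "k \<in> borel_measurable borel" by (rule borel_measurable_continuous_onI[OF k(1)])
  have B0: "0 \<le> B" using order_trans[OF norm_ge_zero B] .
  have "integrable lborel (\<lambda>t::real. inverse (1 + t\<^sup>2))"
    using integrable_inverse_1_plus_square by (simp add: set_integrable_def)
  then have int: "integrable lborel (\<lambda>t::real. B * (B + C) * inverse (1 + t\<^sup>2))" by simp
  have le: "norm ((cmod (k t))\<^sup>2) \<le> norm (B * (B + C) * inverse (1 + t\<^sup>2))" for t
  proof -
    have pos: "0 < 1 + t\<^sup>2" by (simp add: add_pos_nonneg)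
    have "(1 + t\<^sup>2) * cmod (k t) \<le> B + C"
      using B[of t] C[of t] by (simp add: norm_mult norm_power distrib_right)
    then have "cmod (k t) \<le> (B + C) * inverse (1 + t\<^sup>2)"
      using pos by (simp add: field_simps)
    then have "cmod (k t) * cmod (k t) \<le> B * ((B + C) * inverse (1 + t\<^sup>2))"
      using B[of t] B0 by (intro mult_mono) auto
    then show ?thesis by (simp add: power2_eq_square mult.assoc)
  qed
  have "integrable lborel (\<lambda>t. (cmod (k t))\<^sup>2)"
    by (rule Bochner_Integration.integrable_bound[OF int _ always_eventually[OF allI[OF le]]]) measurable
  then show ?thesis by (simp add: square_integrable_def)
qed

lemma bounded_range_add:
  fixes f g :: "real \<Rightarrow> complex"
  assumes "bounded (range f)" "bounded (range g)"
  shows "bounded (range (\<lambda>t. f t + g t))"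
proof -
  obtain A B where "\<And>t. cmod (f t) \<le> A" "\<And>t. cmod (g t) \<le> B"
    using assms by (auto simp: bounded_iff)
  then have "cmod (f t + g t) \<le> A + B" for t
    by (meson add_mono norm_triangle_ineq order_trans)
  then show ?thesis by (auto intro: boundedI)
qed

lemma bounded_range_cmult:
  fixes f :: "real \<Rightarrow> complex"
  assumes "bounded (range f)"
  shows "bounded (range (\<lambda>t. c * f t))"
  using bounded_scaling bounded_linear_image[OF assms bounded_linear_mult_right[of c]] by (simp add: image_image)

section \<open>The oscillator on Schwartz functions and on polynomials times the Gaussian\<close>

definition osc :: "(real \<Rightarrow> complex) \<Rightarrow> real \<Rightarrow> complex" where
  "osc f t = (- nth_deriv 2 f t + of_real (t\<^sup>2) * f t) / 2"

lemma H_ell_eq_closure: "H_ell = closure {(abs_l2 f, abs_l2 (osc f)) | f. schwartz f}"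
  unfolding H_ell_def osc_def[abs_def] ..

context
  fixes f :: "real \<Rightarrow> complex"
  assumes f: "schwartz f"
begin

lemma schwartz_bounded: "bounded (range (\<lambda>t. of_real (t ^ m) * nth_deriv n f t))"
  using f by (simp add: schwartz_def)

lemma schwartz_has_vector_derivative: "(nth_deriv n f has_vector_derivative nth_deriv (Suc n) f t) (at t)"
  using f by (simp add: schwartz_def nth_deriv_Suc vector_derivative_works[symmetric])

lemma schwartz_continuous: "continuous_on A (nth_deriv n f)"
  using f by (auto simp: schwartz_def intro!: continuous_at_imp_continuous_on differentiable_imp_continuous_within)

lemma square_integrable_schwartz: "square_integrable f"
  using square_integrable_of_decay[OF schwartz_continuous, of 0] schwartz_bounded[of 0 0] schwartz_bounded[of 2 0]
  by (simp add: nth_deriv_0)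

lemma square_integrable_osc: "square_integrable (osc f)"
proof (rule square_integrable_of_decay)
  have eq: "osc f = (\<lambda>t. (- 1 / 2) * nth_deriv 2 f t + (1 / 2) * (of_real (t ^ 2) * nth_deriv 0 f t))"
    by (simp add: fun_eq_iff osc_def nth_deriv_0 field_simps)
  show "continuous_on UNIV (osc f)"
    unfolding eq by (intro continuous_intros schwartz_continuous)
  show "bounded (range (osc f))"
    unfolding eq
    using schwartz_bounded[of 0 2] by (intro bounded_range_add bounded_range_cmult schwartz_bounded) simp
  have "(\<lambda>t. of_real (t\<^sup>2) * osc f t) =
      (\<lambda>t. (- 1 / 2) * (of_real (t ^ 2) * nth_deriv 2 f t) + (1 / 2) * (of_real (t ^ 4) * nth_deriv 0 f t))"
    by (simp add: fun_eq_iff eq field_simps power2_eq_square power4_eq_xxxx)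
  then show "bounded (range (\<lambda>t. of_real (t\<^sup>2) * osc f t))"
    by (simp only:) (intro bounded_range_add bounded_range_cmult schwartz_bounded)
qed

text \<open>Green's identity: the Wronskian \<open>F\<close> has derivative \<open>F'\<close> and
  vanishes at both ends, because Gaussian factors meet bounded derivatives of \<open>f\<close>. The
  pairing carries no conjugate; it is applied to the real Hermite-Gauss functions.\<close>

lemma osc_symmetric_gpoly:
  "(\<integral>t. gpoly 1 0 P t * osc f t \<partial>lborel) = (\<integral>t. osc (gpoly 1 0 P) t * f t \<partial>lborel)"
proof -
  define h where "h = (\<lambda>n. gpoly 1 0 ((gderiv ^^ n) P))"
  have h_nth: "nth_deriv n (gpoly 1 0 P) = h n" for n
    by (simp add: h_def nth_deriv_gpoly)
  have hd: "(h n has_vector_derivative h (Suc n) t) (at t)" for n t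
    unfolding h_def funpow.simps comp_def gderiv_def[of "(gderiv ^^ n) P"] by (rule has_vector_derivative_gpoly)
  have hc: "continuous_on A (h n)" for A n unfolding h_def by (rule continuous_gpoly)
  have bdd: "\<exists>B. \<forall>t. cmod (nth_deriv n f t) \<le> B" for n
    using schwartz_bounded[of 0 n] by (auto simp: bounded_iff)
  have int: "integrable lborel (\<lambda>t. h m t * nth_deriv n f t)" for m n
  proof -
    obtain B where B: "\<And>t. cmod (nth_deriv n f t) \<le> B" using bdd by blast
    have [measurable]: "nth_deriv n f \<in> borel_measurable borel" "h m \<in> borel_measurable borel"
      by (intro borel_measurable_continuous_onI schwartz_continuous hc)+
    have "integrable lborel (\<lambda>t. B * h m t)"
      unfolding h_def by (intro integrable_mult_right integrable_gpoly) simp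
    then show ?thesis
    proof (rule Bochner_Integration.integrable_bound[OF _ _ always_eventually[OF allI]])
      fix t
      have "cmod (h m t) * cmod (nth_deriv n f t) \<le> cmod (h m t) * \<bar>B\<bar>"
        using B[of t] by (intro mult_left_mono) auto
      then show "norm (h m t * nth_deriv n f t) \<le> norm (of_real B * h m t)"
        by (simp add: norm_mult mult.commute)
    qed measurable
  qed
  have lim: "(\<lambda>k. h m (x k) * nth_deriv n f (x k)) \<longlonglongrightarrow> 0"
    if "\<And>k. (x k)\<^sup>2 = (real k)\<^sup>2" for m n x
  proof -
    obtain B where B: "\<And>t. cmod (nth_deriv n f t) \<le> B" using bdd by blast
    have "(\<lambda>k. h m (x k)) \<longlonglongrightarrow> 0"
      unfolding h_def by (rule gpoly_tendsto_0[OF _ that]) simp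
    moreover have "Bfun (\<lambda>k. nth_deriv n f (x k)) sequentially"
      using B by (intro BfunI[of _ B] always_eventually) simp
    ultimately show ?thesis
      unfolding tendsto_Zfun_iff by (simp add: bounded_bilinear.Zfun_prod_Bfun[OF bounded_bilinear_mult])
  qed
  define F where "F = (\<lambda>t. h 1 t * nth_deriv 0 f t - h 0 t * nth_deriv 1 f t)"
  define F' where "F' = (\<lambda>t. h 2 t * nth_deriv 0 f t - h 0 t * nth_deriv 2 f t)"
  have F0: "(\<integral>t. F' t \<partial>lborel) = 0"
  proof (rule integral_derivative_eq_0[of F])
    show "(F has_vector_derivative F' t) (at t)" for t
    proof -
      have "(F has_vector_derivative (h 1 t * nth_deriv (Suc 0) f t + h (Suc 1) t * nth_deriv 0 f t)
          - (h 0 t * nth_deriv (Suc 1) f t + h (Suc 0) t * nth_deriv 1 f t)) (at t)"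
        unfolding F_def
        by (intro has_vector_derivative_diff has_vector_derivative_mult hd schwartz_has_vector_derivative)
      then show ?thesis by (simp add: F'_def numeral_2_eq_2)
    qed
    show "continuous_on UNIV F'"
      unfolding F'_def by (intro continuous_intros hc schwartz_continuous)
    show "integrable lborel F'" unfolding F'_def by (intro Bochner_Integration.integrable_diff int)
    have "(\<lambda>k. F (x k)) \<longlonglongrightarrow> 0 - 0" if "\<And>k. (x k)\<^sup>2 = (real k)\<^sup>2" for x
      unfolding F_def by (intro tendsto_diff lim that)
    then show "(\<lambda>n. F (real n)) \<longlonglongrightarrow> 0" "(\<lambda>n. F (- real n)) \<longlonglongrightarrow> 0" by simp_all
  qed
  have "gpoly 1 0 P t * osc f t = osc (gpoly 1 0 P) t * f t + F' t / 2" for t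
    unfolding osc_def h_nth F'_def nth_deriv_0 by (simp add: h_def field_simps)
  moreover have "integrable lborel (\<lambda>t. osc (gpoly 1 0 P) t * f t)"
  proof -
    have "(\<lambda>t. osc (gpoly 1 0 P) t * f t) = (\<lambda>t. (- 1/2) * (h 2 t * nth_deriv 0 f t) + (1/2) * (gpoly 1 0 ([:0, 0, 1:] * P) t * f t))"
      by (simp add: fun_eq_iff osc_def h_nth nth_deriv_0 gpoly_def field_simps power2_eq_square)
    moreover have "integrable lborel (\<lambda>t. cnj (cnj (gpoly 1 0 ([:0, 0, 1:] * P) t)) * f t)"
    proof (rule square_integrable_cnj_mult[OF _ square_integrable_schwartz])
      show "square_integrable (\<lambda>t. cnj (gpoly 1 0 ([:0, 0, 1:] * P) t))"
        using square_integrable_gpoly[of 1 0 "[:0, 0, 1:] * P"]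
        by (auto simp: square_integrable_def intro!: borel_measurable_continuous_onI continuous_intros continuous_gpoly)
    qed
    ultimately show ?thesis
      by (simp only: complex_cnj_cnj) (intro Bochner_Integration.integrable_add integrable_mult_right int)
  qed
  moreover have "integrable lborel F'" unfolding F'_def by (intro Bochner_Integration.integrable_diff int)
  ultimately show ?thesis using F0 by simp
qed

end

definition oscC :: "complex poly \<Rightarrow> complex poly" where
  "oscC P = smult (1 / 2) ([:0, 0, 1:] * P - gderiv (gderiv P))"

lemma osc_gpoly: "osc (gpoly 1 0 P) = gpoly 1 0 (oscC P)"
  by (simp add: fun_eq_iff osc_def nth_deriv_gpoly numeral_2_eq_2 oscC_def gpoly_smult gpoly_diff)
     (simp add: gpoly_def power2_eq_square algebra_simps)

lemma oscC_add: "oscC (P + Q) = oscC P + oscC Q"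
  and oscC_smult: "oscC (smult c P) = smult c (oscC P)"
  by (simp_all add: oscC_def gderiv_def pderiv_add pderiv_diff pderiv_smult pderiv_pCons algebra_simps smult_add_right smult_diff_right)

lemma oscC_0: "oscC 0 = 0"
  using oscC_smult[of 0 0] by simp

lemma oscC_sum: "oscC (\<Sum>i\<in>A. P i) = (\<Sum>i\<in>A. oscC (P i))"
  by (induction A rule: infinite_finite_induct) (simp_all add: oscC_0 oscC_add)

text \<open>Hermite's differential equation, by comparing the derivative of the recurrence with
  \<open>pderiv_hermC_Suc\<close>.\<close>

lemma hermC_ode: "smult 2 ([:0, 1:] * pderiv (hermC n)) - pderiv (pderiv (hermC n)) = smult (2 * of_nat n) (hermC n)"
proof -
  have "pderiv (hermC (Suc n)) = smult 2 (hermC n) + (smult 2 ([:0, 1:] * pderiv (hermC n)) - pderiv (pderiv (hermC n)))"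
    by (simp add: pderiv_diff pderiv_mult pderiv_pCons pderiv_smult)
  then have "smult 2 ([:0, 1:] * pderiv (hermC n)) - pderiv (pderiv (hermC n)) = smult (2 * of_nat (Suc n)) (hermC n) - smult 2 (hermC n)"
    unfolding pderiv_hermC_Suc by (simp only: add_diff_cancel_left')
  also have "\<dots> = smult (2 * of_nat n) (hermC n)"
    by (simp add: smult_diff_left[symmetric] algebra_simps)
  finally show ?thesis .
qed

lemma oscC_hermC: "oscC (hermC n) = smult (of_nat n + 1 / 2) (hermC n)"
proof -
  have "gderiv (gderiv P) = [:0, 0, 1:] * P - P - (smult 2 ([:0, 1:] * pderiv P) - pderiv (pderiv P))" for P
    using smult_add_left[of 1 1 "pderiv P"]
    by (simp add: gderiv_def pderiv_diff pderiv_mult pderiv_pCons algebra_simps)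
  then have "oscC (hermC n) = smult (1 / 2) (hermC n + smult (2 * of_nat n) (hermC n))"
    by (simp add: oscC_def hermC_ode del: mult_pCons_left)
  then show ?thesis by (simp add: smult_add_right smult_add_left)
qed

text \<open>Linear in the polynomial, so a finite Hermite expansion is the class of a single
  Schwartz function.\<close>

definition gauss_l2 :: "complex poly \<Rightarrow> l2" where
  "gauss_l2 P = abs_l2 (gpoly 1 0 P)"

lemma gauss_l2_add: "gauss_l2 (P + Q) = gauss_l2 P + gauss_l2 Q"
  and gauss_l2_smult: "gauss_l2 (smult c P) = cscale c (gauss_l2 P)"
  by (simp_all add: gauss_l2_def gpoly_add[abs_def] gpoly_smult[abs_def] abs_l2_add abs_l2_cmult square_integrable_gpoly)

lemma gauss_l2_sum: "gauss_l2 (\<Sum>i\<in>A. P i) = (\<Sum>i\<in>A. gauss_l2 (P i))"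
  using gauss_l2_smult[of 0 0]
  by (induction A rule: infinite_finite_induct) (simp_all add: gauss_l2_add)

lemma hermite_gauss_eq: "hermite_gauss n = gauss_l2 (smult (of_real (hermite_norm n)) (hermC n))"
  by (simp add: hermite_gauss_def gauss_l2_def of_real_hermite_gauss_fun gpoly_smult[abs_def])

text \<open>Each coefficient condition is closed by continuity of the inner product; hence the
  inclusion of the Schwartz graph passes to its closure.\<close>

lemma closed_number_op: "closed hg.number_op"
proof -
  have "hg.number_op = (\<Inter>n. {p. cinner (hermite_gauss n) (snd p) = (of_nat n + 1 / 2) * cinner (hermite_gauss n) (fst p)})"
    by (auto simp: hg.diag_graph_def)
  also have "closed \<dots>"
    by (intro closed_INT ballI closed_Collect_eq continuous_intros
        bounded_linear.continuous_on[OF bounded_linear_cinner_right])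
  finally show ?thesis .
qed

theorem H_ell_eq_number_op: "H_ell = hg.number_op"
proof
  have "(abs_l2 f, abs_l2 (osc f)) \<in> hg.number_op" if f: "schwartz f" for f
    unfolding hg.diag_graph_def
  proof clarify
    fix n
    let ?P = "smult (of_real (hermite_norm n)) (hermC n)"
    have hg: "of_real (hermite_gauss_fun n t) = gpoly 1 0 ?P t" for t
      by (simp add: of_real_hermite_gauss_fun gpoly_smult)
    have inner: "cinner (hermite_gauss n) (abs_l2 g) = (\<integral>t. gpoly 1 0 ?P t * g t \<partial>lborel)"
      if "square_integrable g" for g
      unfolding hermite_gauss_def cinner_abs[OF square_integrable_hermite_gauss_fun that]
      by (simp flip: hg)
    have "osc (gpoly 1 0 ?P) t = (of_nat n + 1 / 2) * gpoly 1 0 ?P t" for t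
      unfolding osc_gpoly by (simp add: oscC_smult oscC_hermC gpoly_smult mult_ac)
    then show "cinner (hermite_gauss n) (abs_l2 (osc f)) = (of_nat n + 1 / 2) * cinner (hermite_gauss n) (abs_l2 f)"
      unfolding inner[OF square_integrable_osc[OF f]] inner[OF square_integrable_schwartz[OF f]]
        osc_symmetric_gpoly[OF f] by (simp add: mult.assoc)
  qed
  then show "H_ell \<subseteq> hg.number_op"
    unfolding H_ell_eq_closure by (intro closure_minimal closed_number_op) auto
next
  show "hg.number_op \<subseteq> H_ell"
  proof clarify
    fix f g assume "(f, g) \<in> hg.number_op"
    then have fg: "cinner (hermite_gauss n) g = (of_nat n + 1 / 2) * cinner (hermite_gauss n) f" for n
      by (simp add: hg.diag_graph_def)
    \<comment> \<open>The Hermite partial sums of \<open>f\<close>; applying \<open>osc\<close> to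
      them gives the partial sums of \<open>g\<close>, so \<open>(f, g)\<close> is a limit of pairs
      from the Schwartz graph.\<close>
    define P where "P = (\<lambda>N. \<Sum>n<N. smult (cinner (hermite_gauss n) f) (smult (of_real (hermite_norm n)) (hermC n)))"
    have "gauss_l2 (P N) = (\<Sum>n<N. cscale (cinner (hermite_gauss n) f) (hermite_gauss n))" for N
      by (simp only: P_def gauss_l2_sum gauss_l2_smult hermite_gauss_eq)
    then have 1: "(\<lambda>N. gauss_l2 (P N)) \<longlonglongrightarrow> f"
      using hg.expansion[of f] by (simp add: sums_def)
    have "gauss_l2 (oscC (P N)) = (\<Sum>n<N. cscale (cinner (hermite_gauss n) g) (hermite_gauss n))" for N
      unfolding P_def oscC_sum oscC_smult oscC_hermC gauss_l2_sum gauss_l2_smult hermite_gauss_eq cscale_cscale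
      by (intro sum.cong refl) (simp add: fg[unfolded hermite_gauss_eq gauss_l2_smult] mult_ac)
    then have 2: "(\<lambda>N. gauss_l2 (oscC (P N))) \<longlonglongrightarrow> g"
      using hg.expansion[of g] by (simp add: sums_def)
    have "(gauss_l2 (P N), gauss_l2 (oscC (P N))) \<in> {(abs_l2 f, abs_l2 (osc f)) | f. schwartz f}" for N
      using schwartz_gpoly[of "P N"] unfolding gauss_l2_def osc_gpoly[symmetric] by blast
    then show "(f, g) \<in> H_ell"
      unfolding H_ell_eq_closure closure_sequential
      by (intro exI[of _ "\<lambda>N. (gauss_l2 (P N), gauss_l2 (oscC (P N)))"] conjI allI tendsto_Pair 1 2)
  qed
qed

section \<open>Scaled and chirped Hermite--Gauss functions\<close>

text \<open>For \<open>s > 0\<close> the factor \<open>sqrt s\<close> makes this unitary; it is the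
  transform of a lower triangular symplectic matrix.\<close>

definition chirp :: "real \<Rightarrow> real \<Rightarrow> (real \<Rightarrow> complex) \<Rightarrow> real \<Rightarrow> complex" where
  "chirp s \<kappa> f t = of_real (sqrt s) * exp (\<i> * of_real (\<kappa> * t\<^sup>2 / 2)) * f (s * t)"

lemma norm_chirp_factor [simp]: "cmod (exp (\<i> * of_real x)) = 1"
  by (simp add: norm_exp_eq_Re)

lemma square_integrable_scale:
  assumes f: "square_integrable f" and s: "s \<noteq> 0"
  shows "square_integrable (\<lambda>t. exp (\<i> * of_real (\<kappa> * t\<^sup>2 / 2)) * f (s * t))"
proof -
  have [measurable]: "f \<in> borel_measurable borel" using f by (simp add: square_integrable_def)
  have "integrable lborel (\<lambda>t. (cmod (f (0 + s * t)))\<^sup>2)"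
    using f s lborel_integrable_real_affine[of "\<lambda>t. (cmod (f t))\<^sup>2" s 0] by (simp add: square_integrable_def)
  moreover have "(\<lambda>t. exp (\<i> * of_real (\<kappa> * t\<^sup>2 / 2)) * f (s * t)) \<in> borel_measurable borel" by measurable
  ultimately show ?thesis by (simp add: square_integrable_def norm_mult)
qed

lemma square_integrable_chirp: "square_integrable f \<Longrightarrow> s \<noteq> 0 \<Longrightarrow> square_integrable (chirp s \<kappa> f)"
  unfolding chirp_def[abs_def] mult.assoc by (intro square_integrable_cmult square_integrable_scale)

text \<open>In the variable \<open>t / s\<close> the rate \<open>\<kappa>\<close> becomes
  \<open>\<kappa> / s^2\<close>, which the other chirp has to cancel.\<close>

lemma chirp_chirp_inverse:
  assumes "0 < s"
  shows "chirp (1 / s) (- \<kappa> / s\<^sup>2) (chirp s \<kappa> f) = f" "chirp s \<kappa> (chirp (1 / s) (- \<kappa> / s\<^sup>2) f) = f"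
proof -
  have s: "complex_of_real (sqrt (1 / s)) * of_real (sqrt s) = 1" "complex_of_real (sqrt s) * of_real (sqrt (1 / s)) = 1"
    using assms by (simp_all add: of_real_mult[symmetric] real_sqrt_mult[symmetric] del: of_real_mult)
  have "chirp (1 / s) (- \<kappa> / s\<^sup>2) (chirp s \<kappa> f) t = f t" for t
  proof -
    have "chirp (1 / s) (- \<kappa> / s\<^sup>2) (chirp s \<kappa> f) t = (of_real (sqrt (1 / s)) * of_real (sqrt s)) *
        (exp (\<i> * of_real (- \<kappa> / s\<^sup>2 * t\<^sup>2 / 2)) * exp (\<i> * of_real (\<kappa> * (1 / s * t)\<^sup>2 / 2))) * f (s * (1 / s * t))"
      by (simp add: chirp_def mult_ac)
    also have "exp (\<i> * of_real (- \<kappa> / s\<^sup>2 * t\<^sup>2 / 2)) * exp (\<i> * of_real (\<kappa> * (1 / s * t)\<^sup>2 / 2)) = 1"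
      unfolding exp_add[symmetric] distrib_left[symmetric] of_real_add[symmetric] by (simp add: power_mult_distrib power_divide)
    finally show ?thesis using assms unfolding s by simp
  qed
  then show "chirp (1 / s) (- \<kappa> / s\<^sup>2) (chirp s \<kappa> f) = f" by auto
  have "chirp s \<kappa> (chirp (1 / s) (- \<kappa> / s\<^sup>2) f) t = f t" for t
  proof -
    have "chirp s \<kappa> (chirp (1 / s) (- \<kappa> / s\<^sup>2) f) t = (of_real (sqrt s) * of_real (sqrt (1 / s))) *
        (exp (\<i> * of_real (\<kappa> * t\<^sup>2 / 2)) * exp (\<i> * of_real (- \<kappa> / s\<^sup>2 * (s * t)\<^sup>2 / 2))) * f (1 / s * (s * t))"
      by (simp add: chirp_def mult_ac)
    also have "exp (\<i> * of_real (\<kappa> * t\<^sup>2 / 2)) * exp (\<i> * of_real (- \<kappa> / s\<^sup>2 * (s * t)\<^sup>2 / 2)) = 1"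
      unfolding exp_add[symmetric] distrib_left[symmetric] of_real_add[symmetric]
      using assms by (simp add: power_mult_distrib)
    finally show ?thesis using assms unfolding s by simp
  qed
  then show "chirp s \<kappa> (chirp (1 / s) (- \<kappa> / s\<^sup>2) f) = f" by auto
qed

text \<open>The substitution of \<open>s * t\<close> for \<open>t\<close>; the adjoint coincides
  with the inverse, which is unitarity in integral form.\<close>

lemma chirp_adjoint:
  assumes "0 < s"
  shows "(\<integral>t. cnj (chirp s \<kappa> f t) * g t \<partial>lborel) = (\<integral>t. cnj (f t) * chirp (1 / s) (- \<kappa> / s\<^sup>2) g t \<partial>lborel)"
proof -
  have "(\<integral>t. cnj (f t) * chirp (1 / s) (- \<kappa> / s\<^sup>2) g t \<partial>lborel)
      = s *\<^sub>R (\<integral>t. cnj (f (0 + s * t)) * chirp (1 / s) (- \<kappa> / s\<^sup>2) g (0 + s * t) \<partial>lborel)"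
    using assms lborel_integral_real_affine[of s "\<lambda>t. cnj (f t) * chirp (1 / s) (- \<kappa> / s\<^sup>2) g t" 0] by simp
  also have "\<dots> = (\<integral>t. of_real s * (cnj (f (0 + s * t)) * chirp (1 / s) (- \<kappa> / s\<^sup>2) g (0 + s * t)) \<partial>lborel)"
    by (simp add: scaleR_conv_of_real)
  also have "\<dots> = (\<integral>t. cnj (chirp s \<kappa> f t) * g t \<partial>lborel)"
  proof (intro Bochner_Integration.integral_cong refl)
    fix t
    have "s * sqrt (1 / s) = sqrt s" using assms by (simp add: real_sqrt_divide real_div_sqrt)
    then have s: "complex_of_real s * of_real (sqrt (1 / s)) = of_real (sqrt s)"
      by (simp add: of_real_mult[symmetric] del: of_real_mult)
    have "of_real s * (cnj (f (0 + s * t)) * chirp (1 / s) (- \<kappa> / s\<^sup>2) g (0 + s * t))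
        = (of_real s * of_real (sqrt (1 / s))) * exp (\<i> * of_real (- \<kappa> / s\<^sup>2 * (s * t)\<^sup>2 / 2)) * cnj (f (s * t)) * g (1 / s * (s * t))"
      by (simp add: chirp_def mult_ac)
    also have "- \<kappa> / s\<^sup>2 * (s * t)\<^sup>2 / 2 = - (\<kappa> * t\<^sup>2 / 2)"
      using assms by (simp add: power_mult_distrib)
    also have "exp (\<i> * complex_of_real (- (\<kappa> * t\<^sup>2 / 2))) = cnj (exp (\<i> * of_real (\<kappa> * t\<^sup>2 / 2)))"
      by (simp add: exp_cnj)
    finally show "of_real s * (cnj (f (0 + s * t)) * chirp (1 / s) (- \<kappa> / s\<^sup>2) g (0 + s * t)) = cnj (chirp s \<kappa> f t) * g t"
      using assms unfolding s by (simp add: chirp_def)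
  qed
  finally show ?thesis ..
qed

text \<open>Orthonormality and totality are both pulled back to the Hermite-Gauss functions through
  the adjoint.\<close>

lemma orthonormal_basis_chirp:
  assumes s: "0 < s"
  shows "orthonormal_basis (\<lambda>n. abs_l2 (chirp s \<kappa> (\<lambda>t. of_real (hermite_gauss_fun n t))))"
    (is "orthonormal_basis (\<lambda>n. abs_l2 (?h n))")
proof (rule orthonormal_basisI)
  let ?C = "chirp (1 / s) (- \<kappa> / s\<^sup>2)"
  have sq: "square_integrable (?h n)" for n
    using s by (intro square_integrable_chirp square_integrable_hermite_gauss_fun) simp
  have adj: "cinner (abs_l2 (?h n)) (abs_l2 g) = cinner (hermite_gauss n) (abs_l2 (?C g))"
    if g: "square_integrable g" for n g
  proof -
    have "square_integrable (?C g)" using s g by (intro square_integrable_chirp) simp_all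
    then show ?thesis
      unfolding hermite_gauss_def cinner_abs[OF sq g]
      by (subst cinner_abs[OF square_integrable_hermite_gauss_fun]) (simp_all only: chirp_adjoint[OF s])
  qed
  show "cinner (abs_l2 (?h m)) (abs_l2 (?h n)) = (if m = n then 1 else 0)" for m n
    unfolding adj[OF sq] chirp_chirp_inverse[OF s] hermite_gauss_def[symmetric]
    by (rule cinner_hermite_gauss_hermite_gauss)
  fix f assume f: "\<And>n. cinner (abs_l2 (?h n)) f = 0"
  define g where "g = rep_l2 f"
  have g: "square_integrable g" "f = abs_l2 g" by (simp_all add: g_def square_integrable_rep abs_rep_l2)
  have Cg: "square_integrable (?C g)" using s g by (intro square_integrable_chirp) simp_all
  have "cinner (hermite_gauss n) (abs_l2 (?C g)) = cinner (hermite_gauss n) 0" for n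
    using f[of n] unfolding g(2) adj[OF g(1)] by simp
  then have "abs_l2 (?C g) = 0" by (rule hg.coeff_eqI)
  then have "cinner (abs_l2 (?C g)) (abs_l2 (?C g)) = 0" by simp
  moreover have "cinner f f = (\<integral>t. cnj (chirp s \<kappa> (?C g) t) * g t \<partial>lborel)"
    unfolding g(2) cinner_abs[OF g(1) g(1)] chirp_chirp_inverse(2)[OF s] ..
  ultimately have "cinner f f = 0"
    unfolding chirp_adjoint[OF s] cinner_abs[OF Cg Cg] by simp
  then show "f = 0" by (simp add: cinner_norm)
qed

lemma orthonormal_basis_phase:
  assumes e: "orthonormal_basis e" and c: "\<And>n. cmod (c n) = 1"
  shows "orthonormal_basis (\<lambda>n. cscale (c n) (e n))"
proof -
  interpret onb e by unfold_locales (rule e)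
  have c': "cnj (c n) * c n = 1" for n
    by (subst mult.commute, subst complex_norm_square[symmetric]) (simp add: c)
  have c0: "c n \<noteq> 0" for n using c[of n] by auto
  show ?thesis
  proof (rule orthonormal_basisI)
    show "cinner (cscale (c m) (e m)) (cscale (c n) (e n)) = (if m = n then 1 else 0)" for m n
      by (simp add: cinner_cscale_left cinner_cscale_right cinner_basis c' mult.commute[of "c n" "cnj (c n)"])
    show "f = 0" if "\<And>n. cinner (cscale (c n) (e n)) f = 0" for f
      using that c0 by (intro coeff_eqI) (simp add: cinner_cscale_left)
  qed
qed

definition basis_map :: "(nat \<Rightarrow> l2) \<Rightarrow> (nat \<Rightarrow> l2) \<Rightarrow> l2 \<Rightarrow> l2" where
  "basis_map e e' f = (\<Sum>n. cscale (cinner (e n) f) (e' n))"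

text \<open>Parseval in both bases makes the map isometric; Riesz-Fischer in the source basis makes
  it surjective.\<close>

lemma basis_map:
  assumes e: "orthonormal_basis e" and e': "orthonormal_basis e'"
  shows coeff_basis_map: "cinner (e' n) (basis_map e e' f) = cinner (e n) f"
    and unitary_basis_map: "unitary_operator (basis_map e e')"
    and basis_map_basis: "basis_map e e' (e n) = e' n"
proof -
  interpret e: onb e by unfold_locales (rule e)
  interpret e': onb e' by unfold_locales (rule e')
  have "summable (\<lambda>n. cscale (cinner (e n) f) (e' n))" for f
    by (intro orthonormal_summable[OF e'.cinner_basis] sums_summable[OF e.Parseval_norm])
  then have coeff: "cinner (e' n) (basis_map e e' f) = cinner (e n) f" for n f
    unfolding basis_map_def by (intro coeff_orthonormal_series[OF e'.cinner_basis] summable_sums)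
  then show "cinner (e' n) (basis_map e e' f) = cinner (e n) f" .
  show "basis_map e e' (e n) = e' n"
    by (rule e'.coeff_eqI) (simp add: coeff e.cinner_basis e'.cinner_basis)
  have inner: "cinner (basis_map e e' f) (basis_map e e' g) = cinner f g" for f g
    using e'.Parseval[of "basis_map e e' f" "basis_map e e' g"] e.Parseval[of f g]
    by (simp add: coeff sums_unique2)
  have sc: "basis_map e e' (cscale z f) = cscale z (basis_map e e' f)" for z f
    by (rule e'.coeff_eqI) (simp add: coeff cinner_cscale_right)
  have "bounded_linear (basis_map e e')"
  proof (rule bounded_linear_intro[where K = 1])
    show "basis_map e e' (f + g) = basis_map e e' f + basis_map e e' g" for f g
      by (rule e'.coeff_eqI) (simp add: coeff cinner_add_right)
    show "basis_map e e' (r *\<^sub>R f) = r *\<^sub>R basis_map e e' f" for r f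
      by (simp add: scaleR_l2_def sc)
    show "norm (basis_map e e' f) \<le> norm f * 1" for f
      using inner[of f f] unfolding cinner_norm of_real_eq_iff by (simp add: power2_eq_iff_nonneg)
  qed
  moreover have "surj (basis_map e e')"
  proof (rule surjI)
    fix g
    have "summable (\<lambda>n. (cmod (cinner (e' n) g))\<^sup>2)" by (rule sums_summable[OF e'.Parseval_norm])
    then obtain f where "\<And>n. cinner (e n) f = cinner (e' n) g" using e.Riesz_Fischer[of "\<lambda>n. cinner (e' n) g"] by blast
    then have "basis_map e e' f = g" by (intro e'.coeff_eqI) (simp add: coeff)
    then show "basis_map e e' (SOME f. basis_map e e' f = g) = g" by (rule someI)
  qed
  ultimately show "unitary_operator (basis_map e e')"
    by (simp add: unitary_operator_def bounded_clinear_def sc inner)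
qed

section \<open>Metaplectic operators\<close>

text \<open>Under the integral, multiplication by \<open>2 * t\<close> acts as
  \<open>2 * u * x\<close> plus \<open>2 / p\<close> times differentiation, so the integrals obey
  the three-term recurrence of \<open>u ^ n * poly (hermC n) x\<close>. Fixing only
  \<open>u^2\<close> and \<open>u * x\<close> leaves the choice of the root to the caller.\<close>

lemma integral_gpoly_hermC_general:
  assumes p: "0 < Re p" and u: "u * x = - q / p" "u\<^sup>2 = 1 - 2 / p"
  shows "(\<integral>t. gpoly p q (hermC n) t \<partial>lborel) = (\<integral>t. gpoly p q 1 t \<partial>lborel) * u ^ n * poly (hermC n) x"
proof -
  define L where "L = (\<lambda>P. \<integral>t. gpoly p q P t \<partial>lborel)"
  have p0: "p \<noteq> 0" using p by auto
  have add: "L (P + Q) = L P + L Q" and smult: "L (smult c P) = c * L P" for P Q c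
    by (simp_all add: L_def gpoly_add[abs_def] gpoly_smult[abs_def] integrable_gpoly[OF p])
  have mult_x: "L ([:0, 2:] * P) = 2 / p * L (pderiv P) + 2 * u * x * L P" for P
  proof -
    have "L (pderiv P) = L ([:q, p:] * P)"
      unfolding L_def by (rule integral_gpoly_pderiv[OF p])
    also have "[:q, p:] * P = smult q P + smult (p / 2) ([:0, 2:] * P)" by simp
    also have "L \<dots> = q * L P + p / 2 * L ([:0, 2:] * P)" by (simp only: add smult)
    finally have "L ([:0, 2:] * P) = 2 / p * (L (pderiv P) - q * L P)" using p0 by (simp add: field_simps)
    also have "\<dots> = 2 / p * L (pderiv P) + 2 * (- q / p) * L P" by (simp add: algebra_simps)
    finally show ?thesis unfolding u(1)[symmetric] by (simp only: mult.assoc)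
  qed
  have "L (hermC n) = L 1 * u ^ n * poly (hermC n) x"
  proof (induction n rule: induct_nat_012)
    case 1
    have "hermC 1 = [:0, 2:] * 1" by (simp add: pderiv_1)
    then have "L (hermC 1) = 2 / p * L (pderiv 1) + 2 * u * x * L 1" by (simp only: mult_x)
    also have "L (pderiv 1) = 0" by (simp add: L_def gpoly_def pderiv_1)
    finally show ?case by (simp add: pderiv_1)
  next
    case (ge2 n)
    have "hermC (Suc (Suc n)) = [:0, 2:] * hermC (Suc n) + smult (- (2 * of_nat (Suc n))) (hermC n)"
      unfolding hermC_Suc_Suc by (simp only: smult_minus_left diff_conv_add_uminus)
    then have "L (hermC (Suc (Suc n)))
        = 2 / p * (2 * of_nat (Suc n) * L (hermC n)) + 2 * u * x * L (hermC (Suc n)) - 2 * of_nat (Suc n) * L (hermC n)"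
      by (simp only: add mult_x smult pderiv_hermC_Suc mult_minus_left diff_conv_add_uminus)
    also have "\<dots> = 2 * u * x * L (hermC (Suc n)) - 2 * of_nat (Suc n) * (u\<^sup>2 * L (hermC n))"
      unfolding u(2) by (simp add: algebra_simps)
    also have "\<dots> = L 1 * u ^ Suc (Suc n) * (2 * x * poly (hermC (Suc n)) x - 2 * of_nat (Suc n) * poly (hermC n) x)"
      unfolding ge2 by (simp add: algebra_simps power2_eq_square)
    also have "2 * x * poly (hermC (Suc n)) x - 2 * of_nat (Suc n) * poly (hermC n) x = poly (hermC (Suc (Suc n))) x"
      unfolding hermC_Suc_Suc by (simp del: hermC.simps)
    finally show ?case .
  qed simp
  then show ?thesis by (simp add: L_def)
qed

text \<open>Parity is needed for matrices with \<open>b = 0\<close> and \<open>a < 0\<close>, where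
  the transform reflects its argument.\<close>

lemma poly_hermC_minus: "poly (hermC n) (- x) = (- 1) ^ n * poly (hermC n) x"
proof (induction n rule: induct_nat_012)
  case (ge2 n)
  then show ?case unfolding hermC_Suc_Suc by (simp add: algebra_simps del: hermC.simps)
qed (simp_all add: pderiv_1)

lemma hermite_gauss_fun_minus: "hermite_gauss_fun n (- t) = (- 1) ^ n * hermite_gauss_fun n t"
proof -
  have "complex_of_real (poly (hermite n) (- t)) = of_real ((- 1) ^ n * poly (hermite n) t)"
    unfolding poly_hermC[symmetric] of_real_minus poly_hermC_minus by (simp add: poly_hermC)
  then have "poly (hermite n) (- t) = (- 1) ^ n * poly (hermite n) t" unfolding of_real_eq_iff .
  then show ?thesis by (simp add: hermite_gauss_fun_def)
qed

section \<open>Scale, chirp rate and phase attached to a point of the double cover\<close>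

locale mp_element =
  fixes M :: "real^2^2" and \<epsilon> :: complex
  assumes Mp2: "(M, \<epsilon>) \<in> Mp2"
begin

abbreviation (input) "a \<equiv> M $ 1 $ 1"
abbreviation (input) "b \<equiv> M $ 1 $ 2"
abbreviation (input) "c \<equiv> M $ 2 $ 1"
abbreviation (input) "d \<equiv> M $ 2 $ 2"

text \<open>The parameters come from factoring the matrix into the lower triangular shear of rate
  \<open>chirp_rate\<close>, the dilation with entries \<open>r\<close> and \<open>1 / r\<close>,
  and the rotation by the argument of \<open>a + i b\<close>. The rotation contributes
  \<open>rot ^ n\<close>; as \<open>\<epsilon>\<close> is a square root of \<open>a + i b\<close>,
  the remaining factor of \<open>phase\<close> carries the half angle and the sign.\<close>

definition r :: real where "r = cmod (Complex a b)"
definition scale :: real where "scale = 1 / r"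
definition chirp_rate :: real where "chirp_rate = (d * b + a * c) / r\<^sup>2"
definition rot :: complex where "rot = Complex a (- b) / of_real r"
definition phase :: "nat \<Rightarrow> complex" where "phase n = of_real (sqrt r) / \<epsilon> * rot ^ n"

lemma det_eq_1: "a * d - b * c = 1"
proof -
  have "(transpose M ** symplectic_form ** M) $ 1 $ 2 = symplectic_form $ 1 $ 2"
    using Mp2 by (simp add: Mp2_def Sp2_def)
  then show ?thesis
    by (simp add: matrix_matrix_mult_def transpose_def symplectic_form_def sum_2 algebra_simps)
qed

lemma r_square: "r\<^sup>2 = a\<^sup>2 + b\<^sup>2"
  by (simp add: r_def cmod_power2)

lemma r_pos: "0 < r"
proof -
  have "Complex a b \<noteq> 0" using det_eq_1 by (auto simp: complex_eq_iff)
  then show ?thesis by (simp add: r_def)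
qed

lemma scale_pos: "0 < scale"
  using r_pos by (simp add: scale_def)

lemma cmod_eps: "cmod \<epsilon> = sqrt r" and eps_nonzero: "\<epsilon> \<noteq> 0"
proof -
  have "\<epsilon>\<^sup>2 = Complex a b" using Mp2 by (simp add: Mp2_def)
  then have "(cmod \<epsilon>)\<^sup>2 = r" by (simp add: r_def norm_power[symmetric])
  then show "cmod \<epsilon> = sqrt r" using real_sqrt_unique[of "cmod \<epsilon>" r] by simp
  then show "\<epsilon> \<noteq> 0" using r_pos by auto
qed

lemma cmod_rot: "cmod rot = 1"
proof -
  have "cmod (Complex a (- b)) = r" by (simp add: r_def cmod_def)
  then show ?thesis using r_pos by (simp add: rot_def norm_divide)
qed

lemma cmod_phase: "cmod (phase n) = 1"
  using r_pos by (simp add: phase_def norm_mult norm_divide norm_power cmod_eps cmod_rot)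

lemma phase_chirp:
  "phase n * chirp scale chirp_rate f t = rot ^ n / \<epsilon> * exp (\<i> * of_real (chirp_rate * t\<^sup>2 / 2)) * f (scale * t)"
proof -
  have "complex_of_real (sqrt r) * of_real (sqrt scale) = 1"
    using r_pos by (simp add: scale_def of_real_mult[symmetric] real_sqrt_mult[symmetric] del: of_real_mult)
  then show ?thesis by (simp add: phase_def chirp_def mult_ac)
qed

definition kernel :: "real \<Rightarrow> real \<Rightarrow> complex" where
  "kernel t s = exp (\<i> * of_real ((d * t\<^sup>2 - 2 * t * s + a * s\<^sup>2) / (2 * b)))"

definition K :: complex where
  "K = csqrt ((1 - \<i> * of_real (a / b)) / of_real (2 * pi)) / \<epsilon>"

lemma lct_b_zero: "b = 0 \<Longrightarrow> lct (M, \<epsilon>) f t = exp (\<i> * of_real (c * d * t\<^sup>2 / 2)) * f (d * t) / \<epsilon>"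
  by (simp add: lct_def Let_def)

lemma lct_b_nonzero: "b \<noteq> 0 \<Longrightarrow> lct (M, \<epsilon>) f t = K * (\<integral>s. kernel t s * f s \<partial>lborel)"
  by (simp add: lct_def K_def kernel_def Let_def)

end

text \<open>The width \<open>1 - i \<alpha> / \<beta>\<close> and the linear coefficient \<open>i t / \<beta>\<close> are those occurring in the kernels of the
  linear canonical transforms and of their transposes.\<close>

lemma kernel_integral_hermite:
  fixes \<alpha> \<beta> t :: real
  assumes \<beta>: "\<beta> \<noteq> 0"
  defines "\<rho> \<equiv> cmod (Complex \<alpha> \<beta>)"
  shows "csqrt ((1 - \<i> * of_real (\<alpha> / \<beta>)) / of_real (2 * pi)) *
      (\<integral>s. gpoly (1 - \<i> * of_real (\<alpha> / \<beta>)) (\<i> * of_real (t / \<beta>)) (hermC n) s \<partial>lborel)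
    = exp (- (of_real t)\<^sup>2 / (2 * of_real \<beta> * (of_real \<beta> - \<i> * of_real \<alpha>))) *
      (Complex \<alpha> (- \<beta>) / of_real \<rho>) ^ n * poly (hermC n) (of_real (1 / \<rho> * t))"
proof -
  define p where "p = 1 - \<i> * complex_of_real (\<alpha> / \<beta>)"
  define q where "q = \<i> * complex_of_real (t / \<beta>)"
  define u where "u = Complex \<alpha> (- \<beta>) / of_real \<rho>"
  define x where "x = complex_of_real (1 / \<rho> * t)"
  \<comment> \<open>In terms of the conjugate pair \<open>z\<close>, \<open>z'\<close> the width is
    \<open>- i z / \<beta>\<close> and \<open>\<rho>^2 = z z'\<close>; the two conditions on
    \<open>u\<close> become \<open>u^2 = z' / z\<close> and \<open>u x = t / z\<close>.\<close>
  define z where "z = of_real \<alpha> + \<i> * complex_of_real \<beta>"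
  define z' where "z' = of_real \<alpha> - \<i> * complex_of_real \<beta>"
  have p: "0 < Re p" by (simp add: p_def)
  have p0: "p \<noteq> 0" using p by auto
  have z0: "z \<noteq> 0" "z' \<noteq> 0" using \<beta> by (auto simp: z_def z'_def complex_eq_iff)
  have \<rho>2: "complex_of_real \<rho> * of_real \<rho> = z * z'"
  proof -
    have "\<rho> * \<rho> = \<alpha>\<^sup>2 + \<beta>\<^sup>2" unfolding \<rho>_def by (simp add: power2_eq_square[symmetric] cmod_power2)
    then show ?thesis by (simp add: of_real_mult[symmetric] z_def z'_def algebra_simps power2_eq_square del: of_real_mult)
  qed
  have \<rho>0: "complex_of_real \<rho> \<noteq> 0" using \<rho>2 z0 by auto
  have Cz: "Complex \<alpha> (- \<beta>) = z'" by (simp add: z'_def complex_eq_iff)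
  have pz: "p = - \<i> * z / of_real \<beta>" using \<beta> by (simp add: p_def z_def field_simps)
  have "u * x = - q / p"
  proof -
    have "u * x = z' * of_real t / (of_real \<rho> * of_real \<rho>)" by (simp add: u_def x_def Cz)
    also have "\<dots> = of_real t / z" unfolding \<rho>2 using z0 by simp
    also have "\<dots> = - q / p" unfolding pz q_def using \<beta> z0 by (simp add: field_simps)
    finally show ?thesis .
  qed
  moreover have "u\<^sup>2 = 1 - 2 / p"
  proof -
    have "u\<^sup>2 = z' * z' / (of_real \<rho> * of_real \<rho>)" by (simp add: u_def Cz power2_eq_square)
    also have "\<dots> = z' / z" unfolding \<rho>2 using z0 by simp
    also have "z' = z - 2 * \<i> * of_real \<beta>" by (simp add: z_def z'_def)
    also have "(z - 2 * \<i> * of_real \<beta>) / z = 1 - 2 / p"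
      unfolding pz using \<beta> z0 by (simp add: field_simps)
    finally show ?thesis .
  qed
  ultimately have "(\<integral>s. gpoly p q (hermC n) s \<partial>lborel) = (\<integral>s. gpoly p q 1 s \<partial>lborel) * u ^ n * poly (hermC n) x"
    by (rule integral_gpoly_hermC_general[OF p])
  then have "csqrt (p / of_real (2 * pi)) * (\<integral>s. gpoly p q (hermC n) s \<partial>lborel)
      = (csqrt (p / of_real (2 * pi)) * (\<integral>s. gpoly p q 1 s \<partial>lborel)) * u ^ n * poly (hermC n) x"
    by (simp add: mult.assoc)
  also have "csqrt (p / of_real (2 * pi)) * (\<integral>s. gpoly p q 1 s \<partial>lborel) = exp (q\<^sup>2 / (2 * p))"
    by (rule gaussian_integral[OF p])
  also have "q\<^sup>2 / (2 * p) = - (of_real t)\<^sup>2 / (2 * of_real \<beta> * (of_real \<beta> - \<i> * of_real \<alpha>))"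
  proof -
    have w: "of_real \<beta> - \<i> * of_real \<alpha> = - \<i> * z" by (simp add: z_def algebra_simps)
    show ?thesis unfolding w pz q_def using \<beta> z0 by (simp add: field_simps power2_eq_square)
  qed
  finally show ?thesis unfolding p_def q_def u_def x_def .
qed

context mp_element
begin

lemma kernel_gpoly:
  assumes "b \<noteq> 0"
  shows "kernel t s * gpoly 1 0 P s
    = exp (\<i> * of_real (d * t\<^sup>2 / (2 * b))) * gpoly (1 - \<i> * of_real (a / b)) (\<i> * of_real (t / b)) P s"
proof -
  have "\<i> * complex_of_real ((d * t\<^sup>2 - 2 * t * s + a * s\<^sup>2) / (2 * b)) + (- 1 * (of_real s)\<^sup>2 / 2 - 0 * of_real s)
      = \<i> * of_real (d * t\<^sup>2 / (2 * b)) + (- (1 - \<i> * of_real (a / b)) * (of_real s)\<^sup>2 / 2 - \<i> * of_real (t / b) * of_real s)"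
    using assms by (simp add: field_simps)
  then show ?thesis
    unfolding kernel_def gpoly_def by (simp only: mult.left_commute[of _ "poly P _"] exp_add[symmetric])
qed

lemma lct_hermite_b_nonzero:
  assumes b: "b \<noteq> 0"
  shows "lct (M, \<epsilon>) (\<lambda>t. of_real (hermite_gauss_fun n t)) t
    = phase n * chirp scale chirp_rate (\<lambda>t. of_real (hermite_gauss_fun n t)) t"
proof -
  define \<tau> where "\<tau> = (complex_of_real t)\<^sup>2"
  have "lct (M, \<epsilon>) (\<lambda>t. of_real (hermite_gauss_fun n t)) t
      = K * (\<integral>s. of_real (hermite_norm n) * (kernel t s * gpoly 1 0 (hermC n) s) \<partial>lborel)"
    unfolding lct_b_nonzero[OF b] of_real_hermite_gauss_fun by (simp add: mult_ac)
  also have "\<dots> = of_real (hermite_norm n) * exp (\<i> * of_real (d * t\<^sup>2 / (2 * b))) / \<epsilon> *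
      (csqrt ((1 - \<i> * of_real (a / b)) / of_real (2 * pi)) *
       (\<integral>s. gpoly (1 - \<i> * of_real (a / b)) (\<i> * of_real (t / b)) (hermC n) s \<partial>lborel))"
    unfolding kernel_gpoly[OF b] K_def by (simp add: mult_ac)
  also have "\<dots> = of_real (hermite_norm n) / \<epsilon> * rot ^ n * poly (hermC n) (of_real (scale * t)) *
      (exp (\<i> * of_real (d * t\<^sup>2 / (2 * b))) * exp (- (of_real t)\<^sup>2 / (2 * of_real b * (of_real b - \<i> * of_real a))))"
    unfolding kernel_integral_hermite[OF b] r_def[symmetric] rot_def[symmetric] scale_def by (simp add: mult_ac)
  also have "exp (\<i> * of_real (d * t\<^sup>2 / (2 * b))) * exp (- (of_real t)\<^sup>2 / (2 * of_real b * (of_real b - \<i> * of_real a)))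
      = exp (\<i> * of_real (chirp_rate * t\<^sup>2 / 2)) * exp (of_real (- (scale * t)\<^sup>2 / 2))"
  proof -
    have b0: "complex_of_real b \<noteq> 0" using b by simp
    have ba: "complex_of_real b - \<i> * of_real a \<noteq> 0" using b by (auto simp: complex_eq_iff)
    have ba': "complex_of_real b + \<i> * of_real a \<noteq> 0" using b by (auto simp: complex_eq_iff)
    have cancel: "1 / (B * w) = w' / (B * (w * w'))" if "w \<noteq> 0" "w' \<noteq> 0" for B w w' :: complex
      using that by (simp add: divide_simps)
    have r2: "complex_of_real (r\<^sup>2) = (of_real b - \<i> * of_real a) * (of_real b + \<i> * of_real a)"
      unfolding r_square by (simp add: algebra_simps power2_eq_square)
    have r0: "complex_of_real (r\<^sup>2) \<noteq> 0" using r_pos by simp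
    \<comment> \<open>The determinant turns the numerator \<open>d r^2 - a\<close> of the combined
      chirp into \<open>b\<close> times the numerator of \<open>chirp_rate\<close>, so the division
      by \<open>b\<close> disappears.\<close>
    have det: "d * r\<^sup>2 - a = b * (d * b + a * c)"
    proof -
      have "d * r\<^sup>2 - a * (a * d - b * c) = b * (d * b + a * c)"
        unfolding r_square by (simp add: algebra_simps power2_eq_square)
      then show ?thesis unfolding det_eq_1 by simp
    qed
    have inv: "1 / (of_real b * (of_real b - \<i> * of_real a)) = (of_real b + \<i> * of_real a) / (of_real b * complex_of_real (r\<^sup>2))"
      unfolding r2 by (rule cancel[OF ba ba'])
    have common: "\<i> * (D / B) - (B + \<i> * A) / (B * R) = (\<i> * (D * R - A) - B) / (B * R)"
      if "B \<noteq> 0" "R \<noteq> 0" for A B D R :: complex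
      using that by (simp add: field_simps)
    have "\<i> * of_real (d / b) - 1 / (of_real b * (of_real b - \<i> * of_real a))
        = (\<i> * (of_real (d * r\<^sup>2 - a)) - of_real b) / (of_real b * complex_of_real (r\<^sup>2))"
      unfolding inv of_real_divide of_real_diff of_real_mult[of d] by (rule common[OF b0 r0])
    also have "\<dots> = \<i> * of_real chirp_rate - of_real (1 / r\<^sup>2)"
      unfolding det chirp_rate_def using b0 r0 by (simp add: field_simps)
    finally have eq: "\<i> * of_real (d / b) - 1 / (of_real b * (of_real b - \<i> * of_real a)) = \<i> * of_real chirp_rate - of_real (1 / r\<^sup>2)" .
    have "\<i> * of_real (d * t\<^sup>2 / (2 * b)) + - (of_real t)\<^sup>2 / (2 * of_real b * (of_real b - \<i> * of_real a))
        = (\<i> * of_real (d / b) - 1 / (of_real b * (of_real b - \<i> * of_real a))) * (\<tau> / 2)"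
    proof -
      have "\<i> * (D * T / (2 * B)) + - T / (2 * B * w) = (\<i> * (D / B) - 1 / (B * w)) * (T / 2)"
        if "B \<noteq> 0" "w \<noteq> 0" for B D T w :: complex
        using that by (simp add: field_simps)
      from this[OF b0 ba, of "of_real d" \<tau>] show ?thesis by (simp add: \<tau>_def)
    qed
    also have "\<dots> = \<i> * of_real (chirp_rate * t\<^sup>2 / 2) + of_real (- (scale * t)\<^sup>2 / 2)"
    proof -
      have "(\<i> * k - 1 / R) * (T / 2) = \<i> * (k * T / 2) + - (T / R) / 2"
        if "R \<noteq> 0" for k R T :: complex
        using that by (simp add: field_simps)
      from this[OF r0, of "of_real chirp_rate" \<tau>] show ?thesis
        unfolding eq by (simp add: \<tau>_def scale_def power_divide)
    qed
    finally have "\<i> * of_real (d * t\<^sup>2 / (2 * b)) + - (of_real t)\<^sup>2 / (2 * of_real b * (of_real b - \<i> * of_real a))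
        = \<i> * of_real (chirp_rate * t\<^sup>2 / 2) + of_real (- (scale * t)\<^sup>2 / 2)" .
    then show ?thesis unfolding exp_add[symmetric] by (simp only:)
  qed
  also have "of_real (hermite_norm n) / \<epsilon> * rot ^ n * poly (hermC n) (of_real (scale * t)) *
      (exp (\<i> * of_real (chirp_rate * t\<^sup>2 / 2)) * exp (of_real (- (scale * t)\<^sup>2 / 2)))
      = phase n * chirp scale chirp_rate (\<lambda>t. of_real (hermite_gauss_fun n t)) t"
    unfolding phase_chirp of_real_hermite_gauss_fun gpoly_def by (simp add: mult_ac)
  finally show ?thesis .
qed

text \<open>For \<open>b = 0\<close> the scale is \<open>\<bar>d\<bar>\<close> and
  \<open>rot\<close> is the sign of \<open>a\<close>; a negative sign is matched by the parity of
  the Hermite-Gauss functions.\<close>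

lemma lct_hermite:
  "lct (M, \<epsilon>) (\<lambda>t. of_real (hermite_gauss_fun n t)) t
    = phase n * chirp scale chirp_rate (\<lambda>t. of_real (hermite_gauss_fun n t)) t"
proof (cases "b = 0")
  case True
  have ad: "a * d = 1" and r: "r = \<bar>a\<bar>" using det_eq_1 True by (simp_all add: r_def cmod_def)
  have a0: "a \<noteq> 0" using ad by auto
  have rate: "chirp_rate = c * d"
    using a0 ad by (simp add: chirp_rate_def True r power2_eq_square field_simps)
  have "complex_of_real (hermite_gauss_fun n (d * t)) = rot ^ n * of_real (hermite_gauss_fun n (scale * t))"
  proof (cases "0 < a")
    case True
    then have "rot = 1" using \<open>b = 0\<close> by (simp add: rot_def r complex_eq_iff)
    moreover have "scale = d" using ad True by (simp add: scale_def r field_simps)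
    ultimately show ?thesis by simp
  next
    case False
    then have "rot = - 1" using \<open>b = 0\<close> a0 by (simp add: rot_def r complex_eq_iff)
    moreover have "d = - scale" using ad False a0 by (simp add: scale_def r field_simps)
    ultimately show ?thesis by (simp add: hermite_gauss_fun_minus)
  qed
  then show ?thesis
    unfolding lct_b_zero[OF True] phase_chirp
    unfolding rate by (simp add: mult_ac)
qed (rule lct_hermite_b_nonzero)

end

section \<open>The transposed transform\<close>

lemma square_integrable_cnj: "square_integrable f \<Longrightarrow> square_integrable (\<lambda>t. cnj (f t))"
proof -
  assume f: "square_integrable f"
  have [measurable]: "f \<in> borel_measurable borel" using f by (simp add: square_integrable_def)
  have [measurable]: "cnj \<in> borel_measurable borel"
    by (intro borel_measurable_continuous_onI continuous_intros)
  have "(\<lambda>t. cnj (f t)) \<in> borel_measurable borel" by measurable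
  with f show ?thesis by (simp add: square_integrable_def)
qed

lemma integrable_hermite_gauss_fun: "integrable lborel (\<lambda>t. complex_of_real (hermite_gauss_fun n t))"
  unfolding of_real_hermite_gauss_fun by (intro integrable_mult_right integrable_gpoly) simp

context mp_element
begin

lemma norm_kernel [simp]: "cmod (kernel t s) = 1"
  by (simp only: kernel_def norm_chirp_factor)

lemma measurable_kernel [measurable]: "(\<lambda>x. kernel (fst x) (snd x)) \<in> borel_measurable (borel \<Otimes>\<^sub>M borel)"
  unfolding kernel_def by measurable

text \<open>In its other variable the kernel has the same form with \<open>a\<close> and
  \<open>d\<close> exchanged.\<close>

lemma kernel_gpoly_left:
  assumes "b \<noteq> 0"
  shows "kernel t s * gpoly 1 0 P t
    = exp (\<i> * of_real (a * s\<^sup>2 / (2 * b))) * gpoly (1 - \<i> * of_real (d / b)) (\<i> * of_real (s / b)) P t"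
proof -
  have "\<i> * complex_of_real ((d * t\<^sup>2 - 2 * t * s + a * s\<^sup>2) / (2 * b)) + (- 1 * (of_real t)\<^sup>2 / 2 - 0 * of_real t)
      = \<i> * of_real (a * s\<^sup>2 / (2 * b)) + (- (1 - \<i> * of_real (d / b)) * (of_real t)\<^sup>2 / 2 - \<i> * of_real (s / b) * of_real t)"
    using assms by (simp add: field_simps)
  then show ?thesis
    unfolding kernel_def gpoly_def by (simp only: mult.left_commute[of _ "poly P _"] exp_add[symmetric])
qed

text \<open>The transposed kernel yields a multiple of a rescaled Hermite polynomial times a
  Gaussian whose width has the positive real part \<open>1 / (b^2 + d^2)\<close>.\<close>

lemma square_integrable_transpose_hermite:
  assumes b: "b \<noteq> 0"
  shows "square_integrable (\<lambda>s. \<integral>t. kernel t s * of_real (hermite_gauss_fun m t) \<partial>lborel)"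
proof -
  define \<rho> where "\<rho> = cmod (Complex d b)"
  define w where "w = of_real b - \<i> * complex_of_real d"
  define C where "C = csqrt ((1 - \<i> * of_real (d / b)) / of_real (2 * pi))"
  define p where "p = 1 / (of_real b * w) - \<i> * of_real (a / b)"
  define Q where "Q = pcompose (hermC m) [:0, of_real (1 / \<rho>):]"
  have w0: "w \<noteq> 0" using b by (auto simp: w_def complex_eq_iff)
  have b0: "complex_of_real b \<noteq> 0" using b by simp
  have "Re p = b\<^sup>2 / ((b * b)\<^sup>2 + (b * d)\<^sup>2)"
    by (simp add: p_def w_def Re_divide power2_eq_square algebra_simps)
  also have "\<dots> > 0" using b by (intro divide_pos_pos add_pos_nonneg) auto
  finally have p: "0 < Re p" .
  have "1 - \<i> * complex_of_real (d / b) \<noteq> 0" by (simp add: complex_eq_iff)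
  then have C0: "C \<noteq> 0" unfolding C_def csqrt_eq_0 divide_eq_0_iff by simp
  have "(\<integral>t. kernel t s * of_real (hermite_gauss_fun m t) \<partial>lborel)
      = of_real (hermite_norm m) * (Complex d (- b) / of_real \<rho>) ^ m / C * gpoly p 0 Q s" for s
  proof -
    define I where "I = (\<integral>t. gpoly (1 - \<i> * of_real (d / b)) (\<i> * of_real (s / b)) (hermC m) t \<partial>lborel)"
    have CI: "C * I = exp (- (of_real s)\<^sup>2 / (2 * of_real b * w)) * (Complex d (- b) / of_real \<rho>) ^ m * poly (hermC m) (of_real (1 / \<rho> * s))"
      unfolding C_def I_def \<rho>_def w_def by (rule kernel_integral_hermite[OF b])
    have "I = C * I / C" using C0 by simp
    then have I: "I = (Complex d (- b) / of_real \<rho>) ^ m / C * (exp (- (of_real s)\<^sup>2 / (2 * of_real b * w)) * poly (hermC m) (of_real (1 / \<rho> * s)))"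
      unfolding CI by (simp add: mult_ac)
    have "(\<integral>t. kernel t s * of_real (hermite_gauss_fun m t) \<partial>lborel)
        = (\<integral>t. of_real (hermite_norm m) * (kernel t s * gpoly 1 0 (hermC m) t) \<partial>lborel)"
      unfolding of_real_hermite_gauss_fun by (simp add: mult_ac)
    also have "\<dots> = of_real (hermite_norm m) * exp (\<i> * of_real (a * s\<^sup>2 / (2 * b))) * I"
      unfolding kernel_gpoly_left[OF b] I_def by simp
    also have "\<dots> = of_real (hermite_norm m) * (Complex d (- b) / of_real \<rho>) ^ m / C *
        ((exp (\<i> * of_real (a * s\<^sup>2 / (2 * b))) * exp (- (of_real s)\<^sup>2 / (2 * of_real b * w))) * poly (hermC m) (of_real (1 / \<rho> * s)))"
      unfolding I by (simp add: mult_ac)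
    also have "exp (\<i> * of_real (a * s\<^sup>2 / (2 * b))) * exp (- (of_real s)\<^sup>2 / (2 * of_real b * w)) = exp (- p * (of_real s)\<^sup>2 / 2 - 0 * of_real s)"
    proof -
      have "\<i> * (A * T / (2 * B)) + - T / (2 * B * w) = - (1 / (B * w) - \<i> * (A / B)) * T / 2 - 0 * of_real s"
        if "B \<noteq> 0" for A B T :: complex
        using that w0 by (simp add: field_simps)
      from this[OF b0, of "of_real a" "(of_real s)\<^sup>2"] show ?thesis
        unfolding exp_add[symmetric] p_def of_real_divide of_real_mult of_real_power of_real_numeral
        by (simp only:)
    qed
    also have "exp (- p * (of_real s)\<^sup>2 / 2 - 0 * of_real s) * poly (hermC m) (of_real (1 / \<rho> * s)) = gpoly p 0 Q s"
      unfolding gpoly_def Q_def by (simp add: poly_pcompose mult_ac)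
    finally show ?thesis .
  qed
  then show ?thesis
    by (simp only:) (intro square_integrable_cmult square_integrable_gpoly p)
qed

text \<open>For fixed \<open>m\<close> the pairing with the transform is represented by a
  square-integrable \<open>k\<close>, hence is continuous in \<open>f\<close> for the norm of
  \<open>l2\<close>, without an estimate of \<open>lct (M, \<epsilon>) f\<close> itself.\<close>

lemma transpose_lct:
  obtains k where "square_integrable k"
    "\<And>f. square_integrable f \<Longrightarrow> integrable lborel f \<Longrightarrow>
      (\<integral>t. of_real (hermite_gauss_fun m t) * lct (M, \<epsilon>) f t \<partial>lborel) = (\<integral>s. cnj (k s) * f s \<partial>lborel)"
proof (cases "b = 0")
  case True
  have ad: "a * d = 1" using det_eq_1 True by simp
  then have a0: "a \<noteq> 0" by auto
  \<comment> \<open>Read off from the substitution \<open>t = a * s\<close>, which undoes the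
    argument \<open>d * t\<close> since \<open>a * d = 1\<close>.\<close>
  define k where "k = (\<lambda>s. of_real \<bar>a\<bar> / cnj \<epsilon> * (exp (\<i> * of_real (- (c * a) * s\<^sup>2 / 2)) * of_real (hermite_gauss_fun m (a * s))))"
  have k: "square_integrable k"
    unfolding k_def using square_integrable_scale[OF square_integrable_hermite_gauss_fun[of m] a0]
    by (intro square_integrable_cmult)
  have "(\<integral>t. of_real (hermite_gauss_fun m t) * lct (M, \<epsilon>) f t \<partial>lborel) = (\<integral>s. cnj (k s) * f s \<partial>lborel)" for f
  proof -
    have "(\<integral>t. of_real (hermite_gauss_fun m t) * lct (M, \<epsilon>) f t \<partial>lborel)
        = \<bar>a\<bar> *\<^sub>R (\<integral>s. of_real (hermite_gauss_fun m (0 + a * s)) * lct (M, \<epsilon>) f (0 + a * s) \<partial>lborel)"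
      by (rule lborel_integral_real_affine[OF a0])
    also have "\<dots> = (\<integral>s. of_real \<bar>a\<bar> * (of_real (hermite_gauss_fun m (0 + a * s)) * lct (M, \<epsilon>) f (0 + a * s)) \<partial>lborel)"
      by (simp add: scaleR_conv_of_real)
    also have "\<dots> = (\<integral>s. cnj (k s) * f s \<partial>lborel)"
    proof (intro Bochner_Integration.integral_cong refl)
      fix s
      have 1: "d * (a * s) = s" using ad by (simp add: mult.assoc[symmetric] mult.commute[of d])
      have "c * d * (a * s)\<^sup>2 = (a * d) * (c * a * s\<^sup>2)" by (simp add: power2_eq_square mult_ac)
      then have 2: "c * d * (a * s)\<^sup>2 / 2 = c * a * s\<^sup>2 / 2" using ad by simp
      have 3: "cnj (exp (\<i> * of_real (- (c * a) * s\<^sup>2 / 2))) = exp (\<i> * of_real (c * a * s\<^sup>2 / 2))"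
        by (simp add: exp_cnj)
      show "of_real \<bar>a\<bar> * (of_real (hermite_gauss_fun m (0 + a * s)) * lct (M, \<epsilon>) f (0 + a * s)) = cnj (k s) * f s"
        unfolding k_def lct_b_zero[OF True] add_0 1 2 complex_cnj_mult 3 by (simp add: mult_ac)
    qed
    finally show ?thesis .
  qed
  with k show ?thesis by (rule that)
next
  case b: False
  define J where "J = (\<lambda>s. \<integral>t. kernel t s * of_real (hermite_gauss_fun m t) \<partial>lborel)"
  define k where "k = (\<lambda>s. cnj K * cnj (J s))"
  have "square_integrable k"
    unfolding k_def J_def by (intro square_integrable_cmult square_integrable_cnj square_integrable_transpose_hermite b)
  moreover have "(\<integral>t. of_real (hermite_gauss_fun m t) * lct (M, \<epsilon>) f t \<partial>lborel) = (\<integral>s. cnj (k s) * f s \<partial>lborel)"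
    if f: "integrable lborel f" for f
  proof -
    have [measurable]: "f \<in> borel_measurable borel" using borel_measurable_integrable[OF f] by simp
    define F where "F = (\<lambda>t s. of_real (hermite_gauss_fun m t) * (kernel t s * f s))"
    have nF: "norm (F t s) = \<bar>hermite_gauss_fun m t\<bar> * cmod (f s)" for t s
      by (simp add: F_def norm_mult)
    \<comment> \<open>The kernel has modulus 1, so the modulus of the integrand is a product of two
      integrable functions of separate variables.\<close>
    have "integrable (lborel \<Otimes>\<^sub>M lborel) (\<lambda>x. F (fst x) (snd x))"
    proof (rule lborel_pair.Fubini_integrable)
      show "(\<lambda>x. F (fst x) (snd x)) \<in> borel_measurable (lborel \<Otimes>\<^sub>M lborel)"
        unfolding F_def by measurable
      have "integrable lborel (\<lambda>t. \<bar>hermite_gauss_fun m t\<bar>)"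
        using integrable_norm[OF integrable_hermite_gauss_fun[of m]] by simp
      then show "integrable lborel (\<lambda>t. \<integral>s. norm (F (fst (t, s)) (snd (t, s))) \<partial>lborel)"
        by (simp add: nF)
      show "AE t in lborel. integrable lborel (\<lambda>s. F (fst (t, s)) (snd (t, s)))"
      proof (intro AE_I2)
        fix t
        have "integrable lborel (\<lambda>s. kernel t s * f s)"
        proof (rule Bochner_Integration.integrable_bound[OF f])
          show "(\<lambda>s. kernel t s * f s) \<in> borel_measurable lborel" unfolding kernel_def by measurable
        qed (simp add: norm_mult)
        then show "integrable lborel (\<lambda>s. F (fst (t, s)) (snd (t, s)))" by (simp add: F_def)
      qed
    qed
    then have "integrable (lborel \<Otimes>\<^sub>M lborel) (\<lambda>(t, s). F t s)" by (simp add: case_prod_beta')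
    from lborel_pair.Fubini_integral[OF this]
    have swap: "(\<integral>t. \<integral>s. F t s \<partial>lborel \<partial>lborel) = (\<integral>s. \<integral>t. F t s \<partial>lborel \<partial>lborel)" ..
    have "(\<integral>t. of_real (hermite_gauss_fun m t) * lct (M, \<epsilon>) f t \<partial>lborel) = K * (\<integral>t. \<integral>s. F t s \<partial>lborel \<partial>lborel)"
      unfolding lct_b_nonzero[OF b] F_def by (simp add: mult.left_commute[of _ K])
    also have "\<dots> = K * (\<integral>s. f s * J s \<partial>lborel)"
      unfolding swap by (simp add: F_def J_def mult_ac)
    also have "\<dots> = (\<integral>s. cnj (k s) * f s \<partial>lborel)"
      unfolding Bochner_Integration.integral_mult_right_zero[symmetric]
      by (intro Bochner_Integration.integral_cong refl) (simp add: k_def mult_ac)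
    finally show ?thesis .
  qed
  ultimately show ?thesis by (rule that)
qed

lemma measurable_lct:
  assumes [measurable]: "f \<in> borel_measurable borel"
  shows "lct (M, \<epsilon>) f \<in> borel_measurable borel"
proof (cases "b = 0")
  case True
  then have "lct (M, \<epsilon>) f = (\<lambda>t. exp (\<i> * of_real (c * d * t\<^sup>2 / 2)) * f (d * t) / \<epsilon>)"
    by (simp add: fun_eq_iff lct_b_zero)
  then show ?thesis by (simp only:) measurable
next
  case False
  have "(\<lambda>t. \<integral>s. kernel t s * f s \<partial>lborel) \<in> borel_measurable borel"
    by (rule lborel.borel_measurable_lebesgue_integral) (simp add: case_prod_beta')
  then show ?thesis
    using lct_b_nonzero[OF False, of f] by (simp add: fun_eq_iff[symmetric] cong: measurable_cong)
qed

text \<open>For \<open>b = 0\<close> the transform of \<open>f\<close> is square integrable, for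
  \<open>b \<noteq> 0\<close> it is bounded by a multiple of the integral of
  \<open>cmod (f s)\<close>; the two assumptions on \<open>w\<close> serve these two cases.\<close>

lemma integrable_mult_lct:
  assumes w: "square_integrable w" "integrable lborel w"
    and f: "square_integrable f" "integrable lborel f"
  shows "integrable lborel (\<lambda>t. w t * lct (M, \<epsilon>) f t)"
proof (cases "b = 0")
  case True
  then have d0: "d \<noteq> 0" using det_eq_1 by auto
  have "square_integrable (\<lambda>t. 1 / \<epsilon> * (exp (\<i> * of_real (c * d * t\<^sup>2 / 2)) * f (d * t)))"
    by (intro square_integrable_cmult square_integrable_scale f d0)
  then have "square_integrable (lct (M, \<epsilon>) f)"
    unfolding lct_b_zero[OF True, abs_def] by simp
  from square_integrable_cnj_mult[OF square_integrable_cnj[OF w(1)] this] show ?thesis by simp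
next
  case False
  have [measurable]: "w \<in> borel_measurable borel" "f \<in> borel_measurable borel"
    using w f by (auto simp: square_integrable_def)
  note [measurable] = measurable_lct
  have bound: "cmod (lct (M, \<epsilon>) f t) \<le> cmod K * (\<integral>s. cmod (f s) \<partial>lborel)" for t
  proof -
    have "cmod (\<integral>s. kernel t s * f s \<partial>lborel) \<le> (\<integral>s. cmod (kernel t s * f s) \<partial>lborel)"
      by (rule integral_norm_bound)
    then show ?thesis
      unfolding lct_b_nonzero[OF False] norm_mult by (simp add: mult_left_mono)
  qed
  have "integrable lborel (\<lambda>t. (cmod K * (\<integral>s. cmod (f s) \<partial>lborel)) * cmod (w t))"
    by (intro integrable_mult_right Bochner_Integration.integrable_norm w)
  then show ?thesis
  proof (rule Bochner_Integration.integrable_bound[OF _ _ always_eventually[OF allI]])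
    fix t
    have "cmod (lct (M, \<epsilon>) f t) * cmod (w t) \<le> (cmod K * (\<integral>s. cmod (f s) \<partial>lborel)) * cmod (w t)"
      by (intro mult_right_mono bound) simp
    then show "norm (w t * lct (M, \<epsilon>) f t) \<le> norm ((cmod K * (\<integral>s. cmod (f s) \<partial>lborel)) * cmod (w t))"
      by (simp add: norm_mult mult.commute abs_mult)
  qed measurable
qed

section \<open>Identification of the metaplectic operator with a map between bases\<close>

definition chirped :: "nat \<Rightarrow> l2" where
  "chirped n = abs_l2 (chirp scale chirp_rate (\<lambda>t. of_real (hermite_gauss_fun n t)))"

definition basis :: "nat \<Rightarrow> l2" where
  "basis n = cscale (phase n) (chirped n)"

lemma orthonormal_basis_basis: "orthonormal_basis basis"
  unfolding basis_def[abs_def] chirped_def[abs_def]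
  by (intro orthonormal_basis_phase orthonormal_basis_chirp scale_pos cmod_phase)

lemma basis_eq_lct: "square_integrable (lct (M, \<epsilon>) (\<lambda>t. of_real (hermite_gauss_fun n t)))"
  "basis n = abs_l2 (lct (M, \<epsilon>) (\<lambda>t. of_real (hermite_gauss_fun n t)))"
proof -
  have sq: "square_integrable (chirp scale chirp_rate (\<lambda>t. of_real (hermite_gauss_fun n t)))"
    using scale_pos by (intro square_integrable_chirp square_integrable_hermite_gauss_fun) simp
  have eq: "lct (M, \<epsilon>) (\<lambda>t. of_real (hermite_gauss_fun n t)) = (\<lambda>t. phase n * chirp scale chirp_rate (\<lambda>t. of_real (hermite_gauss_fun n t)) t)"
    by (rule ext) (rule lct_hermite)
  show "square_integrable (lct (M, \<epsilon>) (\<lambda>t. of_real (hermite_gauss_fun n t)))"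
    unfolding eq by (rule square_integrable_cmult[OF sq])
  show "basis n = abs_l2 (lct (M, \<epsilon>) (\<lambda>t. of_real (hermite_gauss_fun n t)))"
    unfolding eq abs_l2_cmult[OF sq] basis_def chirped_def ..
qed

definition U :: "l2 \<Rightarrow> l2" where "U = basis_map hermite_gauss basis"

lemmas unitary_U = unitary_basis_map[OF orthonormal_basis_hermite_gauss orthonormal_basis_basis, folded U_def]
lemmas U_hermite = basis_map_basis[OF orthonormal_basis_hermite_gauss orthonormal_basis_basis, folded U_def]
lemmas coeff_U = coeff_basis_map[OF orthonormal_basis_hermite_gauss orthonormal_basis_basis, folded U_def]

text \<open>Both sides have the same Hermite coefficients: pairing with a Hermite--Gauss function is \<open>L\<^sup>2\<close>-continuous
  also on the right-hand side, by the transposed transform, and on the Hermite--Gauss functions themselves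
  the two sides agree.\<close>

lemma U_eq_lct:
  assumes f: "square_integrable f" "integrable lborel f"
  shows "AE t in lborel. rep_l2 (U (abs_l2 f)) t = lct (M, \<epsilon>) f t"
proof -
  define g where "g = rep_l2 (U (abs_l2 f))"
  have g: "square_integrable g" by (simp add: g_def square_integrable_rep)
  have [measurable]: "g \<in> borel_measurable borel" "f \<in> borel_measurable borel"
    using g f by (auto simp: square_integrable_def)
  note [measurable] = measurable_lct
  have coeff: "(\<integral>t. of_real (hermite_gauss_fun m t) * lct (M, \<epsilon>) f t \<partial>lborel) = (\<integral>t. of_real (hermite_gauss_fun m t) * g t \<partial>lborel)" for m
  proof -
    have pair: "cinner (hermite_gauss m) (abs_l2 h) = (\<integral>t. of_real (hermite_gauss_fun m t) * h t \<partial>lborel)"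
      if "square_integrable h" for h
      unfolding hermite_gauss_def cinner_abs[OF square_integrable_hermite_gauss_fun that] by simp
    obtain k where k: "square_integrable k"
      and tr: "\<And>f. square_integrable f \<Longrightarrow> integrable lborel f \<Longrightarrow>
        (\<integral>t. of_real (hermite_gauss_fun m t) * lct (M, \<epsilon>) f t \<partial>lborel) = cinner (abs_l2 k) (abs_l2 f)"
      using transpose_lct[of m] by (metis cinner_abs)
    obtain y where y: "hermite_gauss m = U y"
      using unitary_U by (metis surjD unitary_operator_def)
    have Uy: "cinner (hermite_gauss m) (U F) = cinner y F" for F
      using unitary_U by (simp add: y unitary_operator_def)
    \<comment> \<open>\<open>y\<close> is the image of \<open>hermite_gauss m\<close> under the
      adjoint of \<open>U\<close>, and \<open>k\<close> has this role for the integral transform;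
      they agree because \<open>U\<close> and \<open>lct\<close> agree on the Hermite-Gauss
      functions.\<close>
    have "abs_l2 k = y"
    proof (rule hg.coeff_eqI)
      fix n
      have "cinner (abs_l2 k) (hermite_gauss n) = cinner (hermite_gauss m) (basis n)"
        unfolding basis_eq_lct(2) pair[OF basis_eq_lct(1)]
        by (simp add: tr square_integrable_hermite_gauss_fun integrable_hermite_gauss_fun hermite_gauss_def)
      also have "\<dots> = cinner y (hermite_gauss n)"
        unfolding U_hermite[symmetric] Uy ..
      finally show "cinner (hermite_gauss n) (abs_l2 k) = cinner (hermite_gauss n) y"
        by (metis cinner_commute)
    qed
    then have "cinner (abs_l2 k) (abs_l2 f) = cinner (hermite_gauss m) (abs_l2 g)"
      by (simp add: Uy[symmetric] g_def abs_rep_l2)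
    then show ?thesis unfolding tr[OF f] pair[OF g] .
  qed
  have "AE t in lborel. g t - lct (M, \<epsilon>) f t = 0"
  proof (rule AE_eq_0_of_hermite_coeffs)
    fix c' :: real
    let ?w = "\<lambda>t. complex_of_real (exp (c' * \<bar>t\<bar> - t\<^sup>2 / 2))"
    have w: "square_integrable ?w" by (rule square_integrable_exp_abs_gaussian)
    have "integrable lborel ?w"
    proof -
      have "integrable lborel (\<lambda>t. exp ((c' + 1)\<^sup>2) * exp (- (1/4) * t\<^sup>2))"
        by (intro integrable_mult_right integrable_gaussian) simp
      then show ?thesis
      proof (rule Bochner_Integration.integrable_bound[OF _ _ always_eventually[OF allI]])
        show "norm (?w t) \<le> norm (exp ((c' + 1)\<^sup>2) * exp (- (1/4) * t\<^sup>2))" for t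
          using power_exp_le_gaussian[of 1 t 0 c'] by simp
      qed measurable
    qed
    then have "integrable lborel (\<lambda>t. ?w t * lct (M, \<epsilon>) f t)" by (intro integrable_mult_lct w f)
    moreover have "integrable lborel (\<lambda>t. ?w t * g t)"
      using square_integrable_cnj_mult[OF w g] by simp
    ultimately show "integrable lborel (\<lambda>t. ?w t * (g t - lct (M, \<epsilon>) f t))"
      unfolding right_diff_distrib by (intro Bochner_Integration.integrable_diff)
  next
    fix n
    have "integrable lborel (\<lambda>t. of_real (hermite_gauss_fun n t) * lct (M, \<epsilon>) f t)"
      by (intro integrable_mult_lct f square_integrable_hermite_gauss_fun integrable_hermite_gauss_fun)
    moreover have "integrable lborel (\<lambda>t. of_real (hermite_gauss_fun n t) * g t)"
      using square_integrable_cnj_mult[OF square_integrable_hermite_gauss_fun g] by simp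
    ultimately show "(\<integral>t. of_real (hermite_gauss_fun n t) * (g t - lct (M, \<epsilon>) f t) \<partial>lborel) = 0"
      unfolding right_diff_distrib by (subst Bochner_Integration.integral_diff) (simp_all add: coeff)
  qed measurable
  then show ?thesis unfolding g_def by eventually_elim simp
qed

text \<open>The Hermite-Gauss functions are integrable, so any admissible unitary operator takes the
  values \<open>basis n\<close> on them, and unitarity then fixes all its coefficients.\<close>

lemma metaplectic_eq_U: "metaplectic (M, \<epsilon>) = U"
  unfolding metaplectic_def
proof (rule the_equality, intro conjI allI impI)
  show "unitary_operator U" by (rule unitary_U)
  show "AE t in lborel. rep_l2 (U (abs_l2 f)) t = lct (M, \<epsilon>) f t"
    if "square_integrable f" "integrable lborel f" for f
    using that by (rule U_eq_lct)
  fix U' assume U': "unitary_operator U' \<and> (\<forall>f. square_integrable f \<longrightarrow> integrable lborel f \<longrightarrow>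
      (AE t in lborel. rep_l2 (U' (abs_l2 f)) t = lct (M, \<epsilon>) f t))"
  interpret B: onb basis by unfold_locales (rule orthonormal_basis_basis)
  have U'_hermite: "U' (hermite_gauss n) = basis n" for n
  proof -
    have "abs_l2 (rep_l2 (U' (hermite_gauss n))) = abs_l2 (lct (M, \<epsilon>) (\<lambda>t. of_real (hermite_gauss_fun n t)))"
      using U' unfolding hermite_gauss_def
      by (intro abs_l2_eqI square_integrable_rep basis_eq_lct)
         (simp add: square_integrable_hermite_gauss_fun integrable_hermite_gauss_fun)
    then show ?thesis by (simp add: abs_rep_l2 basis_eq_lct(2))
  qed
  show "U' = U"
  proof (rule ext, rule B.coeff_eqI)
    fix F n
    have "cinner (U' (hermite_gauss n)) (U' F) = cinner (hermite_gauss n) F"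
      using U' by (simp add: unitary_operator_def)
    then show "cinner (basis n) (U' F) = cinner (basis n) (U F)"
      by (simp add: U'_hermite coeff_U)
  qed
qed

end

section \<open>Operators commuting with the oscillator group\<close>

text \<open>Stated for an arbitrary basis, so that it serves the Hermite-Gauss functions and their
  images under \<open>V\<close> alike.\<close>

lemma (in onb) commute_imp_function_of_number_op:
  assumes R: "covariance_operator R"
    and U: "\<And>\<theta> f g. cinner (U \<theta> f) (U \<theta> g) = cinner f g"
      "\<And>\<theta> n. U \<theta> (e n) = cscale (exp (- \<i> * (of_nat n + 1 / 2) * of_real \<theta>)) (e n)"
    and comm: "\<And>\<theta>. R \<circ> U \<theta> = U \<theta> \<circ> R"
  shows "is_function_of R number_op \<and> KLT R e"
proof
  define l where "l = (\<lambda>n. cinner (e n) (R (e n)))"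
  have "bounded_clinear R" and sa: "cinner (R f) g = cinner f (R g)" for f g
    using R by (simp_all add: covariance_operator_def compact_operator_def self_adjoint_def)
  from commute_imp_eigenvector[OF this(1) U(1) U(2) comm]
  have eig: "R (e n) = cscale (l n) (e n)" for n by (simp add: l_def)
  show "KLT R e"
    unfolding KLT_def using onb eig by blast
  \<comment> \<open>Self-adjointness makes the eigenvalues real, and moving \<open>R\<close> to the
    left factor then gives every coefficient of \<open>R f\<close>.\<close>
  have "cnj (l n) = l n" for n
    using sa[of "e n" "e n"] cinner_commute[of "R (e n)" "e n"] by (simp add: l_def)
  then have coeff: "cinner (e n) (R f) = l n * cinner (e n) f" for n f
    by (simp add: sa[symmetric] eig cinner_cscale_left)
  \<comment> \<open>A step function with value \<open>l n\<close> on \<open>[n, n + 1)\<close>,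
    around the spectral point \<open>n + 1/2\<close>; negative reals, which lie off the spectrum,
    get the default \<open>l 0\<close>.\<close>
  define \<phi> where "\<phi> = (\<lambda>x::real. l (nat \<lfloor>x\<rfloor>))"
  have "\<phi> (real n + 1 / 2) = l n" for n
  proof -
    have "\<lfloor>real n + 1 / 2\<rfloor> = int n" by (rule floor_unique) auto
    then show ?thesis by (simp add: \<phi>_def)
  qed
  then have "cinner (e n) (R f) = \<phi> (real n + 1 / 2) * cinner (e n) f" for n f
    by (simp add: coeff)
  moreover have "\<phi> \<in> borel_measurable borel"
    unfolding \<phi>_def by (rule measurable_compose[OF measurable_real_floor]) simp
  ultimately show "is_function_of R number_op"
    unfolding is_function_of_def using functional_calculus_number_op by blast
qed

section \<open>Conjugation by a unitary operator\<close>

context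
  fixes V :: "l2 \<Rightarrow> l2"
  assumes V: "unitary_operator V"
begin

lemma unitary_cinner: "cinner (V f) (V g) = cinner f g"
  using V by (simp add: unitary_operator_def)

lemma unitary_surj: "V (inv V f) = f"
  using V by (simp add: unitary_operator_def surj_f_inv_f)

lemma unitary_inv_left: "inv V (V f) = f"
proof -
  have "inj V"
  proof (rule injI)
    fix f g assume "V f = V g"
    have "bounded_linear V" using V by (simp add: unitary_operator_def bounded_clinear_def)
    then have "V (f - g) = V f - V g" by (intro linear_diff bounded_linear.linear)
    with \<open>V f = V g\<close> have "cinner (V (f - g)) (V (f - g)) = 0" by simp
    then have "cinner (f - g) (f - g) = 0" unfolding unitary_cinner .
    then show "f = g" by (simp add: cinner_norm)
  qed
  then show ?thesis by (rule inv_f_f)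
qed

lemma orthonormal_basis_unitary:
  assumes e: "orthonormal_basis e"
  shows "orthonormal_basis (\<lambda>n. V (e n))"
proof -
  interpret onb e by unfold_locales (rule e)
  show ?thesis
  proof (rule orthonormal_basisI)
    show "cinner (V (e m)) (V (e n)) = (if m = n then 1 else 0)" for m n
      by (simp add: unitary_cinner cinner_basis)
    fix f assume "\<And>n. cinner (V (e n)) f = 0"
    then have "cinner (e n) (inv V f) = 0" for n
      using unitary_cinner[of "e n" "inv V f"] by (simp add: unitary_surj)
    then have "inv V f = 0" by (intro coeff_eqI) simp
    then have "f = V 0" using unitary_surj[of f] by simp
    then show "f = 0"
      using unitary_cinner[of 0 0] by (simp add: cinner_norm)
  qed
qed

text \<open>Conjugation transports the basis and keeps the entries, so the conjugated oscillator has
  the same form in the basis \<open>V (e n)\<close>.\<close>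

lemma conj_graph_diag_graph:
  assumes e: "orthonormal_basis e"
  shows "conj_graph V (onb.diag_graph e a) = onb.diag_graph (\<lambda>n. V (e n)) a"
proof -
  interpret e: onb e by unfold_locales (rule e)
  interpret Ve: onb "\<lambda>n. V (e n)" by unfold_locales (rule orthonormal_basis_unitary[OF e])
  have "(V f, V g) \<in> Ve.diag_graph a \<longleftrightarrow> (f, g) \<in> e.diag_graph a" for f g
    by (simp add: e.diag_graph_def Ve.diag_graph_def unitary_cinner)
  then show ?thesis
    unfolding conj_graph_def using unitary_surj by (auto; metis)
qed

end

section \<open>The elliptic group\<close>

lemma elliptic_in_Mp2: "elliptic \<theta> \<in> Mp2"
proof -
  have "(cis (\<theta> / 2))\<^sup>2 = Complex (cos \<theta>) (sin \<theta>)"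
    by (simp add: Complex.DeMoivre complex_eq_iff)
  moreover have "vector [vector [cos \<theta>, sin \<theta>], vector [- sin \<theta>, cos \<theta>]] \<in> Sp2"
    using sin_cos_squared_add[of \<theta>]
    by (simp add: Sp2_def vec_eq_iff forall_2 matrix_matrix_mult_def transpose_def sum_2 symplectic_form_def
        power2_eq_square algebra_simps)
  ultimately show ?thesis by (simp add: Mp2_def elliptic_def)
qed

lemma unitary_metaplectic:
  assumes "g \<in> Mp2"
  shows "unitary_operator (metaplectic g)"
proof -
  interpret mp_element "fst g" "snd g" by unfold_locales (use assms in simp)
  show ?thesis using unitary_U metaplectic_eq_U by simp
qed

text \<open>Here \<open>r = 1\<close>, the chirp rate is 0 and
  \<open>rot = cis (- \<theta>)\<close>. In the exponent \<open>n + 1/2\<close>, the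
  \<open>n\<close> comes from \<open>rot ^ n\<close> and the \<open>1/2\<close> from the lift
  \<open>cis (\<theta> / 2)\<close>.\<close>

lemma metaplectic_elliptic_hermite_gauss:
  "metaplectic (elliptic \<theta>) (hermite_gauss n) = cscale (exp (- \<i> * (of_nat n + 1 / 2) * of_real \<theta>)) (hermite_gauss n)"
proof -
  define M :: "real^2^2" where "M = vector [vector [cos \<theta>, sin \<theta>], vector [- sin \<theta>, cos \<theta>]]"
  have M: "elliptic \<theta> = (M, cis (\<theta> / 2))" by (simp add: elliptic_def M_def)
  interpret mp_element M "cis (\<theta> / 2)" by unfold_locales (use elliptic_in_Mp2[of \<theta>] M in simp)
  have entries: "M $ 1 $ 1 = cos \<theta>" "M $ 1 $ 2 = sin \<theta>" "M $ 2 $ 1 = - sin \<theta>" "M $ 2 $ 2 = cos \<theta>"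
    by (simp_all add: M_def)
  have r: "r = 1" by (simp add: r_def entries cmod_def)
  have "scale = 1" "chirp_rate = 0" by (simp_all add: scale_def chirp_rate_def r entries)
  then have "chirped n = hermite_gauss n"
    by (simp add: chirped_def hermite_gauss_def chirp_def[abs_def])
  moreover have "phase n = exp (- \<i> * (of_nat n + 1 / 2) * of_real \<theta>)"
  proof -
    have rot: "rot = cis (- \<theta>)" by (simp add: rot_def r entries complex_eq_iff)
    have "1 / cis (\<theta> / 2) = cis (- (\<theta> / 2))"
      using cis_divide[of 0 "\<theta> / 2"] by simp
    then have "phase n = cis (- (\<theta> / 2)) * cis (real n * - \<theta>)"
      unfolding phase_def r rot Complex.DeMoivre by simp
    also have "\<dots> = cis (- (real n + 1 / 2) * \<theta>)"
      by (simp add: cis_mult algebra_simps)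
    also have "\<dots> = exp (- \<i> * (of_nat n + 1 / 2) * of_real \<theta>)"
      unfolding cis_conv_exp by (rule arg_cong[where f = exp]) (simp add: algebra_simps)
    finally show ?thesis .
  qed
  ultimately show ?thesis
    unfolding M metaplectic_eq_U U_hermite basis_def by simp
qed

text \<open>Unitarity passes the eigenvalue equation to the other argument, so the operator is
  diagonal on every \<open>f\<close>, as the functional calculus requires.\<close>

lemma coeff_metaplectic_elliptic:
  "cinner (hermite_gauss n) (metaplectic (elliptic \<theta>) f) = exp (- \<i> * (of_nat n + 1 / 2) * of_real \<theta>) * cinner (hermite_gauss n) f"
proof -
  let ?c = "exp (- \<i> * (of_nat n + 1 / 2) * of_real \<theta>)"
  have "cnj ?c * cinner (hermite_gauss n) (metaplectic (elliptic \<theta>) f) = cinner (hermite_gauss n) f"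
    using unitary_cinner[OF unitary_metaplectic[OF elliptic_in_Mp2], of \<theta> "hermite_gauss n" f]
    unfolding metaplectic_elliptic_hermite_gauss cinner_cscale_left .
  then have "?c * cnj ?c * cinner (hermite_gauss n) (metaplectic (elliptic \<theta>) f) = ?c * cinner (hermite_gauss n) f"
    by (simp only: mult.assoc)
  moreover have one: "?c * cnj ?c = 1"
    by (subst complex_norm_square[symmetric]) (simp add: norm_exp_eq_Re)
  ultimately show ?thesis unfolding one mult_1 by simp
qed

theorem theorem5p1:
  fixes R :: "l2 \<Rightarrow> l2"
  assumes "covariance_operator R"
  shows
    "(\<forall>\<theta>. elliptic \<theta> \<in> Mp2 \<and>
        functional_calculus (\<lambda>x. exp (- \<i> * of_real \<theta> * of_real x)) H_ell
          (metaplectic (elliptic \<theta>))) \<and>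
     spectrum H_ell = {of_nat n + 1 / 2 | n. True} \<and>
     (\<forall>n. eigenspace H_ell (of_nat n + 1 / 2) = {cscale c (hermite_gauss n) | c. True}) \<and>
     orthonormal_basis hermite_gauss \<and>
     (\<forall>\<theta> n. metaplectic (elliptic \<theta>) (hermite_gauss n) =
        cscale (exp (- \<i> * (of_nat n + 1 / 2) * of_real \<theta>)) (hermite_gauss n)) \<and>
     ((\<forall>\<theta>. R \<circ> metaplectic (elliptic \<theta>) = metaplectic (elliptic \<theta>) \<circ> R) \<longrightarrow>
        is_function_of R H_ell \<and> KLT R hermite_gauss) \<and>
     (\<forall>V\<in>metaplectic_operators.
        (\<forall>\<theta>. R \<circ> (V \<circ> metaplectic (elliptic \<theta>) \<circ> inv V) =
              (V \<circ> metaplectic (elliptic \<theta>) \<circ> inv V) \<circ> R) \<longrightarrow>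
        is_function_of R (conj_graph V H_ell) \<and>
        KLT R (\<lambda>n. V (hermite_gauss n)) \<and>
        (\<forall>\<theta> n. (V \<circ> metaplectic (elliptic \<theta>) \<circ> inv V) (V (hermite_gauss n)) =
           cscale (exp (- \<i> * (of_nat n + 1 / 2) * of_real \<theta>)) (V (hermite_gauss n))) \<and>
        (\<exists>s>0. \<exists>\<kappa>. \<forall>n. \<exists>c. cmod c = 1 \<and>
           V (hermite_gauss n) = cscale c (abs_l2 (\<lambda>t.
             of_real (sqrt s) * exp (\<i> * of_real (\<kappa> * t\<^sup>2 / 2)) *
             of_real (hermite_gauss_fun n (s * t))))))"
proof (intro conjI allI ballI impI)
  fix \<theta> :: real and n :: nat
  show "elliptic \<theta> \<in> Mp2" by (rule elliptic_in_Mp2)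
  show "functional_calculus (\<lambda>x. exp (- \<i> * of_real \<theta> * of_real x)) H_ell (metaplectic (elliptic \<theta>))"
    unfolding H_ell_eq_number_op
  proof (rule hg.functional_calculus_number_op)
    show "(\<lambda>x. exp (- \<i> * of_real \<theta> * of_real x)) \<in> borel_measurable borel" by measurable
    show "cinner (hermite_gauss n) (metaplectic (elliptic \<theta>) f)
        = exp (- \<i> * of_real \<theta> * of_real (real n + 1 / 2)) * cinner (hermite_gauss n) f" for n f
      unfolding coeff_metaplectic_elliptic by (simp add: mult_ac)
  qed
  show "spectrum H_ell = {of_nat n + 1 / 2 | n. True}"
    unfolding H_ell_eq_number_op by (rule hg.spectrum_number_op)
  show "eigenspace H_ell (of_nat n + 1 / 2) = {cscale c (hermite_gauss n) | c. True}"
    unfolding H_ell_eq_number_op by (rule hg.eigenspace_number_op)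
  show "orthonormal_basis hermite_gauss" by (rule orthonormal_basis_hermite_gauss)
  show "metaplectic (elliptic \<theta>) (hermite_gauss n) =
      cscale (exp (- \<i> * (of_nat n + 1 / 2) * of_real \<theta>)) (hermite_gauss n)"
    by (rule metaplectic_elliptic_hermite_gauss)
next
  assume "\<forall>\<theta>. R \<circ> metaplectic (elliptic \<theta>) = metaplectic (elliptic \<theta>) \<circ> R"
  then have "is_function_of R H_ell \<and> KLT R hermite_gauss"
    unfolding H_ell_eq_number_op
    by (intro hg.commute_imp_function_of_number_op[OF assms, where U = "\<lambda>\<theta>. metaplectic (elliptic \<theta>)"]
          metaplectic_elliptic_hermite_gauss
          unitary_cinner[OF unitary_metaplectic[OF elliptic_in_Mp2]]) blast
  then show "is_function_of R H_ell" "KLT R hermite_gauss" by simp_all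
next
  fix V assume "V \<in> metaplectic_operators"
  then obtain M \<epsilon> where M: "(M, \<epsilon>) \<in> Mp2" "V = metaplectic (M, \<epsilon>)"
    by (auto simp: metaplectic_operators_def)
  then have uV: "unitary_operator V" by (simp add: unitary_metaplectic)
  note V = uV orthonormal_basis_hermite_gauss
  interpret Vh: onb "\<lambda>n. V (hermite_gauss n)"
    by unfold_locales (rule orthonormal_basis_unitary[OF V])
  show eig: "(V \<circ> metaplectic (elliptic \<theta>) \<circ> inv V) (V (hermite_gauss n)) =
      cscale (exp (- \<i> * (of_nat n + 1 / 2) * of_real \<theta>)) (V (hermite_gauss n))" for \<theta> n
    using uV by (simp only: comp_apply unitary_inv_left[OF uV] metaplectic_elliptic_hermite_gauss)
      (simp add: unitary_operator_def bounded_clinear_def)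
  assume comm: "\<forall>\<theta>. R \<circ> (V \<circ> metaplectic (elliptic \<theta>) \<circ> inv V) = (V \<circ> metaplectic (elliptic \<theta>) \<circ> inv V) \<circ> R"
  have iso: "cinner ((V \<circ> metaplectic (elliptic \<theta>) \<circ> inv V) f) ((V \<circ> metaplectic (elliptic \<theta>) \<circ> inv V) g) = cinner f g" for \<theta> f g
    using unitary_cinner[OF uV, of "inv V f" "inv V g"]
    by (simp add: unitary_cinner[OF uV] unitary_cinner[OF unitary_metaplectic[OF elliptic_in_Mp2]] unitary_surj[OF uV])
  have "is_function_of R (conj_graph V H_ell) \<and> KLT R (\<lambda>n. V (hermite_gauss n))"
    unfolding H_ell_eq_number_op conj_graph_diag_graph[OF V]
    by (rule Vh.commute_imp_function_of_number_op[OF assms iso eig]) (use comm in blast)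
  then show "is_function_of R (conj_graph V H_ell)" "KLT R (\<lambda>n. V (hermite_gauss n))" by simp_all
  \<comment> \<open>The witnesses for \<open>s\<close>, \<open>\<kappa>\<close> and \<open>c\<close>
    are \<open>scale\<close>, \<open>chirp_rate\<close> and \<open>phase n\<close>; the first two do
    not depend on \<open>n\<close>.\<close>
  interpret mp_element M \<epsilon> by unfold_locales (rule M)
  have "V (hermite_gauss n) = cscale (phase n) (abs_l2 (\<lambda>t. of_real (sqrt scale) *
      exp (\<i> * of_real (chirp_rate * t\<^sup>2 / 2)) * of_real (hermite_gauss_fun n (scale * t))))" for n
    unfolding M(2) metaplectic_eq_U U_hermite basis_def chirped_def chirp_def ..
  then show "\<exists>s>0. \<exists>\<kappa>. \<forall>n. \<exists>c. cmod c = 1 \<and>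
      V (hermite_gauss n) = cscale c (abs_l2 (\<lambda>t.
        of_real (sqrt s) * exp (\<i> * of_real (\<kappa> * t\<^sup>2 / 2)) * of_real (hermite_gauss_fun n (s * t))))"
    using scale_pos cmod_phase by blast
qed

end
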